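(* Let $d\ge1$ and let $\mathcal F$ be an iterated function system consisting of contractive similarities of $\mathbb R^d$ and satisfying the open set condition. Let $\mathcal K$ be its limit set and let $\mu$ be the restriction of the $s$-dimensional Hausdorff measure to $\mathcal K$, where $s=\dim_H(\mathcal K)$. Assume that $s>d-1$. Then $\alpha_\ell(\mu)\ge s-d+\ell$ for every $1\le\ell\le d$ and, hence, $$\dim_H\left(\mathrm{Sing}(d)\cap\mathcal K\right)\le s-\frac{d(s-d+1)}{d+1}.$$
   Context: **IFS.** An iterated function system (IFS) on $\mathbb R^d$ is a finite collection $\mathcal F=\{h_i:i\in\Lambda\}$ of maps $h_i(\mathbf x)=\rho_iO_i\mathbf x+b_i$ with $0<\rho_i<1$, $O_i\in \mathrm{SO}(d,\mathbb R)$, $b_i\in\mathbb R^d$. Its limit set is the unique nonempty compact set $\mathcal K\subset\mathbb R^d$ with $\mathcal K=\bigcup_{i\in\Lambda}h_i(\mathcal K)$. $\mathcal F$ satisfies the open set condition if there is a nonempty open $U\subset\mathbb R^d$ with $h_i(U)\subseteq U$ for all $i$ and $h_i(U)\cap h_j(U)=\emptyset$ for all $i\ne j$. **Singular vectors.** $\mathbf x\in\mathbb R^d$ is singular if for every $0<\varepsilon<1$ there is $N_0\in\mathbb N$ such that for all integers $N\ge N_0$ there is a non-zero $(p,\mathbf q)\in\mathbb Z\times\mathbb Z^d$ with $|\mathbf q\cdot\mathbf x+p|\le\varepsilon/N$ and $\|\mathbf q\|\le N^{1/d}$ (with $\|\cdot\|$ the supremum norm; any other norm gives the same notion). $\mathrm{Sing}(d)$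 is the set of singular vectors in $\mathbb R^d$. **The exponents $\alpha_\ell$.** For $0\le k\le d$, $\mathcal A(d,k)$ is the collection of all $k$-dimensional affine subspaces of $\mathbb R^d$; $\mathcal L^{(\varepsilon)}$ is the open Euclidean $\varepsilon$-neighborhood of $\mathcal L$. For a compactly supported Borel measure $\mu$ on $\mathbb R^d$ and $1\le\ell\le d$, $$\alpha_\ell(\mu)=\liminf_{\varepsilon\to0}\frac{\log\sup_{\mathcal L\in\mathcal A(d,d-\ell)}\mu(\mathcal L^{(\varepsilon)})}{\log\varepsilon}.$$ $\dim_H$ denotes Hausdorff dimension. *)

theory Defs
  imports "HOL-Analysis.Analysis"
begin

section \<open>Hausdorff measure and Hausdorff dimension\<close>

text \<open>
  The contribution of a covering set is \<open>diam(U)\<^sup>s\<close>, with the usual conventions that the empty set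
  contributes \<open>0\<close> and \<open>0\<^sup>0 = 1\<close>.  The latter must be spelled out because \<open>0 powr 0 = 0\<close>.
\<close>
definition hausdorff_gauge :: "real \<Rightarrow> 'a::metric_space set \<Rightarrow> ennreal" where
  "hausdorff_gauge s U =
     (if U = {} then 0 else if s = 0 then 1 else ennreal (diameter U powr s))"

text \<open>
  Boundedness of the covering sets is required separately: \<^const>\<open>diameter\<close> carries no information
  for unbounded sets.  Finite covers are included, since covering sets may be empty.
\<close>
definition hausdorff_premeasure :: "real \<Rightarrow> real \<Rightarrow> 'a::metric_space set \<Rightarrow> ennreal" where
  "hausdorff_premeasure s \<delta> A =
     (INF U \<in> {U :: nat \<Rightarrow> 'a set. A \<subseteq> (\<Union>n. U n) \<and> (\<forall>n. bounded (U n) \<and> diameter (U n) \<le> \<delta>)}.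
        \<Sum>n. hausdorff_gauge s (U n))"

definition hausdorff_outer_measure :: "real \<Rightarrow> 'a::metric_space set \<Rightarrow> ennreal" where
  "hausdorff_outer_measure s A = (SUP \<delta> \<in> {0<..}. hausdorff_premeasure s \<delta> A)"

text \<open>
  For \<open>s \<ge> 0\<close> the Hausdorff outer measure is a metric outer measure, hence countably additive on the
  Borel sets, so that \<^const>\<open>measure_of\<close> does not fall back to the zero measure here.
\<close>
definition hausdorff_measure :: "real \<Rightarrow> 'a::metric_space measure" where
  "hausdorff_measure s = measure_of UNIV (sets borel) (hausdorff_outer_measure s)"

definition hausdorff_dim :: "'a::metric_space set \<Rightarrow> ereal" where
  "hausdorff_dim A = (INF s \<in> {s :: real. 0 \<le> s \<and> hausdorff_outer_measure s A = 0}. ereal s)"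

text \<open>The restriction of a Borel measure to \<open>K\<close>, as a measure on the whole space:
  \<open>A \<mapsto> M (A \<inter> K)\<close>.\<close>
definition restrict_measure_to :: "'a measure \<Rightarrow> 'a set \<Rightarrow> 'a measure" where
  "restrict_measure_to M K = density M (indicator K)"


section \<open>Iterated function systems\<close>

definition is_IFS :: "'i set \<Rightarrow> ('i \<Rightarrow> real ^ 'd \<Rightarrow> real ^ 'd) \<Rightarrow> bool" where
  "is_IFS \<Lambda> h \<longleftrightarrow> finite \<Lambda> \<and>
     (\<forall>i\<in>\<Lambda>. \<exists>(\<rho>::real) (Q :: real ^ 'd ^ 'd) (b :: real ^ 'd).
        0 < \<rho> \<and> \<rho> < 1 \<and> rotation_matrix Q \<and> (\<forall>x. h i x = \<rho> *\<^sub>R (Q *v x) + b))"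

definition is_limit_set :: "'i set \<Rightarrow> ('i \<Rightarrow> real ^ 'd \<Rightarrow> real ^ 'd) \<Rightarrow> (real ^ 'd) set \<Rightarrow> bool" where
  "is_limit_set \<Lambda> h K \<longleftrightarrow> K \<noteq> {} \<and> compact K \<and> K = (\<Union>i\<in>\<Lambda>. h i ` K)"

definition open_set_condition :: "'i set \<Rightarrow> ('i \<Rightarrow> real ^ 'd \<Rightarrow> real ^ 'd) \<Rightarrow> bool" where
  "open_set_condition \<Lambda> h \<longleftrightarrow>
     (\<exists>U. open U \<and> U \<noteq> {} \<and> (\<forall>i\<in>\<Lambda>. h i ` U \<subseteq> U) \<and>
          (\<forall>i\<in>\<Lambda>. \<forall>j\<in>\<Lambda>. i \<noteq> j \<longrightarrow> h i ` U \<inter> h j ` U = {}))"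


section \<open>Singular vectors\<close>

definition real_vec :: "int ^ 'd \<Rightarrow> real ^ 'd" where
  "real_vec q = (\<chi> i. real_of_int (q $ i))"

definition singular_vector :: "real ^ 'd \<Rightarrow> bool" where
  "singular_vector x \<longleftrightarrow>
     (\<forall>\<epsilon>::real. 0 < \<epsilon> \<and> \<epsilon> < 1 \<longrightarrow>
       (\<exists>N0::nat. \<forall>N::nat. N \<ge> N0 \<longrightarrow>
         (\<exists>(p::int) (q :: int ^ 'd). (p, q) \<noteq> (0, 0) \<and>
            \<bar>real_vec q \<bullet> x + real_of_int p\<bar> \<le> \<epsilon> / real N \<and>
            infnorm (real_vec q) \<le> real N powr (1 / real CARD('d)))))"

definition Sing :: "(real ^ 'd) set" where
  "Sing = {x. singular_vector x}"


section \<open>The exponents \<open>\<alpha>\<^sub>\<ell>\<close>\<close>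

definition affine_subspaces :: "nat \<Rightarrow> 'a::euclidean_space set set" where
  "affine_subspaces k = {L. affine L \<and> aff_dim L = int k}"

definition open_nbhd :: "real \<Rightarrow> 'a::metric_space set \<Rightarrow> 'a set" where
  "open_nbhd \<epsilon> L = (\<Union>x\<in>L. ball x \<epsilon>)"

text \<open>The logarithm on \<open>[0,\<infinity>]\<close> with \<open>log 0 = -\<infinity>\<close>; the function \<^const>\<open>ln\<close> on the reals has
  \<open>ln 0 = 0\<close>.\<close>
definition ext_ln :: "ennreal \<Rightarrow> ereal" where
  "ext_ln x = (if x = 0 then - \<infinity> else if x = top then \<infinity> else ereal (ln (enn2real x)))"

definition alpha_exp :: "nat \<Rightarrow> (real ^ 'd) measure \<Rightarrow> ereal" where
  "alpha_exp l \<mu> =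
     Liminf (at_right (0::real))
       (\<lambda>\<epsilon>. ext_ln (SUP L \<in> affine_subspaces (CARD('d) - l). emeasure \<mu> (open_nbhd \<epsilon> L))
              / ereal (ln \<epsilon>))"

end

theory Submission
  imports Defs "HOL-Library.Sublist" "HOL-Real_Asymp.Real_Asymp"
begin

text \<open>
  The open set condition gives \<open>O(\<epsilon>\<^bsup>-k\<^esup>)\<close> cylinders of size \<open>\<epsilon>\<close> near a \<open>k\<close>-dimensional affine subspace, which
  yields the exponents \<open>\<alpha>\<^sub>\<ell>\<close>.

  For the singular vectors, transfer to simultaneous approximation: if \<open>x\<close> is singular, then at all small
  scales the moderately small vectors \<open>(q, q x - p)\<close> of the rescaled lattice lie in a rational
  hyperplane, because a very small linear form annihilates them. Let \<open>lam\<close> be the norm of a shortest such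
  vector. When passing to a random subcylinder of relative size \<open>r\<close>, the norm typically grows by
  \<open>r\<^bsup>-1/(d+1)\<^esup>\<close>. If the growth is smaller by a factor \<open>\<eta>\<close>, then the subcylinder is near one of the \<open>O(P\<^sup>d)\<close>
  rational points of height about \<open>P\<close> in a hyperplane, and also near that hyperplane. Together these two
  facts bound the probability by \<open>\<eta>\<^sup>c\<close>, where \<open>c = d (s - d + 1)\<close>, up to logarithms. Hence \<open>lam\<^bsup>-c\<^esup>\<close> contracts
  on average by \<open>r\<^bsup>c/(d+1)\<^esup>\<close>, while \<open>lam\<close> is bounded by Dirichlet's theorem. Summing over the
  cylinders that meet the singular set bounds the dimension by \<open>s - c/(d+1)\<close>.
\<close>

section \<open>Separated families and Hausdorff null sets\<close>

text \<open>Duality turns the obstruction into points: a vector with denominator q is small only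
  near p / q, and near a point the mass decays like \<sigma>^s, against \<sigma>^(s - d + 1) near a
  hyperplane. A lattice may have about P^(d+1) vectors of height up to P, and summing \<sigma>^s
  over them with \<sigma> about \<eta> / P grows with P. Trapping lowers the count to P^d, but
  P^(d-s) \<eta>^s still grows when s < d; the second bound, from the hyperplane carrying the
  points, removes this growth. At the exponent c each dyadic class of growth factors and heights
  contributes equally, so a squared logarithm of the step size is lost; any t > s - c / (d + 1)
  leaves a positive power that absorbs it. The mass is that of the weights
  \<open>rw u powr s\<close> on words. The link to dim K = s is \<Sum>\<rho>^s \<le> 1, which comes
  from a lower bound for covers of K. Constants are chosen in the order t, step size, trapping
  level, initial scale. Singularity supplies every trapping level, but with an initial scale that
  depends on the point, whence a countable union at the end.\<close>

text \<open>Pigeonhole on the rounded coordinates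
  \<open>\<lfloor>\<phi> i x / \<delta>\<rfloor>\<close>, which determine x by separation. The
  bounds \<open>M i\<close> may differ, so that boxes long in some directions and short in others
  are counted sharply.\<close>

lemma card_le_of_separated:
  fixes \<phi> :: "'b \<Rightarrow> 'a \<Rightarrow> real"
  assumes I: "finite I" and \<delta>: "0 < \<delta>" and M: "\<And>i. i \<in> I \<Longrightarrow> 0 \<le> M i"
    and bd: "\<And>x i. x \<in> X \<Longrightarrow> i \<in> I \<Longrightarrow> \<bar>\<phi> i x\<bar> \<le> M i"
    and sep: "\<And>x y. x \<in> X \<Longrightarrow> y \<in> X \<Longrightarrow> x \<noteq> y \<Longrightarrow> \<exists>i\<in>I. \<delta> \<le> \<bar>\<phi> i x - \<phi> i y\<bar>"
  shows "finite X" and "real (card X) \<le> (\<Prod>i\<in>I. 2 * M i / \<delta> + 2)"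
proof -
  define f where "f x = (\<lambda>i\<in>I. \<lfloor>\<phi> i x / \<delta>\<rfloor>)" for x
  let ?B = "\<lambda>i. {\<lfloor>- (M i / \<delta>)\<rfloor>..\<lfloor>M i / \<delta>\<rfloor>}"
  have inj: "inj_on f X"
  proof (rule inj_onI, rule ccontr)
    fix x y assume xy: "x \<in> X" "y \<in> X" "f x = f y" "x \<noteq> y"
    then obtain i where i: "i \<in> I" "\<delta> \<le> \<bar>\<phi> i x - \<phi> i y\<bar>" using sep by blast
    have "f x i = f y i" using xy by simp
    then have "\<lfloor>\<phi> i x / \<delta>\<rfloor> = \<lfloor>\<phi> i y / \<delta>\<rfloor>" using i by (simp add: f_def)
    then have "\<bar>\<phi> i x / \<delta> - \<phi> i y / \<delta>\<bar> < 1" by linarith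
    then have "\<bar>(\<phi> i x - \<phi> i y) / \<delta>\<bar> < 1" by (simp add: diff_divide_distrib)
    then show False using i \<delta> by (simp add: abs_divide field_simps)
  qed
  have img: "f ` X \<subseteq> PiE I ?B"
  proof (clarsimp simp: f_def)
    fix x i assume "x \<in> X" "i \<in> I"
    then have "\<bar>\<phi> i x\<bar> \<le> M i" using bd by simp
    then have "\<phi> i x \<le> M i" "- M i \<le> \<phi> i x" by linarith+
    then have "\<phi> i x / \<delta> \<le> M i / \<delta>" "- M i / \<delta> \<le> \<phi> i x / \<delta>"
      using \<delta> divide_right_mono less_imp_le by blast+
    then show "\<lfloor>- (M i / \<delta>)\<rfloor> \<le> \<lfloor>\<phi> i x / \<delta>\<rfloor> \<and> \<lfloor>\<phi> i x / \<delta>\<rfloor> \<le> \<lfloor>M i / \<delta>\<rfloor>"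
      by (simp add: floor_mono)
  qed
  have fin: "finite (PiE I ?B)" using I by (intro finite_PiE) auto
  then have "finite (f ` X)" using img finite_subset by blast
  then show X: "finite X" using inj finite_imageD by blast
  show "real (card X) \<le> (\<Prod>i\<in>I. 2 * M i / \<delta> + 2)"
  proof -
    have "card X = card (f ` X)" using inj card_image by metis
    also have "\<dots> \<le> card (PiE I ?B)" using fin img card_mono by blast
    also have "\<dots> = (\<Prod>i\<in>I. card (?B i))" using I by (simp add: card_PiE)
    finally have "real (card X) \<le> (\<Prod>i\<in>I. real (card (?B i)))" by (metis of_nat_le_iff of_nat_prod)
    also have "\<dots> \<le> (\<Prod>i\<in>I. 2 * M i / \<delta> + 2)"
    proof (rule prod_mono)
      fix i assume "i \<in> I"
      then have "0 \<le> M i / \<delta>" using M \<delta> by simp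
      then show "0 \<le> real (card (?B i)) \<and> real (card (?B i)) \<le> 2 * M i / \<delta> + 2"
        by (auto; linarith)
    qed
    finally show ?thesis .
  qed
qed

section \<open>Null sets and finite covers for the Hausdorff outer measure\<close>

lemma hausdorff_outer_measure_null_iff:
  fixes A :: "'a::metric_space set"
  shows "hausdorff_outer_measure s A = 0 \<longleftrightarrow> (\<forall>\<delta>>0. hausdorff_premeasure s \<delta> A = 0)"
  unfolding hausdorff_outer_measure_def by (auto simp: SUP_eq_iff)

lemma hausdorff_premeasure_null_iff:
  fixes A :: "'a::metric_space set"
  shows "hausdorff_premeasure s \<delta> A = 0 \<longleftrightarrow>
    (\<forall>e::real. 0 < e \<longrightarrow> (\<exists>U. A \<subseteq> (\<Union>n. U n) \<and> (\<forall>n::nat. bounded (U n) \<and> diameter (U n) \<le> \<delta>) \<and>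
       (\<Sum>n. hausdorff_gauge s (U n)) < ennreal e))" (is "?L \<longleftrightarrow> ?R")
proof
  assume L: ?L
  show ?R
  proof (intro allI impI)
    fix e :: real assume "0 < e"
    then have "hausdorff_premeasure s \<delta> A < ennreal e" using L by simp
    then show "\<exists>U. A \<subseteq> (\<Union>n. U n) \<and> (\<forall>n::nat. bounded (U n) \<and> diameter (U n) \<le> \<delta>) \<and>
       (\<Sum>n. hausdorff_gauge s (U n)) < ennreal e"
      unfolding hausdorff_premeasure_def by (auto simp: INF_less_iff)
  qed
next
  assume R: ?R
  have "hausdorff_premeasure s \<delta> A \<le> 0 + ennreal e" if e: "0 < e" for e
  proof -
    obtain U where U: "A \<subseteq> (\<Union>n. U n)" "\<forall>n::nat. bounded (U n) \<and> diameter (U n) \<le> \<delta>"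
       "(\<Sum>n. hausdorff_gauge s (U n)) < ennreal e" using R[rule_format, OF e] by (elim exE conjE)
    have "hausdorff_premeasure s \<delta> A \<le> (\<Sum>n. hausdorff_gauge s (U n))"
      unfolding hausdorff_premeasure_def using U by (intro INF_lower) auto
    then show ?thesis using U by simp
  qed
  then have "hausdorff_premeasure s \<delta> A \<le> 0" by (rule ennreal_le_epsilon)
  then show ?L by simp
qed

lemma hausdorff_outer_measure_mono:
  "A \<subseteq> B \<Longrightarrow> hausdorff_outer_measure s A \<le> hausdorff_outer_measure s B"
  unfolding hausdorff_outer_measure_def hausdorff_premeasure_def
  by (intro SUP_mono' INF_superset_mono) auto

lemma hausdorff_outer_measure_UN_null:
  fixes A :: "nat \<Rightarrow> 'a::metric_space set"
  assumes "\<And>m. hausdorff_outer_measure s (A m) = 0"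
  shows "hausdorff_outer_measure s (\<Union>m. A m) = 0"
  unfolding hausdorff_outer_measure_null_iff hausdorff_premeasure_null_iff
proof (intro allI impI)
  fix \<delta> e :: real assume \<delta>: "0 < \<delta>" and e: "0 < e"
  \<comment> \<open>The budgets add up to e / 2, so the strict bound by e survives the infinite
    sum.\<close>
  have "\<forall>m. \<exists>U. A m \<subseteq> (\<Union>n. U n) \<and> (\<forall>n::nat. bounded (U n) \<and> diameter (U n) \<le> \<delta>) \<and>
       (\<Sum>n. hausdorff_gauge s (U n)) < ennreal (e / 2 * (1/2)^Suc m)"
  proof
    fix m
    have "0 < e / 2 * (1/2)^Suc m" using e by simp
    then show "\<exists>U. A m \<subseteq> (\<Union>n. U n) \<and> (\<forall>n::nat. bounded (U n) \<and> diameter (U n) \<le> \<delta>) \<and>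
       (\<Sum>n. hausdorff_gauge s (U n)) < ennreal (e / 2 * (1/2)^Suc m)"
      using assms[of m] \<delta> unfolding hausdorff_outer_measure_null_iff hausdorff_premeasure_null_iff by blast
  qed
  then obtain U where U: "\<And>m. A m \<subseteq> (\<Union>n. U m n)" "\<And>m n::nat. bounded (U m n)" "\<And>m n. diameter (U m n) \<le> \<delta>"
    and Us: "\<And>m. (\<Sum>n. hausdorff_gauge s (U m n)) < ennreal (e / 2 * (1/2)^Suc m)" by metis
  let ?V = "\<lambda>k. case_prod U (prod_decode k)"
  have "(\<Union>m. A m) \<subseteq> (\<Union>k. ?V k)"
  proof
    fix x assume "x \<in> (\<Union>m. A m)"
    then obtain m n where "x \<in> U m n" using U(1) by blast
    then show "x \<in> (\<Union>k. ?V k)" by (intro UN_I[of "prod_encode (m, n)"]) simp_all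
  qed
  moreover have "\<forall>k. bounded (?V k) \<and> diameter (?V k) \<le> \<delta>" using U by (auto split: prod.split)
  moreover have "(\<Sum>k. hausdorff_gauge s (?V k)) < ennreal e"
  proof -
    have "(\<Sum>k. hausdorff_gauge s (?V k)) = (\<Sum>k. (\<lambda>(m,n). hausdorff_gauge s (U m n)) (prod_decode k))"
      by (intro arg_cong[where f=suminf] ext) (simp split: prod.split)
    also have "\<dots> = (\<Sum>m. \<Sum>n. hausdorff_gauge s (U m n))"
      by (rule suminf_ennreal_2dimen) simp
    also have "\<dots> \<le> (\<Sum>m. ennreal (e / 2) * ennreal ((1/2)^Suc m))"
      using Us e by (intro suminf_le) (auto simp flip: ennreal_mult intro: less_imp_le)
    also have "\<dots> = ennreal (e / 2)"
      unfolding ennreal_suminf_cmult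
      by (subst suminf_ennreal_eq[OF zero_le_power power_half_series]) auto
    also have "\<dots> < ennreal e" using e by (simp add: ennreal_lessI)
    finally show ?thesis .
  qed
  ultimately show "\<exists>U. (\<Union>m. A m) \<subseteq> (\<Union>n. U n) \<and> (\<forall>n::nat. bounded (U n) \<and> diameter (U n) \<le> \<delta>) \<and>
       (\<Sum>n. hausdorff_gauge s (U n)) < ennreal e" by blast
qed

lemma hausdorff_gauge_antimono:
  assumes "0 \<le> t" "t \<le> s" "bounded U" "diameter U \<le> 1"
  shows "hausdorff_gauge s U \<le> hausdorff_gauge t U"
proof -
  have "0 \<le> diameter U" using assms diameter_ge_0 by blast
  then show ?thesis using assms unfolding hausdorff_gauge_def
    by (auto intro!: powr_mono' simp: powr_le_one_le ennreal_le_1 powr_le1)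
qed

text \<open>Nullity holds at every mesh, so the mesh can be capped at 1; for diameters up to 1 the
  gauge decreases in the exponent.\<close>

lemma hausdorff_outer_measure_null_mono:
  fixes A :: "'a::metric_space set"
  assumes "hausdorff_outer_measure t A = 0" "0 \<le> t" "t \<le> s"
  shows "hausdorff_outer_measure s A = 0"
  unfolding hausdorff_outer_measure_null_iff hausdorff_premeasure_null_iff
proof (intro allI impI)
  fix \<delta> e :: real assume \<delta>: "0 < \<delta>" and e: "0 < e"
  then have "0 < min \<delta> 1" by simp
  then obtain U where U: "A \<subseteq> (\<Union>n. U n)" "\<And>n::nat. bounded (U n)" "\<And>n. diameter (U n) \<le> min \<delta> 1"
     and Us: "(\<Sum>n. hausdorff_gauge t (U n)) < ennreal e"
    using assms(1) e unfolding hausdorff_outer_measure_null_iff hausdorff_premeasure_null_iff by metis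
  have "(\<Sum>n. hausdorff_gauge s (U n)) \<le> (\<Sum>n. hausdorff_gauge t (U n))"
    using U assms by (intro suminf_le hausdorff_gauge_antimono) auto
  then show "\<exists>U. A \<subseteq> (\<Union>n. U n) \<and> (\<forall>n::nat. bounded (U n) \<and> diameter (U n) \<le> \<delta>) \<and>
       (\<Sum>n. hausdorff_gauge s (U n)) < ennreal e"
    using U Us by (intro exI[of _ U]) auto
qed

text \<open>A finite family becomes a sequence by padding with empty sets, whose gauge is 0. As s >
  0, the convention 0^0 = 1 does not interfere.\<close>

lemma hausdorff_outer_measure_le_of_finite_covers:
  fixes A :: "'a::metric_space set"
  assumes s: "0 < s"
    and cov: "\<And>\<delta>. 0 < \<delta> \<Longrightarrow> \<exists>T (V :: 'b \<Rightarrow> 'a set). finite T \<and> A \<subseteq> (\<Union>t\<in>T. V t) \<and>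
       (\<forall>t\<in>T. bounded (V t) \<and> diameter (V t) \<le> \<delta>) \<and> (\<Sum>t\<in>T. diameter (V t) powr s) \<le> c"
  shows "hausdorff_outer_measure s A \<le> ennreal c"
  unfolding hausdorff_outer_measure_def
proof (rule SUP_least)
  fix \<delta> :: real assume "\<delta> \<in> {0<..}"
  then have \<delta>: "0 < \<delta>" by simp
  obtain T and V :: "'b \<Rightarrow> 'a set" where T: "finite T" "A \<subseteq> (\<Union>t\<in>T. V t)"
       "\<And>t. t\<in>T \<Longrightarrow> bounded (V t) \<and> diameter (V t) \<le> \<delta>" "(\<Sum>t\<in>T. diameter (V t) powr s) \<le> c"
    using cov[OF \<delta>] by blast
  obtain f where f: "bij_betw f {..<card T} T"
    using T(1) ex_bij_betw_nat_finite lessThan_atLeast0 by metis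
  define U where "U n = (if n < card T then V (f n) else {})" for n
  have "hausdorff_premeasure s \<delta> A \<le> (\<Sum>n. hausdorff_gauge s (U n))"
    unfolding hausdorff_premeasure_def
  proof (rule INF_lower, clarsimp, intro conjI allI)
    show "A \<subseteq> (\<Union>n. U n)"
    proof
      fix x assume "x \<in> A"
      then obtain t where "t \<in> T" "x \<in> V t" using T by blast
      then obtain n where "n < card T" "f n = t" using f unfolding bij_betw_def by (metis imageE lessThan_iff)
      then have "x \<in> U n" using \<open>x \<in> V t\<close> by (simp add: U_def)
      then show "x \<in> (\<Union>n. U n)" by blast
    qed
    fix n
    have "f n \<in> T" if "n < card T" using f that bij_betwE by blast
    then show "bounded (U n)" "diameter (U n) \<le> \<delta>" using T \<delta> by (auto simp: U_def)
  qed
  also have "\<dots> = (\<Sum>n\<in>{..<card T}. hausdorff_gauge s (U n))"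
    by (rule suminf_finite) (auto simp: U_def hausdorff_gauge_def)
  also have "\<dots> \<le> (\<Sum>n\<in>{..<card T}. ennreal (diameter (V (f n)) powr s))"
    using s by (intro sum_mono) (auto simp: U_def hausdorff_gauge_def)
  also have "\<dots> = (\<Sum>t\<in>T. ennreal (diameter (V t) powr s))"
    using sum.reindex_bij_betw[OF f] .
  also have "\<dots> = ennreal (\<Sum>t\<in>T. diameter (V t) powr s)" by (rule sum_ennreal) simp
  also have "\<dots> \<le> ennreal c" using T by (intro ennreal_leI) simp
  finally show "hausdorff_premeasure s \<delta> A \<le> ennreal c" .
qed

section \<open>Words and cylinders\<close>

primrec word_map :: "('i \<Rightarrow> 'a \<Rightarrow> 'a) \<Rightarrow> 'i list \<Rightarrow> 'a \<Rightarrow> 'a" where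
  "word_map h [] = id"
| "word_map h (i # w) = h i \<circ> word_map h w"

text \<open>The letter weight is a parameter because two of them occur: the contraction ratios and
  their s-th powers, which play the part of Bernoulli weights.\<close>

definition word_prod :: "('i \<Rightarrow> real) \<Rightarrow> 'i list \<Rightarrow> real" where
  "word_prod p w = prod_list (map p w)"

lemma word_prod_simps [simp]:
  "word_prod p [] = 1" "word_prod p (i # w) = p i * word_prod p w"
  "word_prod p (u @ v) = word_prod p u * word_prod p v"
  by (simp_all add: word_prod_def)

lemma word_map_append: "word_map h (u @ v) = word_map h u \<circ> word_map h v"
  by (induction u) (auto simp: comp_assoc)

definition prefix_free :: "'i list set \<Rightarrow> bool" where
  "prefix_free T \<longleftrightarrow> (\<forall>u\<in>T. \<forall>v\<in>T. prefix u v \<longrightarrow> u = v)"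

lemma sum_words_split_first:
  fixes f :: "'i list \<Rightarrow> real"
  assumes "finite \<Lambda>" "finite T" "T \<subseteq> lists \<Lambda>" "[] \<notin> T"
  shows "(\<Sum>w\<in>T. f w) = (\<Sum>i\<in>\<Lambda>. \<Sum>w\<in>{w. i # w \<in> T}. f (i # w))"
proof -
  have T: "T = (\<Union>i\<in>\<Lambda>. (#) i ` {w. i # w \<in> T})"
  proof (intro equalityI subsetI)
    fix w assume "w \<in> T"
    then obtain i v where "w = i # v" "i \<in> \<Lambda>" using assms by (cases w) auto
    then show "w \<in> (\<Union>i\<in>\<Lambda>. (#) i ` {w. i # w \<in> T})" using \<open>w \<in> T\<close> by auto
  qed auto
  have fin: "finite ((#) i ` {w. i # w \<in> T})" for i
    by (rule finite_subset[OF _ assms(2)]) auto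
  have "(\<Sum>w\<in>T. f w) = (\<Sum>w\<in>(\<Union>i\<in>\<Lambda>. (#) i ` {w. i # w \<in> T}). f w)" using T by simp
  also have "\<dots> = (\<Sum>i\<in>\<Lambda>. \<Sum>w\<in>(#) i ` {w. i # w \<in> T}. f w)"
    using fin assms by (intro sum.UNION_disjoint) auto
  also have "\<dots> = (\<Sum>i\<in>\<Lambda>. \<Sum>w\<in>{w. i # w \<in> T}. f (i # w))"
    by (intro sum.cong refl sum.reindex[THEN trans]) (auto simp: inj_on_def)
  finally show ?thesis .
qed

text \<open>A prefix-free set is either just the root or splits by the first letter into prefix-free
  sets of shorter words, on which induction applies.\<close>

lemma kraft_inequality:
  assumes "finite \<Lambda>" "\<And>i. i \<in> \<Lambda> \<Longrightarrow> 0 \<le> p i" "(\<Sum>i\<in>\<Lambda>. p i) \<le> 1"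
    and "T \<subseteq> lists \<Lambda>" "\<And>w. w \<in> T \<Longrightarrow> length w \<le> N" "prefix_free T"
  shows "(\<Sum>w\<in>T. word_prod p w) \<le> 1"
  using assms(4-6)
proof (induction N arbitrary: T)
  case 0
  then have "T \<subseteq> {[]}" by auto
  then have "T = {} \<or> T = {[]}" by auto
  then show ?case by auto
next
  case (Suc N)
  have "T \<subseteq> {w. set w \<subseteq> \<Lambda> \<and> length w \<le> Suc N}"
    using Suc.prems(1,2) by (simp add: subset_iff in_lists_conv_set)
  then have finT: "finite T"
    by (rule finite_subset) (rule finite_lists_length_le[OF assms(1)])
  show ?case
  proof (cases "[] \<in> T")
    case True
    then have "[] = w" if "w \<in> T" for w
      using Suc.prems(3) that Nil_prefix[of w] unfolding prefix_free_def by blast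
    then have "T = {[]}" using True by auto
    then show ?thesis by simp
  next
    case False
    have "(\<Sum>w\<in>T. word_prod p w) = (\<Sum>i\<in>\<Lambda>. \<Sum>w\<in>{w. i # w \<in> T}. word_prod p (i # w))"
      by (rule sum_words_split_first[OF assms(1) finT Suc.prems(1) False])
    also have "\<dots> = (\<Sum>i\<in>\<Lambda>. p i * (\<Sum>w\<in>{w. i # w \<in> T}. word_prod p w))"
      by (simp add: sum_distrib_left)
    also have "\<dots> \<le> (\<Sum>i\<in>\<Lambda>. p i * 1)"
    proof (intro sum_mono mult_left_mono assms(2))
      fix i assume i: "i \<in> \<Lambda>"
      show "(\<Sum>w\<in>{w. i # w \<in> T}. word_prod p w) \<le> 1"
      proof (rule Suc.IH)
        show "{w. i # w \<in> T} \<subseteq> lists \<Lambda>" using Suc.prems(1) by auto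
        show "length w \<le> N" if "w \<in> {w. i # w \<in> T}" for w using Suc.prems(2)[of "i # w"] that by auto
        show "prefix_free {w. i # w \<in> T}" using Suc.prems(3) unfolding prefix_free_def
          by (metis Cons_prefix_Cons list.inject mem_Collect_eq)
      qed
    qed
    finally show ?thesis using assms(3) by simp
  qed
qed

text \<open>Counterpart of Kraft for a family that cuts every branch by depth N: if the root is not
  a member, the subtree below each letter is cut by depth N - 1, and \<Sum>p \<ge> 1 carries the
  bound upwards. This converts a cover of K into an inequality for weights.\<close>

lemma one_le_sum_word_prod_of_prefix_cover:
  assumes "finite \<Lambda>" "\<And>i. i \<in> \<Lambda> \<Longrightarrow> 0 \<le> p i" "1 \<le> (\<Sum>i\<in>\<Lambda>. p i)"
    and "finite T" "T \<subseteq> lists \<Lambda>"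
    and "\<And>v. v \<in> lists \<Lambda> \<Longrightarrow> length v = N \<Longrightarrow> \<exists>u\<in>T. prefix u v"
  shows "1 \<le> (\<Sum>w\<in>T. word_prod p w)"
  using assms(4-6)
proof (induction N arbitrary: T)
  case 0
  have pos: "0 \<le> word_prod p w" if "w \<in> lists \<Lambda>" for w
    using that by (induction w) (auto simp: assms(2))
  have "[] \<in> T" using 0(3)[of "[]"] by auto
  then have "word_prod p [] \<le> (\<Sum>w\<in>T. word_prod p w)"
    using 0(1) pos[OF subsetD[OF 0(2)]] by (intro member_le_sum) auto
  then show ?case by simp
next
  case (Suc N)
  have pos: "0 \<le> word_prod p w" if "w \<in> lists \<Lambda>" for w
    using that by (induction w) (auto simp: assms(2))
  show ?case
  proof (cases "[] \<in> T")
    case True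
    then have "word_prod p [] \<le> (\<Sum>w\<in>T. word_prod p w)"
      using Suc.prems(1) pos[OF subsetD[OF Suc.prems(2)]] by (intro member_le_sum) auto
    then show ?thesis by simp
  next
    case False
    have "1 \<le> (\<Sum>i\<in>\<Lambda>. p i * 1)" using assms(3) by simp
    also have "\<dots> \<le> (\<Sum>i\<in>\<Lambda>. p i * (\<Sum>w\<in>{w. i # w \<in> T}. word_prod p w))"
    proof (intro sum_mono mult_left_mono assms(2))
      fix i assume i: "i \<in> \<Lambda>"
      show "1 \<le> (\<Sum>w\<in>{w. i # w \<in> T}. word_prod p w)"
      proof (rule Suc.IH)
        show "{w. i # w \<in> T} \<subseteq> lists \<Lambda>" using Suc.prems by auto
        have "finite ((#) i ` {w. i # w \<in> T})" by (rule finite_subset[OF _ Suc.prems(1)]) auto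
        then show "finite {w. i # w \<in> T}" by (rule finite_imageD) (auto simp: inj_on_def)
        fix v assume "v \<in> lists \<Lambda>" "length v = N"
        then obtain u where u: "u \<in> T" "prefix u (i # v)" using Suc.prems(3)[of "i # v"] i by auto
        then obtain u' where "u = i # u'" "prefix u' v" using False by (cases u) auto
        then show "\<exists>u\<in>{w. i # w \<in> T}. prefix u v" using u by auto
      qed
    qed
    also have "\<dots> = (\<Sum>i\<in>\<Lambda>. \<Sum>w\<in>{w. i # w \<in> T}. word_prod p (i # w))"
      by (simp add: sum_distrib_left)
    also have "\<dots> = (\<Sum>w\<in>T. word_prod p w)"
      by (rule sum_words_split_first[OF assms(1) Suc.prems(1,2) False, symmetric])
    finally show ?thesis .
  qed
qed

lemma sum_word_prod_length:
  assumes "finite \<Lambda>"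
  shows "(\<Sum>w\<in>{w \<in> lists \<Lambda>. length w = n}. word_prod p w) = (\<Sum>i\<in>\<Lambda>. p i) ^ n"
proof (induction n)
  case 0
  have "{w \<in> lists \<Lambda>. length w = 0} = {[]}" by auto
  then show ?case by simp
next
  case (Suc n)
  have fin: "finite {w \<in> lists \<Lambda>. length w = Suc n}"
    by (rule finite_subset[OF _ finite_lists_length_le[OF assms(1), of "Suc n"]]) auto
  have "(\<Sum>w\<in>{w \<in> lists \<Lambda>. length w = Suc n}. word_prod p w) =
     (\<Sum>i\<in>\<Lambda>. \<Sum>w\<in>{w. i # w \<in> {w \<in> lists \<Lambda>. length w = Suc n}}. word_prod p (i # w))"
    by (rule sum_words_split_first[OF assms fin]) auto
  also have "\<dots> = (\<Sum>i\<in>\<Lambda>. p i * (\<Sum>w\<in>{w \<in> lists \<Lambda>. length w = n}. word_prod p w))"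
  proof (rule sum.cong[OF refl])
    fix i assume "i \<in> \<Lambda>"
    then have "{w. i # w \<in> {w \<in> lists \<Lambda>. length w = Suc n}} = {w \<in> lists \<Lambda>. length w = n}" by auto
    then show "(\<Sum>w\<in>{w. i # w \<in> {w \<in> lists \<Lambda>. length w = Suc n}}. word_prod p (i # w))
       = p i * (\<Sum>w\<in>{w \<in> lists \<Lambda>. length w = n}. word_prod p w)"
      by (simp add: sum_distrib_left)
  qed
  also have "\<dots> = (\<Sum>i\<in>\<Lambda>. p i) ^ Suc n" unfolding Suc by (simp add: sum_distrib_right)
  finally show ?case .
qed

section \<open>Cylinders and cut sets of a self-similar set\<close>

locale similarity_ifs =
  fixes \<Lambda> :: "'i set" and h :: "'i \<Rightarrow> 'a::euclidean_space \<Rightarrow> 'a" and \<rho> :: "'i \<Rightarrow> real"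
    and K U :: "'a set"
  assumes finite_index: "finite \<Lambda>"
    and ratio_pos: "i \<in> \<Lambda> \<Longrightarrow> 0 < \<rho> i" and ratio_less_1: "i \<in> \<Lambda> \<Longrightarrow> \<rho> i < 1"
    and similarity: "i \<in> \<Lambda> \<Longrightarrow> \<exists>g b. orthogonal_transformation g \<and> (\<forall>x. h i x = \<rho> i *\<^sub>R g x + b)"
    and K_nonempty: "K \<noteq> {}" and K_compact: "compact K" and K_invariant: "K = (\<Union>i\<in>\<Lambda>. h i ` K)"
    and U_open: "open U" and U_nonempty: "U \<noteq> {}"
    and U_invariant: "i \<in> \<Lambda> \<Longrightarrow> h i ` U \<subseteq> U"
    and U_disjoint: "i \<in> \<Lambda> \<Longrightarrow> j \<in> \<Lambda> \<Longrightarrow> i \<noteq> j \<Longrightarrow> h i ` U \<inter> h j ` U = {}"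
begin

abbreviation hw :: "'i list \<Rightarrow> 'a \<Rightarrow> 'a" where "hw \<equiv> word_map h"
abbreviation rw :: "'i list \<Rightarrow> real" where "rw \<equiv> word_prod \<rho>"

text \<open>The Moran cut set: a branch is cut where its ratio first drops to \<epsilon>, so all
  members have ratios between \<open>rmin * \<epsilon>\<close> and \<epsilon>. At scales \<epsilon>
  \<ge> 1 it is empty, which is why covering statements ask for \<epsilon> < 1.\<close>

definition stop :: "real \<Rightarrow> 'i list set" where
  "stop \<epsilon> = {w \<in> lists \<Lambda>. w \<noteq> [] \<and> rw w \<le> \<epsilon> \<and> \<epsilon> < rw (butlast w)}"

definition rmin :: real where "rmin = Min (\<rho> ` \<Lambda>)"
definition rmax :: real where "rmax = Max (\<rho> ` \<Lambda>)"

lemma index_nonempty: "\<Lambda> \<noteq> {}"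
  using K_nonempty K_invariant by auto

lemma rmin_pos: "0 < rmin" and rmin_le: "i \<in> \<Lambda> \<Longrightarrow> rmin \<le> \<rho> i"
  and rmax_less_1: "rmax < 1" and le_rmax: "i \<in> \<Lambda> \<Longrightarrow> \<rho> i \<le> rmax" and rmax_pos: "0 < rmax"
  and rmin_less_1: "rmin < 1"
proof -
  show *: "0 < rmin" "rmax < 1" unfolding rmin_def rmax_def
    using finite_index index_nonempty ratio_pos ratio_less_1 by auto
  show **: "rmin \<le> \<rho> i" "\<rho> i \<le> rmax" if "i \<in> \<Lambda>" for i unfolding rmin_def rmax_def
    using finite_index that by auto
  obtain i where "i \<in> \<Lambda>" using index_nonempty by blast
  then show "0 < rmax" "rmin < 1" using * ** [of i] by linarith+
qed

lemma rw_pos: "w \<in> lists \<Lambda> \<Longrightarrow> 0 < rw w"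
  by (induction w) (auto simp: ratio_pos)

lemma rw_le_power: "w \<in> lists \<Lambda> \<Longrightarrow> rw w \<le> rmax ^ length w"
proof (induction w)
  case (Cons i w)
  then show ?case using le_rmax[of i] rw_pos[of w] rmax_pos
    by (auto intro!: mult_mono)
qed auto

lemma rw_le_1: "w \<in> lists \<Lambda> \<Longrightarrow> rw w \<le> 1"
  using rw_le_power[of w] rmax_pos rmax_less_1 power_le_one[of rmax "length w"] by linarith

lemma rw_prefix_le: "v \<in> lists \<Lambda> \<Longrightarrow> prefix u v \<Longrightarrow> rw v \<le> rw u"
proof -
  assume v: "v \<in> lists \<Lambda>" "prefix u v"
  then obtain t where t: "v = u @ t" unfolding prefix_def by blast
  then have "0 < rw u" "rw t \<le> 1" using v rw_pos rw_le_1 by auto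
  then show "rw v \<le> rw u" using t by (simp add: mult_left_le)
qed

lemma hw_similarity:
  assumes "w \<in> lists \<Lambda>"
  shows "\<exists>g b. orthogonal_transformation g \<and> (\<forall>x. hw w x = rw w *\<^sub>R g x + b)"
  using assms
proof (induction w)
  case Nil
  show ?case by (intro exI[of _ "\<lambda>x. x"] exI[of _ 0]) auto
next
  case (Cons i w)
  then obtain g b g' b' where g: "orthogonal_transformation g" "\<And>x. h i x = \<rho> i *\<^sub>R g x + b"
    and g': "orthogonal_transformation g'" "\<And>x. hw w x = rw w *\<^sub>R g' x + b'"
    using similarity[of i] by auto
  have "linear g" using g orthogonal_transformation_def by blast
  then have "hw (i # w) x = rw (i # w) *\<^sub>R (g \<circ> g') x + (\<rho> i *\<^sub>R g b' + b)" for x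
    by (simp add: g g' linear_add linear_cmul algebra_simps)
  then show ?case using orthogonal_transformation_compose[OF g(1) g'(1)] by blast
qed

lemma dist_hw: "w \<in> lists \<Lambda> \<Longrightarrow> dist (hw w x) (hw w y) = rw w * dist x y"
proof -
  assume w: "w \<in> lists \<Lambda>"
  then obtain g b where g: "orthogonal_transformation g" "\<And>x. hw w x = rw w *\<^sub>R g x + b"
    using hw_similarity by blast
  have "linear g" using g orthogonal_transformation_def by blast
  then have "hw w x - hw w y = rw w *\<^sub>R g (x - y)"
    by (simp add: g linear_diff algebra_simps)
  then show ?thesis using rw_pos[OF w] g(1) by (simp add: dist_norm orthogonal_transformation_norm)
qed

lemma inj_hw: "w \<in> lists \<Lambda> \<Longrightarrow> hw w x = hw w y \<Longrightarrow> x = y"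
  using dist_hw[of w x y] rw_pos[of w] by auto

lemma hw_K_subset: "w \<in> lists \<Lambda> \<Longrightarrow> hw w ` K \<subseteq> K"
proof (induction w)
  case (Cons i w)
  then show ?case using K_invariant by fastforce
qed auto

lemma hw_U_subset: "w \<in> lists \<Lambda> \<Longrightarrow> hw w ` U \<subseteq> U"
proof (induction w)
  case (Cons i w)
  then show ?case using U_invariant[of i] by fastforce
qed auto

lemma K_subset_words: "x \<in> K \<Longrightarrow> \<exists>w\<in>lists \<Lambda>. length w = n \<and> x \<in> hw w ` K"
proof (induction n arbitrary: x)
  case 0
  then show ?case by (intro bexI[of _ "[]"]) auto
next
  case (Suc n)
  then obtain i y where i: "i \<in> \<Lambda>" "y \<in> K" "x = h i y" using K_invariant by blast
  then obtain w where "w \<in> lists \<Lambda>" "length w = n" "y \<in> hw w ` K" using Suc.IH by blast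
  then show ?case using i by (intro bexI[of _ "i # w"]) auto
qed

text \<open>Strip the common prefix, which is injective on points; at the first differing letter the
  open set condition separates the images.\<close>

lemma hw_U_disjoint:
  assumes "u \<in> lists \<Lambda>" "v \<in> lists \<Lambda>" "\<not> prefix u v" "\<not> prefix v u"
  shows "hw u ` U \<inter> hw v ` U = {}"
  using assms
proof (induction u arbitrary: v)
  case (Cons i u)
  then obtain j v' where v: "v = j # v'" by (cases v) auto
  show ?case
  proof (cases "i = j")
    case True
    then have "hw u ` U \<inter> hw v' ` U = {}" using Cons v by auto
    moreover have "i \<in> \<Lambda>" using Cons.hyps by auto
    then have "inj (h i)" using inj_hw[of "[i]"] by (intro injI) simp
    ultimately have "h i ` (hw u ` U) \<inter> h i ` (hw v' ` U) = {}" by (simp flip: image_Int)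
    then show ?thesis using True v by (simp add: image_comp)
  next
    case False
    have "hw (i # u) ` U \<subseteq> h i ` U" "hw v ` U \<subseteq> h j ` U"
      using hw_U_subset[of u] hw_U_subset[of v'] Cons.hyps Cons.prems v by auto
    then show ?thesis using U_disjoint[of i j] False Cons.hyps Cons.prems v by fastforce
  qed
qed auto

lemma stop_lists: "w \<in> stop \<epsilon> \<Longrightarrow> w \<in> lists \<Lambda>" and stop_le: "w \<in> stop \<epsilon> \<Longrightarrow> rw w \<le> \<epsilon>"
  by (auto simp: stop_def)

lemma stop_ge: "w \<in> stop \<epsilon> \<Longrightarrow> rmin * \<epsilon> \<le> rw w"
proof -
  assume "w \<in> stop \<epsilon>"
  then have w: "w \<in> lists \<Lambda>" "w \<noteq> []" "rw w \<le> \<epsilon>" "\<epsilon> < rw (butlast w)" by (auto simp: stop_def)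
  have "rw w = rw (butlast w @ [last w])" using w by simp
  also have "\<dots> = rw (butlast w) * \<rho> (last w)" by (simp only: word_prod_simps mult_1_right)
  finally have *: "rw w = rw (butlast w) * \<rho> (last w)" .
  have "last w \<in> \<Lambda>" using w by (metis in_lists_conv_set last_in_set)
  then have "rmin \<le> \<rho> (last w)" using rmin_le by simp
  moreover have "0 < \<epsilon>" using w rw_pos[of w] by simp
  ultimately have "\<epsilon> * rmin \<le> rw (butlast w) * \<rho> (last w)" using w rmin_pos by (intro mult_mono) auto
  then show ?thesis using * by (simp add: mult.commute)
qed

lemma stop_prefix_exists:
  assumes "v \<in> lists \<Lambda>" "rw v \<le> \<epsilon>" "\<epsilon> < 1"
  shows "\<exists>u\<in>stop \<epsilon>. prefix u v"
  using assms(1,2)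
proof (induction v rule: rev_induct)
  case Nil
  then show ?case using assms by simp
next
  case (snoc i v)
  show ?case
  proof (cases "rw v \<le> \<epsilon>")
    case True
    then obtain u where "u \<in> stop \<epsilon>" "prefix u v" using snoc by auto
    then show ?thesis by auto
  next
    case False
    then have "v @ [i] \<in> stop \<epsilon>" using snoc by (auto simp: stop_def)
    then show ?thesis by blast
  qed
qed

lemma prefix_free_stop: "prefix_free (stop \<epsilon>)"
  unfolding prefix_free_def
proof (intro ballI impI, rule ccontr)
  fix u v assume uv: "u \<in> stop \<epsilon>" "v \<in> stop \<epsilon>" "prefix u v" "u \<noteq> v"
  have "prefix u (butlast v)" using uv by (metis append_butlast_last_id prefix_snoc butlast.simps(1) prefix_bot.extremum_unique)
  moreover have "butlast v \<in> lists \<Lambda>" using uv by (auto simp: stop_def dest: in_set_butlastD)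
  ultimately have "rw (butlast v) \<le> rw u" by (rule rw_prefix_le[rotated])
  then show False using uv by (auto simp: stop_def)
qed

lemma length_stop_bounded:
  assumes "0 < \<epsilon>" shows "\<exists>N. \<forall>w\<in>stop \<epsilon>. length w \<le> N"
proof -
  obtain n where n: "rmax ^ n < \<epsilon>" using real_arch_pow_inv[OF assms rmax_less_1] by blast
  have "length w \<le> n" if "w \<in> stop \<epsilon>" for w
  proof (rule ccontr)
    assume "\<not> length w \<le> n"
    then have "n \<le> length (butlast w)" by simp
    then have "rmax ^ length (butlast w) \<le> rmax ^ n" using rmax_pos rmax_less_1 by (intro power_decreasing) auto
    moreover have "butlast w \<in> lists \<Lambda>" using that by (auto simp: stop_def dest: in_set_butlastD)
    ultimately have "rw (butlast w) \<le> rmax ^ n" using rw_le_power by force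
    then show False using n that by (auto simp: stop_def)
  qed
  then show ?thesis by blast
qed

lemma finite_stop: "0 < \<epsilon> \<Longrightarrow> finite (stop \<epsilon>)"
proof -
  assume "0 < \<epsilon>"
  then obtain N where "\<forall>w\<in>stop \<epsilon>. length w \<le> N" using length_stop_bounded by blast
  then show ?thesis
    by (intro finite_subset[OF _ finite_lists_length_le[OF finite_index, of N]]) (auto simp: stop_def)
qed

lemma cylinder_subset_stop:
  assumes "w \<in> lists \<Lambda>" "0 < \<epsilon>" "\<epsilon> < 1"
  shows "hw w ` K \<subseteq> (\<Union>u\<in>stop \<epsilon>. hw (w @ u) ` K)"
proof
  fix x assume "x \<in> hw w ` K"
  then obtain y where y: "y \<in> K" "x = hw w y" by blast
  obtain n where n: "rmax ^ n < \<epsilon>" using real_arch_pow_inv[OF assms(2) rmax_less_1] by blast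
  obtain v where v: "v \<in> lists \<Lambda>" "length v = n" "y \<in> hw v ` K" using K_subset_words y by blast
  then have "rw v \<le> \<epsilon>" using rw_le_power[of v] n by simp
  then obtain u where u: "u \<in> stop \<epsilon>" "prefix u v" using stop_prefix_exists v(1) assms(3) by blast
  then obtain t where "v = u @ t" by (auto simp: prefix_def)
  note u = u(1) this
  then have "t \<in> lists \<Lambda>" using v by simp
  then have "y \<in> hw u ` K" using v u hw_K_subset[of t] by (auto simp: word_map_append)
  then have "x \<in> hw (w @ u) ` K" using y by (auto simp: word_map_append)
  then show "x \<in> (\<Union>u\<in>stop \<epsilon>. hw (w @ u) ` K)" using u by blast
qed

lemma word_prod_powr: "w \<in> lists \<Lambda> \<Longrightarrow> word_prod (\<lambda>i. \<rho> i powr s) w = rw w powr s"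
proof (induction w)
  case (Cons i w)
  then show ?case using rw_pos[of w] ratio_pos[of i] by (simp add: powr_mult)
qed simp

lemma sum_stop_le_1:
  assumes "(\<Sum>i\<in>\<Lambda>. \<rho> i powr s) \<le> 1" "0 < \<epsilon>"
  shows "(\<Sum>u\<in>stop \<epsilon>. rw u powr s) \<le> 1"
proof -
  obtain N where N: "\<And>w. w\<in>stop \<epsilon> \<Longrightarrow> length w \<le> N" using length_stop_bounded assms by blast
  have "(\<Sum>w\<in>stop \<epsilon>. word_prod (\<lambda>i. \<rho> i powr s) w) \<le> 1"
    by (rule kraft_inequality[OF finite_index _ assms(1) _ N prefix_free_stop]) (auto simp: stop_def)
  then show ?thesis using word_prod_powr stop_lists by (simp cong: sum.cong)
qed

lemma bounded_cylinder: "w \<in> lists \<Lambda> \<Longrightarrow> bounded (hw w ` K)"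
  by (rule bounded_subset[OF compact_imp_bounded[OF K_compact] hw_K_subset])

lemma dist_K_le: "x \<in> K \<Longrightarrow> y \<in> K \<Longrightarrow> dist x y \<le> diameter K"
  using K_compact compact_imp_bounded diameter_bounded_bound by blast

lemma diameter_cylinder_le: "w \<in> lists \<Lambda> \<Longrightarrow> diameter (hw w ` K) \<le> rw w * diameter K"
proof -
  assume w: "w \<in> lists \<Lambda>"
  show ?thesis
  proof (rule diameter_le)
    show "hw w ` K \<noteq> {} \<or> 0 \<le> rw w * diameter K" using K_nonempty by simp
    fix x y assume "x \<in> hw w ` K" "y \<in> hw w ` K"
    then obtain a b where ab: "x = hw w a" "y = hw w b" "a \<in> K" "b \<in> K" by blast
    have "norm (x - y) = rw w * dist a b" using dist_hw[OF w] ab by (simp add: dist_norm[symmetric])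
    also have "\<dots> \<le> rw w * diameter K" using dist_K_le ab rw_pos[OF w] by (intro mult_left_mono) auto
    finally show "norm (x - y) \<le> rw w * diameter K" .
  qed
qed

lemma diameter_K_nonneg: "0 \<le> diameter K"
  using K_compact compact_imp_bounded diameter_ge_0 by blast

text \<open>Subdividing to words of a large common extra length keeps the \<open>s\<close>-sum, since \<open>\<Sum>\<rho>\<^sub>i\<^sup>s \<le> 1\<close>.\<close>
lemma hausdorff_outer_measure_cylinders_le:
  assumes s: "0 < s" and sum1: "(\<Sum>i\<in>\<Lambda>. \<rho> i powr s) \<le> 1" and T: "finite T" "T \<subseteq> lists \<Lambda>"
    and A: "A \<subseteq> (\<Union>w\<in>T. hw w ` K)"
  shows "hausdorff_outer_measure s A \<le> ennreal (diameter K powr s * (\<Sum>w\<in>T. rw w powr s))"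
proof (rule hausdorff_outer_measure_le_of_finite_covers[OF s])
  fix \<delta> :: real assume \<delta>: "0 < \<delta>"
  then have "0 < \<delta> / (diameter K + 1)" using diameter_K_nonneg by simp
  then obtain n where n: "rmax ^ n < \<delta> / (diameter K + 1)" using real_arch_pow_inv[OF _ rmax_less_1] by blast
  let ?L = "{v \<in> lists \<Lambda>. length v = n}"
  let ?V = "\<lambda>(w, v). hw (w @ v) ` K"
  have fin: "finite ?L"
    by (rule finite_subset[OF _ finite_lists_length_le[OF finite_index, of n]]) auto
  have "A \<subseteq> (\<Union>t\<in>T \<times> ?L. ?V t)"
  proof
    fix x assume "x \<in> A"
    then obtain w y where w: "w \<in> T" "y \<in> K" "x = hw w y" using A by blast
    obtain v where "v \<in> ?L" "y \<in> hw v ` K" using K_subset_words[OF w(2)] by blast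
    then have "(w, v) \<in> T \<times> ?L" "x \<in> ?V (w, v)" using w by (auto simp: word_map_append)
    then show "x \<in> (\<Union>t\<in>T \<times> ?L. ?V t)" by blast
  qed
  moreover have "bounded (?V t) \<and> diameter (?V t) \<le> \<delta>" if t: "t \<in> T \<times> ?L" for t
  proof -
    obtain w v where t: "t = (w, v)" "w \<in> lists \<Lambda>" "v \<in> lists \<Lambda>" "length v = n"
      using t subsetD[OF T(2)] by blast
    have "diameter (hw (w @ v) ` K) \<le> rw (w @ v) * diameter K"
      using t by (intro diameter_cylinder_le) auto
    also have "\<dots> \<le> (1 * rmax ^ n) * (diameter K + 1)"
      unfolding word_prod_simps
      using t rw_le_1[of w] rw_le_power[of v] rw_pos[of w] rw_pos[of v] rmax_pos diameter_K_nonneg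
      by (intro mult_mono mult_nonneg_nonneg) auto
    also have "\<dots> \<le> \<delta>" using n diameter_K_nonneg by (simp add: field_simps)
    finally show ?thesis using t bounded_cylinder[of "w @ v"] by simp
  qed
  moreover have "(\<Sum>t\<in>T \<times> ?L. diameter (?V t) powr s) \<le> diameter K powr s * (\<Sum>w\<in>T. rw w powr s)"
  proof -
    have "(\<Sum>t\<in>T \<times> ?L. diameter (?V t) powr s) \<le> (\<Sum>t\<in>T \<times> ?L. case t of (w, v) \<Rightarrow> (rw w powr s * rw v powr s) * diameter K powr s)"
    proof (intro sum_mono)
      fix t assume "t \<in> T \<times> ?L"
      then obtain w v where t: "t = (w, v)" "w \<in> lists \<Lambda>" "v \<in> lists \<Lambda>" using subsetD[OF T(2)] by blast
      have "diameter (hw (w @ v) ` K) powr s \<le> (rw (w @ v) * diameter K) powr s"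
        using t s bounded_cylinder[of "w @ v"] by (intro powr_mono2 diameter_cylinder_le diameter_ge_0) auto
      also have "\<dots> = (rw w powr s * rw v powr s) * diameter K powr s"
        using t rw_pos[of w] rw_pos[of v] diameter_K_nonneg by (simp add: powr_mult)
      finally show "diameter (?V t) powr s \<le> (case t of (w, v) \<Rightarrow> (rw w powr s * rw v powr s) * diameter K powr s)"
        using t by simp
    qed
    also have "\<dots> = diameter K powr s * ((\<Sum>w\<in>T. rw w powr s) * (\<Sum>v\<in>?L. rw v powr s))"
      unfolding sum.cartesian_product[symmetric] sum_product
      by (simp only: sum_distrib_left mult_ac)
    also have "(\<Sum>v\<in>?L. rw v powr s) = (\<Sum>i\<in>\<Lambda>. \<rho> i powr s) ^ n"
      unfolding sum_word_prod_length[OF finite_index, of "\<lambda>i. \<rho> i powr s" n, symmetric]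
      by (intro sum.cong refl) (simp add: word_prod_powr)
    also have "diameter K powr s * ((\<Sum>w\<in>T. rw w powr s) * (\<Sum>i\<in>\<Lambda>. \<rho> i powr s) ^ n)
        \<le> diameter K powr s * ((\<Sum>w\<in>T. rw w powr s) * 1)"
      using sum1 by (intro mult_left_mono power_le_one sum_nonneg) auto
    finally show ?thesis by simp
  qed
  ultimately show "\<exists>T' (V :: 'i list \<times> 'i list \<Rightarrow> 'a set). finite T' \<and> A \<subseteq> (\<Union>t\<in>T'. V t) \<and>
       (\<forall>t\<in>T'. bounded (V t) \<and> diameter (V t) \<le> \<delta>) \<and> (\<Sum>t\<in>T'. diameter (V t) powr s)
         \<le> diameter K powr s * (\<Sum>w\<in>T. rw w powr s)"
    using finite_cartesian_product[OF T(1) fin] by (intro exI[of _ "T \<times> ?L"] exI[of _ ?V] conjI ballI) simp_all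
qed

end

section \<open>Cylinders near affine subspaces\<close>

lemma sum_UN_le:
  fixes f :: "'a \<Rightarrow> real"
  assumes "finite I" "\<And>i. i \<in> I \<Longrightarrow> finite (A i)" "\<And>x. 0 \<le> f x"
  shows "sum f (\<Union>i\<in>I. A i) \<le> (\<Sum>i\<in>I. sum f (A i))"
  using assms(1,2)
proof (induction I)
  case (insert i I)
  have "sum f (A i \<union> (\<Union>i\<in>I. A i)) \<le> sum f (A i) + sum f (\<Union>i\<in>I. A i)"
    using insert.prems insert.hyps assms(3)
    by (subst sum.union_inter[symmetric]) (auto intro!: sum_nonneg)
  then show ?case using insert by auto
qed simp

lemma norm_le_sum_abs_inner_orthonormal:
  fixes y :: "'a::euclidean_space"
  assumes B: "pairwise orthogonal B" "\<And>e. e \<in> B \<Longrightarrow> norm e = 1" "finite B" and y: "y \<in> span B"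
  shows "norm y \<le> (\<Sum>e\<in>B. \<bar>y \<bullet> e\<bar>)"
proof -
  define z where "z = y - (\<Sum>e\<in>B. (y \<bullet> e) *\<^sub>R e)"
  have orth: "orthogonal z e" if e: "e \<in> B" for e
  proof -
    have "(\<Sum>e'\<in>B. (y \<bullet> e') * (e' \<bullet> e)) = (\<Sum>e'\<in>B. if e' = e then y \<bullet> e else 0)"
    proof (rule sum.cong[OF refl])
      fix e' assume e': "e' \<in> B"
      have "e \<bullet> e = 1" using B(2)[OF e] by (simp add: norm_eq_1)
      then show "(y \<bullet> e') * (e' \<bullet> e) = (if e' = e then y \<bullet> e else 0)"
        using B(1) e e' by (auto simp: pairwise_def orthogonal_def)
    qed
    also have "\<dots> = y \<bullet> e" using B(3) e by simp
    finally show ?thesis by (simp add: orthogonal_def z_def inner_diff_left inner_sum_left)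
  qed
  have "z \<in> span B" unfolding z_def
    by (intro span_diff y span_sum span_scale) (simp add: span_base)
  then have "orthogonal z z" using orth by (rule orthogonal_to_span)
  then have "y = (\<Sum>e\<in>B. (y \<bullet> e) *\<^sub>R e)" by (simp add: orthogonal_def z_def)
  then have "norm y = norm (\<Sum>e\<in>B. (y \<bullet> e) *\<^sub>R e)" by simp
  also have "\<dots> \<le> (\<Sum>e\<in>B. norm ((y \<bullet> e) *\<^sub>R e))" by (rule norm_sum)
  also have "\<dots> = (\<Sum>e\<in>B. \<bar>y \<bullet> e\<bar>)" using B(2) by simp
  finally show ?thesis .
qed

text \<open>\<open>B1\<close> spans the directions of L and \<open>B2\<close> the orthogonal
  complement. A point near L is confined along \<open>B1\<close> only by the size of K, along
  \<open>B2\<close> by its distance to L; these are the two side lengths of the box in the packing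
  count.\<close>

lemma orthonormal_frame_adapted_to_affine:
  fixes L :: "'a::euclidean_space set"
  assumes L: "affine L" "aff_dim L = int k"
  obtains B1 B2 where "finite B1" "finite B2" "card B1 = k" "card B2 \<le> DIM('a)" "B1 \<inter> B2 = {}"
    "\<And>e. e \<in> B1 \<union> B2 \<Longrightarrow> norm e = 1" "\<And>e x y. e \<in> B2 \<Longrightarrow> x \<in> L \<Longrightarrow> y \<in> L \<Longrightarrow> (x - y) \<bullet> e = 0"
    "\<And>z. norm z \<le> (\<Sum>e\<in>B1 \<union> B2. \<bar>z \<bullet> e\<bar>)"
proof -
  have "L \<noteq> {}" using L by auto
  then obtain a where a: "a \<in> L" by blast
  define S where "S = (\<lambda>x. (-a) + x) ` L"
  have S: "subspace S" unfolding S_def using affine_diffs_subspace[OF L(1) a] .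
  have dimS: "dim S = k"
    using aff_dim_eq_dim[of a L] a L unfolding S_def by (simp add: hull_inc)
  define S' where "S' = {y. \<forall>x\<in>S. orthogonal x y}"
  have S': "subspace S'" unfolding S'_def by (rule subspace_orthogonal_to_vectors)
  obtain B1 where B1: "B1 \<subseteq> S" "pairwise orthogonal B1" "\<And>x. x \<in> B1 \<Longrightarrow> norm x = 1"
     "independent B1" "card B1 = dim S" "span B1 = S"
    using orthonormal_basis_subspace[OF S] by blast
  obtain B2 where B2: "B2 \<subseteq> S'" "pairwise orthogonal B2" "\<And>x. x \<in> B2 \<Longrightarrow> norm x = 1"
     "independent B2" "card B2 = dim S'" "span B2 = S'"
    using orthonormal_basis_subspace[OF S'] by blast
  have fin: "finite B1" "finite B2" using B1 B2 independent_bound by blast+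
  have orth: "x \<bullet> e = 0" if "e \<in> S'" "x \<in> S" for x e using that by (simp add: S'_def orthogonal_def)
  show thesis
  proof (rule that[OF fin])
    show "card B1 = k" using B1 dimS by simp
    show "card B2 \<le> DIM('a)" using B2 independent_bound by blast
    show disj: "B1 \<inter> B2 = {}"
    proof (rule ccontr)
      assume "B1 \<inter> B2 \<noteq> {}"
      then obtain e where "e \<in> B1" "e \<in> B2" by blast
      then have "e \<bullet> e = 0" "norm e = 1" using orth B1 B2 by blast+
      then show False by simp
    qed
    show "norm e = 1" if "e \<in> B1 \<union> B2" for e using that B1 B2 by blast
    show "(x - y) \<bullet> e = 0" if "e \<in> B2" "x \<in> L" "y \<in> L" for e x y
    proof -
      have "-a + x \<in> S" "-a + y \<in> S" using that by (auto simp: S_def)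
      then have "(-a + x) - (-a + y) \<in> S" using S subspace_diff by blast
      then have "x - y \<in> S" by simp
      then show ?thesis using orth that B2 by blast
    qed
    show "norm z \<le> (\<Sum>e\<in>B1 \<union> B2. \<bar>z \<bullet> e\<bar>)" for z
    proof -
      obtain y w where yw: "y \<in> span S" "\<And>v. v \<in> span S \<Longrightarrow> orthogonal w v" "z = y + w"
        using orthogonal_subspace_decomp_exists[of S z] by blast
      have yS: "y \<in> S" using yw(1) S by (metis span_eq_iff)
      have wS: "w \<in> S'" unfolding S'_def using yw(2) by (auto simp: span_base orthogonal_commute)
      have "norm y \<le> (\<Sum>e\<in>B1. \<bar>y \<bullet> e\<bar>)"
        using B1 yS fin by (intro norm_le_sum_abs_inner_orthonormal) auto
      also have "\<dots> = (\<Sum>e\<in>B1. \<bar>z \<bullet> e\<bar>)"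
        using orth[OF wS] B1(1) yw(3) by (intro sum.cong refl) (auto simp: inner_add_left inner_commute[of w])
      finally have 1: "norm y \<le> (\<Sum>e\<in>B1. \<bar>z \<bullet> e\<bar>)" .
      have "norm w \<le> (\<Sum>e\<in>B2. \<bar>w \<bullet> e\<bar>)"
        using B2 wS fin by (intro norm_le_sum_abs_inner_orthonormal) auto
      also have "\<dots> = (\<Sum>e\<in>B2. \<bar>z \<bullet> e\<bar>)"
        using orth[OF _ yS] B2(1) yw(3) by (intro sum.cong refl) (auto simp: inner_add_left)
      finally have 2: "norm w \<le> (\<Sum>e\<in>B2. \<bar>z \<bullet> e\<bar>)" .
      have "norm z \<le> norm y + norm w" using yw(3) norm_triangle_ineq by blast
      then show ?thesis using 1 2 fin disj by (simp add: sum.union_disjoint)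
    qed
  qed
qed

lemma hausdorff_outer_measure_null_of_finite_covers:
  fixes A :: "'a::metric_space set"
  assumes s: "0 < s"
    and cov: "\<And>\<delta> c. 0 < \<delta> \<Longrightarrow> 0 < c \<Longrightarrow> \<exists>T (V :: 'b \<Rightarrow> 'a set). finite T \<and> A \<subseteq> (\<Union>t\<in>T. V t) \<and>
       (\<forall>t\<in>T. bounded (V t) \<and> diameter (V t) \<le> \<delta>) \<and> (\<Sum>t\<in>T. diameter (V t) powr s) \<le> c"
  shows "hausdorff_outer_measure s A = 0"
proof -
  have "hausdorff_outer_measure s A \<le> 0 + ennreal c" if "0 < c" for c
    using hausdorff_outer_measure_le_of_finite_covers[OF s cov[OF _ that]] by simp
  then have "hausdorff_outer_measure s A \<le> 0" by (rule ennreal_le_epsilon)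
  then show ?thesis by simp
qed

lemma hausdorff_outer_measure_null_above_dim:
  assumes "hausdorff_dim A < ereal t"
  shows "hausdorff_outer_measure t A = 0"
proof -
  obtain u where "0 \<le> u" "hausdorff_outer_measure u A = 0" "u < t"
    using assms unfolding hausdorff_dim_def by (auto simp: INF_less_iff)
  then show ?thesis using hausdorff_outer_measure_null_mono[of u A t] by simp
qed

lemma hausdorff_dim_le:
  assumes "0 \<le> b" "\<And>t. b < t \<Longrightarrow> hausdorff_outer_measure t A = 0"
  shows "hausdorff_dim A \<le> ereal b"
proof (rule ereal_le_epsilon2)
  fix e :: real assume "0 < e"
  then have "hausdorff_outer_measure (b + e) A = 0" using assms(2) by simp
  then show "hausdorff_dim A \<le> ereal b + ereal e" unfolding hausdorff_dim_def
    using assms(1) \<open>0 < e\<close> by (intro INF_lower2[of "b + e"]) auto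
qed

context similarity_ifs
begin

lemma surj_hw: "w \<in> lists \<Lambda> \<Longrightarrow> \<exists>x. hw w x = y"
proof -
  assume w: "w \<in> lists \<Lambda>"
  then obtain g b where g: "orthogonal_transformation g" "\<And>x. hw w x = rw w *\<^sub>R g x + b"
    using hw_similarity by blast
  have "surj g" using g(1) orthogonal_transformation_surj by blast
  then obtain x where "g x = (y - b) /\<^sub>R rw w" by (metis surjD)
  then have "hw w x = y" using g rw_pos[OF w] by simp
  then show ?thesis by blast
qed

text \<open>L will be a point, an affine subspace or the whole space, so that one packing bound
  covers mass distribution, neighbourhoods of subspaces and the box count of K.\<close>

definition stop_near :: "real \<Rightarrow> 'a set \<Rightarrow> 'i list set" where
  "stop_near \<epsilon> L = {u \<in> stop \<epsilon>. \<exists>x\<in>hw u ` K. \<exists>y\<in>L. dist x y \<le> \<epsilon>}"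

text \<open>Packing: by the open set condition the images of a fixed point of \<open>U\<close> are separated at scale \<open>\<epsilon>\<close>,
  and those counted here lie within a multiple of \<open>\<epsilon>\<close> of \<open>L\<close>.\<close>
lemma card_stop_near_affine:
  obtains C where "1 \<le> C" "\<And>\<epsilon> L k. 0 < \<epsilon> \<Longrightarrow> \<epsilon> < 1 \<Longrightarrow> affine L \<Longrightarrow> aff_dim L = int k \<Longrightarrow>
     real (card (stop_near \<epsilon> L)) \<le> C * \<epsilon> powr (- real k)"
proof -
  obtain z0 where z0: "z0 \<in> U" using U_nonempty by blast
  then obtain r0 where r0: "0 < r0" "ball z0 r0 \<subseteq> U" using U_open openE by blast
  obtain E where "\<And>y. y \<in> K \<Longrightarrow> dist z0 y \<le> E"
    using compact_imp_bounded[OF K_compact] bounded_any_center[of K z0] by (auto simp: dist_commute)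
  then have E: "dist z0 y \<le> \<bar>E\<bar>" if "y \<in> K" for y using that by force
  define E' where "E' = \<bar>E\<bar>"
  have E'0: "0 \<le> E'" by (simp add: E'_def)
  let ?n = "real DIM('a)"
  let ?D = "diameter K"
  \<comment> \<open>Images of \<open>z0\<close> are \<open>r0 * rmin * \<epsilon>\<close> apart. The
    norm is at most the sum of at most 2n frame coordinates, so one coordinate differs by the 2n-th
    part of this.\<close>
  define \<kappa> where "\<kappa> = r0 * rmin / (2 * ?n)"
  have npos: "0 < ?n" by simp
  have \<kappa>: "0 < \<kappa>" unfolding \<kappa>_def using r0 rmin_pos by simp
  \<comment> \<open>A common bound for the number of cells per coordinate: the first summand is for
    directions along L (after extracting 1 / \<epsilon>), the second for directions across
    L.\<close>
  define C0 where "C0 = 2 * (2 * E' + ?D) / \<kappa> + 4 * (1 + E') / \<kappa> + 2"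
  have C0: "2 \<le> C0" unfolding C0_def using E'0 \<kappa> diameter_K_nonneg by simp
  show thesis
  proof (rule that[of "C0 ^ (2 * DIM('a))"])
    show "1 \<le> C0 ^ (2 * DIM('a))" using C0 by (intro one_le_power) simp
    fix \<epsilon> :: real and L :: "'a set" and k :: nat
    assume \<epsilon>: "0 < \<epsilon>" "\<epsilon> < 1" and L: "affine L" "aff_dim L = int k"
    obtain B1 B2 where fin: "finite B1" "finite B2" and card: "card B1 = k" "card B2 \<le> DIM('a)"
      and disj: "B1 \<inter> B2 = {}" and n1: "\<And>e. e \<in> B1 \<union> B2 \<Longrightarrow> norm e = 1"
      and B2L: "\<And>e x y. e \<in> B2 \<Longrightarrow> x \<in> L \<Longrightarrow> y \<in> L \<Longrightarrow> (x - y) \<bullet> e = 0"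
      and nrm: "\<And>z. norm z \<le> (\<Sum>e\<in>B1 \<union> B2. \<bar>z \<bullet> e\<bar>)"
      using orthonormal_frame_adapted_to_affine[OF L] by metis
    have kn: "k \<le> DIM('a)" using L(2) aff_dim_le_DIM[of L] by simp
    let ?X = "stop_near \<epsilon> L"
    show "real (card ?X) \<le> C0 ^ (2 * DIM('a)) * \<epsilon> powr (- real k)"
    proof (cases "?X = {}")
      case True
      then show ?thesis using C0 by simp
    next
      case False
      then obtain u0 where u0: "u0 \<in> ?X" by blast
      define \<phi> where "\<phi> e u = (hw u z0 - hw u0 z0) \<bullet> e" for e u
      define M where "M e = (if e \<in> B1 then 2 * E' + ?D else 2 * \<epsilon> * (1 + E'))" for e
      have near: "\<exists>x\<in>K. \<exists>y\<in>L. dist (hw u z0) x \<le> E' * \<epsilon> \<and> dist x y \<le> \<epsilon>" if "u \<in> ?X" for u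
      proof -
        obtain x y where xy: "x \<in> K" "y \<in> L" "dist (hw u x) y \<le> \<epsilon>" and u: "u \<in> stop \<epsilon>"
          using \<open>u \<in> ?X\<close> by (auto simp: stop_near_def)
        have ul: "u \<in> lists \<Lambda>" using stop_lists u .
        have "dist (hw u z0) (hw u x) = rw u * dist z0 x" using dist_hw[OF ul] .
        also have "\<dots> \<le> \<epsilon> * E'" using stop_le[OF u] rw_pos[OF ul] E[OF xy(1)] \<epsilon>
          by (intro mult_mono) (auto simp: E'_def)
        finally show ?thesis using xy hw_K_subset[OF ul]
          by (intro bexI[of _ "hw u x"] bexI[of _ y]) (auto simp: mult.commute)
      qed
      have ins: "\<bar>z \<bullet> e\<bar> \<le> norm z" if "e \<in> B1 \<union> B2" for z e :: 'a
        using Cauchy_Schwarz_ineq2[of z e] n1[OF that] by simp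
      obtain x0 y0 where x0: "x0 \<in> K" "y0 \<in> L" "dist (hw u0 z0) x0 \<le> E' * \<epsilon>" "dist x0 y0 \<le> \<epsilon>"
        using near[OF u0] by blast
      have prodle: "(\<Prod>i\<in>B1 \<union> B2. 2 * M i / (\<kappa> * \<epsilon>) + 2) \<le> C0 ^ (2 * DIM('a)) * \<epsilon> powr (- real k)"
      proof -
        have "(\<Prod>i\<in>B1. 2 * M i / (\<kappa> * \<epsilon>) + 2) \<le> (\<Prod>i\<in>B1. C0 / \<epsilon>)"
        proof (intro prod_mono conjI)
          fix i assume "i \<in> B1"
          then have Mi: "M i = 2 * E' + ?D" by (simp add: M_def)
          show "0 \<le> 2 * M i / (\<kappa> * \<epsilon>) + 2" unfolding Mi using E'0 diameter_K_nonneg \<kappa> \<epsilon> by simp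
          have "2 * M i / (\<kappa> * \<epsilon>) + 2 \<le> (2 * M i / \<kappa>) / \<epsilon> + 2 / \<epsilon>"
            using \<epsilon> by (simp add: field_simps)
          also have "\<dots> \<le> C0 / \<epsilon>" unfolding add_divide_distrib[symmetric] C0_def Mi
            using \<epsilon> E'0 \<kappa> by (intro divide_right_mono add_right_mono) auto
          finally show "2 * M i / (\<kappa> * \<epsilon>) + 2 \<le> C0 / \<epsilon>" .
        qed
        also have "\<dots> = C0 ^ k * \<epsilon> powr (- real k)"
          using card \<epsilon> by (simp add: power_divide powr_minus powr_realpow field_simps)
        finally have 1: "(\<Prod>i\<in>B1. 2 * M i / (\<kappa> * \<epsilon>) + 2) \<le> C0 ^ k * \<epsilon> powr (- real k)" .
        have "(\<Prod>i\<in>B2. 2 * M i / (\<kappa> * \<epsilon>) + 2) \<le> (\<Prod>i\<in>B2. C0)"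
        proof (intro prod_mono conjI)
          fix i assume "i \<in> B2"
          then have Mi: "M i = 2 * \<epsilon> * (1 + E')" using disj by (auto simp: M_def)
          have eq: "2 * M i / (\<kappa> * \<epsilon>) + 2 = 4 * (1 + E') / \<kappa> + 2"
            unfolding Mi using \<epsilon> \<kappa> by (simp add: field_simps)
          show "0 \<le> 2 * M i / (\<kappa> * \<epsilon>) + 2" unfolding eq using E'0 \<kappa> by simp
          show "2 * M i / (\<kappa> * \<epsilon>) + 2 \<le> C0" unfolding eq C0_def
            using E'0 \<kappa> diameter_K_nonneg by simp
        qed
        also have "\<dots> \<le> C0 ^ DIM('a)" using card(2) C0 by (simp add: power_increasing)
        finally have 2: "(\<Prod>i\<in>B2. 2 * M i / (\<kappa> * \<epsilon>) + 2) \<le> C0 ^ DIM('a)" .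
        have "(\<Prod>i\<in>B1 \<union> B2. 2 * M i / (\<kappa> * \<epsilon>) + 2)
           = (\<Prod>i\<in>B1. 2 * M i / (\<kappa> * \<epsilon>) + 2) * (\<Prod>i\<in>B2. 2 * M i / (\<kappa> * \<epsilon>) + 2)"
          using fin disj by (rule prod.union_disjoint)
        also have "\<dots> \<le> (C0 ^ k * \<epsilon> powr (- real k)) * C0 ^ DIM('a)"
          using 1 2 C0 \<kappa> \<epsilon> E'0 by (intro mult_mono prod_nonneg) (auto simp: M_def diameter_K_nonneg)
        also have "\<dots> = C0 ^ (k + DIM('a)) * \<epsilon> powr (- real k)" by (simp add: power_add)
        also have "\<dots> \<le> C0 ^ (2 * DIM('a)) * \<epsilon> powr (- real k)"
          using kn C0 by (intro mult_right_mono power_increasing) auto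
        finally show ?thesis .
      qed
      have "real (card ?X) \<le> (\<Prod>i\<in>B1 \<union> B2. 2 * M i / (\<kappa> * \<epsilon>) + 2)"
      proof (rule card_le_of_separated(2)[of _ _ _ _ \<phi>])
        show "finite (B1 \<union> B2)" using fin by simp
        show "0 < \<kappa> * \<epsilon>" using \<kappa> \<epsilon> by simp
        show "0 \<le> M i" if "i \<in> B1 \<union> B2" for i unfolding M_def using E'0 \<epsilon> diameter_K_nonneg by simp
      next
        fix u e assume u: "u \<in> ?X" and e: "e \<in> B1 \<union> B2"
        obtain x y where x: "x \<in> K" "y \<in> L" "dist (hw u z0) x \<le> E' * \<epsilon>" "dist x y \<le> \<epsilon>"
          using near[OF u] by blast
        show "\<bar>\<phi> e u\<bar> \<le> M e"
        proof (cases "e \<in> B1")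
          case True
          have "\<bar>\<phi> e u\<bar> \<le> dist (hw u z0) (hw u0 z0)" unfolding \<phi>_def dist_norm by (rule ins[OF e])
          also have "\<dots> \<le> dist (hw u z0) x + dist x x0 + dist (hw u0 z0) x0" by metric
          also have "\<dots> \<le> E' * \<epsilon> + ?D + E' * \<epsilon>" using x x0 dist_K_le[OF x(1) x0(1)] by linarith
          also have "\<dots> \<le> 2 * E' + ?D" using E'0 \<epsilon> by (simp add: mult_left_le)
          finally show ?thesis using True by (simp add: M_def)
        next
          case False
          then have e2: "e \<in> B2" using e by blast
          \<comment> \<open>The middle term joins two points of L and is orthogonal to e, so only
            the two distances to L remain.\<close>
          have "\<phi> e u = ((hw u z0 - y) + (y - y0) + (y0 - hw u0 z0)) \<bullet> e" by (simp add: \<phi>_def)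
          also have "\<dots> = (hw u z0 - y) \<bullet> e + (y0 - hw u0 z0) \<bullet> e"
            using B2L[OF e2 x(2) x0(2)] by (simp add: inner_add_left inner_diff_left)
          finally have "\<bar>\<phi> e u\<bar> \<le> dist (hw u z0) y + dist y0 (hw u0 z0)"
            using ins[OF e, of "hw u z0 - y"] ins[OF e, of "y0 - hw u0 z0"] unfolding dist_norm by linarith
          also have "\<dots> \<le> (dist (hw u z0) x + dist x y) + (dist (hw u0 z0) x0 + dist x0 y0)"
            using dist_triangle[of "hw u z0" y x] dist_triangle[of "hw u0 z0" y0 x0]
            unfolding dist_commute[of y0] by linarith
          also have "\<dots> \<le> 2 * \<epsilon> * (1 + E')" using x x0 by (simp add: algebra_simps)
          finally show ?thesis using False by (simp add: M_def)
        qed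
      next
        fix u v assume uv: "u \<in> ?X" "v \<in> ?X" "u \<noteq> v"
        then have st: "u \<in> stop \<epsilon>" "v \<in> stop \<epsilon>" by (auto simp: stop_near_def)
        then have l: "u \<in> lists \<Lambda>" "v \<in> lists \<Lambda>" by (auto dest: stop_lists)
        have "hw u ` U \<inter> hw v ` U = {}"
          using prefix_free_stop st uv(3) l unfolding prefix_free_def by (intro hw_U_disjoint) auto
        moreover have "hw v z0 \<in> hw v ` U" using z0 by blast
        \<comment> \<open>\<open>hw u\<close> maps the ball of radius \<open>r0\<close> about
          \<open>z0\<close>, which lies in U, onto the ball of radius \<open>r0 * rw u\<close> about
          \<open>hw u z0\<close>.\<close>
        moreover have "hw v z0 \<in> hw u ` U" if "dist (hw v z0) (hw u z0) < r0 * rw u"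
        proof -
          obtain y where y: "hw u y = hw v z0" using surj_hw[OF l(1)] by blast
          then have "rw u * dist y z0 < r0 * rw u" using that dist_hw[OF l(1), of y z0] by simp
          then have "dist y z0 < r0" using rw_pos[OF l(1)] by simp
          then have "y \<in> U" using r0(2) by (auto simp: dist_commute)
          then show ?thesis using y by force
        qed
        ultimately have "r0 * rw u \<le> dist (hw v z0) (hw u z0)" by fastforce
        moreover have "r0 * (rmin * \<epsilon>) \<le> r0 * rw u" using stop_ge[OF st(1)] r0 by simp
        ultimately have far: "r0 * rmin * \<epsilon> \<le> norm (hw u z0 - hw v z0)"
          by (simp add: dist_norm norm_minus_commute)
        show "\<exists>e\<in>B1 \<union> B2. \<kappa> * \<epsilon> \<le> \<bar>\<phi> e u - \<phi> e v\<bar>"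
        proof (rule ccontr)
          assume "\<not> ?thesis"
          then have lt: "\<bar>(hw u z0 - hw v z0) \<bullet> e\<bar> < \<kappa> * \<epsilon>" if "e \<in> B1 \<union> B2" for e
            using that by (force simp: \<phi>_def inner_diff_left)
          have pos: "0 < norm (hw u z0 - hw v z0)" using far r0 rmin_pos \<epsilon> by (smt (verit) mult_pos_pos)
          have ne: "B1 \<union> B2 \<noteq> {}" using nrm[of "hw u z0 - hw v z0"] pos by auto
          have "norm (hw u z0 - hw v z0) \<le> (\<Sum>e\<in>B1 \<union> B2. \<bar>(hw u z0 - hw v z0) \<bullet> e\<bar>)" by (rule nrm)
          also have "\<dots> < (\<Sum>e\<in>B1 \<union> B2. \<kappa> * \<epsilon>)" using lt ne fin by (intro sum_strict_mono) auto
          also have "\<dots> \<le> (2 * ?n) * (\<kappa> * \<epsilon>)"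
          proof -
            have "card (B1 \<union> B2) \<le> 2 * DIM('a)" using card kn card_Un_le[of B1 B2] by linarith
            then have "real (card (B1 \<union> B2)) \<le> 2 * ?n" by linarith
            then show ?thesis using \<kappa> \<epsilon> by (simp add: mult_right_mono)
          qed
          also have "\<dots> = r0 * rmin * \<epsilon>" unfolding \<kappa>_def by simp
          finally show False using far by simp
        qed
      qed
      then show ?thesis using prodle by linarith
    qed
  qed
qed

text \<open>The tails of the stopped words below v are again prefix-free, so Kraft applies inside
  the cylinder of v: refining a cylinder creates no weight.\<close>

lemma sum_stop_prefix_le:
  assumes sum1: "(\<Sum>i\<in>\<Lambda>. \<rho> i powr s) \<le> 1" and \<tau>: "0 < \<tau>" and v: "v \<in> lists \<Lambda>"
  shows "(\<Sum>u\<in>{u \<in> stop \<tau>. prefix v u}. rw u powr s) \<le> rw v powr s"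
proof -
  let ?T = "{t. v @ t \<in> stop \<tau>}"
  obtain N where N: "\<And>w. w\<in>stop \<tau> \<Longrightarrow> length w \<le> N" using length_stop_bounded \<tau> by blast
  have eq: "{u \<in> stop \<tau>. prefix v u} = (\<lambda>t. v @ t) ` ?T" by (auto simp: prefix_def)
  have Tl: "t \<in> lists \<Lambda>" if "t \<in> ?T" for t using stop_lists[of "v @ t" \<tau>] that by auto
  have "(\<Sum>u\<in>{u \<in> stop \<tau>. prefix v u}. rw u powr s) = (\<Sum>t\<in>?T. rw (v @ t) powr s)"
    unfolding eq by (subst sum.reindex) (auto simp: inj_on_def)
  also have "\<dots> = (\<Sum>t\<in>?T. rw v powr s * word_prod (\<lambda>i. \<rho> i powr s) t)"
    using Tl rw_pos[OF v] by (intro sum.cong refl) (simp add: powr_mult word_prod_powr rw_pos less_imp_le)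
  also have "\<dots> = rw v powr s * (\<Sum>t\<in>?T. word_prod (\<lambda>i. \<rho> i powr s) t)" by (simp add: sum_distrib_left)
  also have "\<dots> \<le> rw v powr s * 1"
  proof (intro mult_left_mono kraft_inequality[OF finite_index _ sum1])
    show "?T \<subseteq> lists \<Lambda>" using Tl by blast
    show "length w \<le> N" if "w \<in> ?T" for w using N[of "v @ w"] that by simp
    show "prefix_free ?T" using prefix_free_stop[of \<tau>] unfolding prefix_free_def
      by (metis mem_Collect_eq same_append_eq same_prefix_prefix)
  qed auto
  finally show ?thesis by simp
qed

text \<open>Discrete form of the bound \<sigma>^(s-k) for the mass of a \<sigma>-neighbourhood:
  count the cylinders of size \<sigma> near L, give each the weight \<sigma>^s, and refine down to
  \<tau> at no cost. For \<sigma> \<ge> 1 the total weight 1 suffices, because C \<ge> 1 and k \<le>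
  s.\<close>

lemma mass_near_affine:
  assumes sum1: "(\<Sum>i\<in>\<Lambda>. \<rho> i powr s) \<le> 1"
  obtains C where "1 \<le> C" "\<And>\<tau> \<sigma> L k x0. 0 < \<tau> \<Longrightarrow> \<tau> \<le> \<sigma> \<Longrightarrow> affine L \<Longrightarrow> aff_dim L = int k \<Longrightarrow>
     real k \<le> s \<Longrightarrow> x0 \<in> K \<Longrightarrow>
     (\<Sum>u\<in>{u \<in> stop \<tau>. \<exists>y\<in>L. dist (hw u x0) y \<le> \<sigma>}. rw u powr s) \<le> C * \<sigma> powr (s - real k)"
proof -
  obtain C where C: "1 \<le> C" "\<And>\<epsilon> L k. 0 < \<epsilon> \<Longrightarrow> \<epsilon> < 1 \<Longrightarrow> affine L \<Longrightarrow> aff_dim L = int k \<Longrightarrow>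
     real (card (stop_near \<epsilon> L)) \<le> C * \<epsilon> powr (- real k)" using card_stop_near_affine by blast
  show thesis
  proof (rule that[OF C(1)])
    fix \<tau> \<sigma> :: real and L :: "'a set" and k x0
    assume \<tau>: "0 < \<tau>" "\<tau> \<le> \<sigma>" and L: "affine L" "aff_dim L = int k" and k: "real k \<le> s" and x0: "x0 \<in> K"
    let ?A = "{u \<in> stop \<tau>. \<exists>y\<in>L. dist (hw u x0) y \<le> \<sigma>}"
    have s0: "0 \<le> s" using k by linarith
    have finA: "finite ?A" using finite_stop[OF \<tau>(1)] by simp
    show "(\<Sum>u\<in>?A. rw u powr s) \<le> C * \<sigma> powr (s - real k)"
    proof (cases "1 \<le> \<sigma>")
      case True
      have "(\<Sum>u\<in>?A. rw u powr s) \<le> (\<Sum>u\<in>stop \<tau>. rw u powr s)"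
        using finite_stop[OF \<tau>(1)] by (intro sum_mono2) auto
      also have "\<dots> \<le> 1" by (rule sum_stop_le_1[OF sum1 \<tau>(1)])
      also have "1 \<le> C * \<sigma> powr (s - real k)"
        using mult_mono[OF C(1) ge_one_powr_ge_zero[OF True, of "s - real k"]] k C(1) by simp
      finally show ?thesis .
    next
      case False
      then have \<sigma>: "0 < \<sigma>" "\<sigma> < 1" using \<tau> by auto
      let ?T = "stop_near \<sigma> L"
      have finT: "finite ?T" using finite_stop[OF \<sigma>(1)] by (simp add: stop_near_def)
      have sub: "?A \<subseteq> (\<Union>v\<in>?T. {u \<in> stop \<tau>. prefix v u})"
      proof
        fix u assume u: "u \<in> ?A"
        then obtain y where y: "u \<in> stop \<tau>" "y \<in> L" "dist (hw u x0) y \<le> \<sigma>" by blast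
        have ul: "u \<in> lists \<Lambda>" using stop_lists y by blast
        have "rw u \<le> \<sigma>" using stop_le[OF y(1)] \<tau> by simp
        then obtain v where v: "v \<in> stop \<sigma>" "prefix v u" using stop_prefix_exists[OF ul] \<sigma>(2) by blast
        then obtain t where "u = v @ t" by (auto simp: prefix_def)
        note v = v(1) this
        have "t \<in> lists \<Lambda>" using v ul by simp
        then have "hw u x0 \<in> hw v ` K" using v x0 hw_K_subset[of t] by (auto simp: word_map_append)
        then have "v \<in> ?T" using v(1) y(2,3) unfolding stop_near_def by blast
        moreover have "u \<in> {u \<in> stop \<tau>. prefix v u}" using v y by simp
        ultimately show "u \<in> (\<Union>v\<in>?T. {u \<in> stop \<tau>. prefix v u})" by (rule UN_I)
      qed
      have "(\<Sum>u\<in>?A. rw u powr s) \<le> (\<Sum>u\<in>(\<Union>v\<in>?T. {u \<in> stop \<tau>. prefix v u}). rw u powr s)"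
        using finT finite_stop[OF \<tau>(1)] by (intro sum_mono2 sub) auto
      also have "\<dots> \<le> (\<Sum>v\<in>?T. \<Sum>u\<in>{u \<in> stop \<tau>. prefix v u}. rw u powr s)"
        using finT finite_stop[OF \<tau>(1)] by (intro sum_UN_le) auto
      also have "\<dots> \<le> (\<Sum>v\<in>?T. \<sigma> powr s)"
      proof (rule sum_mono)
        fix v assume "v \<in> ?T"
        then have v: "v \<in> stop \<sigma>" by (simp add: stop_near_def)
        have "(\<Sum>u\<in>{u \<in> stop \<tau>. prefix v u}. rw u powr s) \<le> rw v powr s"
          by (rule sum_stop_prefix_le[OF sum1 \<tau>(1) stop_lists[OF v]])
        also have "\<dots> \<le> \<sigma> powr s" using stop_le[OF v] rw_pos[OF stop_lists[OF v]] s0 by (intro powr_mono2) auto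
        finally show "(\<Sum>u\<in>{u \<in> stop \<tau>. prefix v u}. rw u powr s) \<le> \<sigma> powr s" .
      qed
      also have "\<dots> = real (card ?T) * \<sigma> powr s" by simp
      also have "\<dots> \<le> (C * \<sigma> powr (- real k)) * \<sigma> powr s"
        using C(2)[OF \<sigma> L] by (intro mult_right_mono) auto
      also have "\<dots> = C * \<sigma> powr (s - real k)" by (simp flip: powr_add)
      finally show ?thesis .
    qed
  qed
qed

text \<open>The same count as for the weights: cylinders of size \<epsilon> near L cover the
  neighbourhood within K, and each contributes at most a constant times \<epsilon>^s.\<close>

lemma hausdorff_outer_measure_near_affine_le:
  assumes sum1: "(\<Sum>i\<in>\<Lambda>. \<rho> i powr s) \<le> 1" and s: "0 < s"
  obtains C where "0 < C" "\<And>\<epsilon> L k. 0 < \<epsilon> \<Longrightarrow> \<epsilon> < 1 \<Longrightarrow> affine L \<Longrightarrow> aff_dim L = int k \<Longrightarrow>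
     hausdorff_outer_measure s (open_nbhd \<epsilon> L \<inter> K) \<le> ennreal (C * \<epsilon> powr (s - real k))"
proof -
  obtain C where C: "1 \<le> C" "\<And>\<epsilon> L k. 0 < \<epsilon> \<Longrightarrow> \<epsilon> < 1 \<Longrightarrow> affine L \<Longrightarrow> aff_dim L = int k \<Longrightarrow>
     real (card (stop_near \<epsilon> L)) \<le> C * \<epsilon> powr (- real k)" using card_stop_near_affine by blast
  let ?C = "(diameter K + 1) powr s * C"
  show thesis
  proof (rule that[of ?C])
    show "0 < ?C" using C diameter_K_nonneg by simp
    fix \<epsilon> :: real and L :: "'a set" and k
    assume \<epsilon>: "0 < \<epsilon>" "\<epsilon> < 1" and L: "affine L" "aff_dim L = int k"
    let ?T = "stop_near \<epsilon> L"
    have sub: "open_nbhd \<epsilon> L \<inter> K \<subseteq> (\<Union>w\<in>?T. hw w ` K)"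
    proof
      fix x assume x: "x \<in> open_nbhd \<epsilon> L \<inter> K"
      then obtain y where y: "y \<in> L" "dist x y \<le> \<epsilon>" by (auto simp: open_nbhd_def dist_commute)
      obtain u where "u \<in> stop \<epsilon>" "x \<in> hw u ` K" using cylinder_subset_stop[of "[]" \<epsilon>] x \<epsilon> by auto
      then show "x \<in> (\<Union>w\<in>?T. hw w ` K)" using y by (auto simp: stop_near_def)
    qed
    have "hausdorff_outer_measure s (open_nbhd \<epsilon> L \<inter> K) \<le> ennreal (diameter K powr s * (\<Sum>w\<in>?T. rw w powr s))"
      using finite_stop[OF \<epsilon>(1)] stop_lists
      by (intro hausdorff_outer_measure_cylinders_le[OF s sum1 _ _ sub]) (auto simp: stop_near_def)
    also have "\<dots> \<le> ennreal (?C * \<epsilon> powr (s - real k))"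
    proof (rule ennreal_leI)
      have "(\<Sum>w\<in>?T. rw w powr s) \<le> (\<Sum>w\<in>?T. \<epsilon> powr s)"
        using stop_le rw_pos stop_lists s by (intro sum_mono powr_mono2) (auto simp: stop_near_def less_imp_le)
      also have "\<dots> = real (card ?T) * \<epsilon> powr s" by simp
      also have "\<dots> \<le> (C * \<epsilon> powr (- real k)) * \<epsilon> powr s"
        using C(2)[OF \<epsilon> L] by (intro mult_right_mono) auto
      also have "\<dots> = C * \<epsilon> powr (s - real k)" by (simp flip: powr_add)
      finally have "(\<Sum>w\<in>?T. rw w powr s) \<le> C * \<epsilon> powr (s - real k)" .
      moreover have "diameter K powr s \<le> (diameter K + 1) powr s"
        using s diameter_K_nonneg by (intro powr_mono2) auto
      ultimately show "diameter K powr s * (\<Sum>w\<in>?T. rw w powr s) \<le> ?C * \<epsilon> powr (s - real k)"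
        unfolding mult.assoc by (intro mult_mono sum_nonneg) auto
    qed
    finally show "hausdorff_outer_measure s (open_nbhd \<epsilon> L \<inter> K) \<le> ennreal (?C * \<epsilon> powr (s - real k))" .
  qed
qed

end

section \<open>The similarity dimension and the exponents\<close>

context similarity_ifs
begin

text \<open>The packing count with L the whole space. It yields s \<le> d, hence
  \<open>\<alpha> \<le> 1\<close>, so that \<alpha> and 1 - \<alpha> can serve as interpolation
  weights.\<close>

lemma hausdorff_dim_le_DIM: "hausdorff_dim K \<le> ereal (real DIM('a))"
proof (rule hausdorff_dim_le)
  fix t :: real assume t: "real DIM('a) < t"
  let ?n = "real DIM('a)"
  obtain C where C: "1 \<le> C" "\<And>\<epsilon> L k. 0 < \<epsilon> \<Longrightarrow> \<epsilon> < 1 \<Longrightarrow> affine L \<Longrightarrow> aff_dim L = int k \<Longrightarrow>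
     real (card (stop_near \<epsilon> L)) \<le> C * \<epsilon> powr (- real k)" using card_stop_near_affine by blast
  let ?D = "diameter K + 1"
  have D: "0 < ?D" using diameter_K_nonneg by simp
  show "hausdorff_outer_measure t K = 0"
  proof (rule hausdorff_outer_measure_null_of_finite_covers)
    show "0 < t" using t by (meson less_trans of_nat_0_less_iff DIM_positive)
    fix \<delta> c :: real assume \<delta>: "0 < \<delta>" and c: "0 < c"
    have "((\<lambda>\<epsilon>. ?D powr t * C * \<epsilon> powr (t - ?n)) \<longlongrightarrow> ?D powr t * C * 0) (at_right 0)"
      using t eventually_at_right_less[of "0::real"]
      by (intro tendsto_mult tendsto_const tendsto_zero_powrI[OF tendsto_ident_at tendsto_const])
        (auto elim: eventually_mono)
    then have "\<forall>\<^sub>F \<epsilon> in at_right 0. ?D powr t * C * \<epsilon> powr (t - ?n) < c"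
      using c by (intro order_tendstoD(2)) auto
    moreover have "\<forall>\<^sub>F \<epsilon> in at_right 0. \<epsilon> < min 1 (\<delta> / ?D)"
      using \<delta> D eventually_at_right_real[of 0 "min 1 (\<delta> / ?D)"] by (auto elim: eventually_mono)
    moreover have "\<forall>\<^sub>F \<epsilon> in at_right 0. 0 < (\<epsilon>::real)" by (rule eventually_at_right_less)
    ultimately have "\<forall>\<^sub>F \<epsilon> in at_right 0. ?D powr t * C * \<epsilon> powr (t - ?n) < c \<and> \<epsilon> < min 1 (\<delta> / ?D) \<and> 0 < \<epsilon>"
      by (intro eventually_conj)
    then obtain \<epsilon> where "?D powr t * C * \<epsilon> powr (t - ?n) < c \<and> \<epsilon> < min 1 (\<delta> / ?D) \<and> 0 < \<epsilon>"
      using eventually_happens' [OF trivial_limit_at_right_real] by blast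
    then have \<epsilon>: "?D powr t * C * \<epsilon> powr (t - ?n) < c" "\<epsilon> < 1" "\<epsilon> < \<delta> / ?D" "0 < \<epsilon>" by auto
    let ?V = "\<lambda>u. hw u ` K"
    have eq: "stop_near \<epsilon> UNIV = stop \<epsilon>" 
    proof -
      obtain x where "x \<in> K" using K_nonempty by blast
      moreover have "dist y y \<le> \<epsilon>" for y :: 'a using \<epsilon> by simp
      ultimately show ?thesis unfolding stop_near_def by blast
    qed
    have card: "real (card (stop \<epsilon>)) \<le> C * \<epsilon> powr (- ?n)"
      using C(2)[OF \<epsilon>(4,2), of UNIV "DIM('a)"] eq by simp
    have dle: "diameter (?V u) \<le> \<epsilon> * ?D" if "u \<in> stop \<epsilon>" for u
    proof -
      have "diameter (?V u) \<le> rw u * diameter K" using stop_lists[OF that] by (rule diameter_cylinder_le)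
      also have "\<dots> \<le> \<epsilon> * ?D" using stop_le[OF that] \<epsilon> diameter_K_nonneg by (intro mult_mono) auto
      finally show ?thesis .
    qed
    have "K \<subseteq> (\<Union>u\<in>stop \<epsilon>. ?V u)" using cylinder_subset_stop[of "[]" \<epsilon>] \<epsilon> by auto
    moreover have "bounded (?V u) \<and> diameter (?V u) \<le> \<delta>" if "u \<in> stop \<epsilon>" for u
    proof -
      have "\<epsilon> * ?D \<le> \<delta>" using \<epsilon>(3) D by (simp add: field_simps)
      then show ?thesis using dle[OF that] bounded_cylinder[OF stop_lists[OF that]] by auto
    qed
    moreover have "(\<Sum>u\<in>stop \<epsilon>. diameter (?V u) powr t) \<le> c"
    proof -
      have "(\<Sum>u\<in>stop \<epsilon>. diameter (?V u) powr t) \<le> (\<Sum>u\<in>stop \<epsilon>. (\<epsilon> * ?D) powr t)"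
        using dle \<open>0 < t\<close> bounded_cylinder stop_lists
        by (intro sum_mono powr_mono2 diameter_ge_0) auto
      also have "\<dots> = real (card (stop \<epsilon>)) * (\<epsilon> powr t * ?D powr t)" using \<epsilon> D by (simp add: powr_mult)
      also have "\<dots> \<le> (C * \<epsilon> powr (- ?n)) * (\<epsilon> powr t * ?D powr t)" using card by (intro mult_right_mono) auto
      also have "\<dots> = ?D powr t * C * (\<epsilon> powr t * \<epsilon> powr (- ?n))" by (simp add: mult_ac)
      also have "\<dots> = ?D powr t * C * \<epsilon> powr (t - ?n)" by (simp flip: powr_add)
      finally show ?thesis using \<epsilon>(1) by linarith
    qed
    ultimately show "\<exists>T (V :: 'i list \<Rightarrow> 'a set). finite T \<and> K \<subseteq> (\<Union>t\<in>T. V t) \<and>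
       (\<forall>t\<in>T. bounded (V t) \<and> diameter (V t) \<le> \<delta>) \<and> (\<Sum>u\<in>T. diameter (V u) powr t) \<le> c"
      using finite_stop[OF \<epsilon>(4)] by (intro exI[of _ "stop \<epsilon>"] exI[of _ ?V]) auto
  qed
qed simp

text \<open>Lower bound of the mass distribution principle: if \<open>\<Sum>\<rho>\<^sub>i\<^sup>t \<ge> 1\<close>, a cover of \<open>K\<close> with small \<open>t\<close>-sum would
  turn into a prefix cover of the tree of words by boundedly many words per covering set.\<close>
lemma hausdorff_outer_measure_nonzero:
  assumes t: "0 < t" and ge1: "1 \<le> (\<Sum>i\<in>\<Lambda>. \<rho> i powr t)"
  shows "hausdorff_outer_measure t K \<noteq> 0"
proof
  assume "hausdorff_outer_measure t K = 0"
  then have null: "hausdorff_premeasure t 1 K = 0" by (simp add: hausdorff_outer_measure_null_iff)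
  obtain C where C: "1 \<le> C" "\<And>\<epsilon> L k. 0 < \<epsilon> \<Longrightarrow> \<epsilon> < 1 \<Longrightarrow> affine L \<Longrightarrow> aff_dim L = int k \<Longrightarrow>
     real (card (stop_near \<epsilon> L)) \<le> C * \<epsilon> powr (- real k)" using card_stop_near_affine by blast
  \<comment> \<open>The concluding estimate is 1 \<le> C (e + e), which this value contradicts; e
    \<le> 1 / 4 also keeps the radii below 1.\<close>
  define e where "e = 1 / (4 * C)"
  have e: "0 < e" "e \<le> 1/4" "C * (2 * e) < 1" using C by (auto simp: e_def field_simps)
  obtain V where V: "K \<subseteq> (\<Union>n. V n)" "\<And>n::nat. bounded (V n)" "(\<Sum>n. hausdorff_gauge t (V n)) < ennreal e"
    using null e unfolding hausdorff_premeasure_null_iff by metis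
  let ?d = "\<lambda>n. diameter (V n)"
  have d0: "0 \<le> ?d n" for n using V(2) diameter_ge_0 by blast
  \<comment> \<open>Radii strictly larger than the diameters, also when these are 0, so that open
    balls cover K and compactness applies; the enlargement adds at most e to the t-sum.\<close>
  define \<eta> where "\<eta> n = (?d n powr t + e * (1/2) ^ Suc n) powr (1 / t)" for n
  have \<eta>t: "\<eta> n powr t = ?d n powr t + e * (1/2) ^ Suc n" for n
  proof -
    have "0 < ?d n powr t + e * (1/2) ^ Suc n" using e by (intro add_nonneg_pos) simp_all
    then show ?thesis using t by (simp add: \<eta>_def powr_powr)
  qed
  have \<eta>pos: "0 < \<eta> n" for n
  proof -
    have "0 < ?d n powr t + e * (1/2) ^ Suc n" using e by (intro add_nonneg_pos) simp_all
    then show ?thesis by (simp add: \<eta>_def)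
  qed
  have d\<eta>: "?d n < \<eta> n" for n
  proof (rule ccontr)
    assume "\<not> ?d n < \<eta> n"
    then have "\<eta> n powr t \<le> ?d n powr t" using \<eta>pos[of n] t by (intro powr_mono2) auto
    moreover have "0 < e * (1/2) ^ Suc n" using e by simp
    ultimately show False using \<eta>t[of n] by linarith
  qed
  have sumle: "(\<Sum>n\<in>F. ?d n powr t) \<le> e" if F: "finite F" "\<And>n. n \<in> F \<Longrightarrow> V n \<noteq> {}" for F
  proof -
    have "ennreal (\<Sum>n\<in>F. ?d n powr t) = (\<Sum>n\<in>F. ennreal (?d n powr t))" by (rule sum_ennreal[symmetric]) simp
    also have "\<dots> = (\<Sum>n\<in>F. hausdorff_gauge t (V n))"
      using F t by (intro sum.cong refl) (simp add: hausdorff_gauge_def)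
    also have "\<dots> \<le> (\<Sum>n. hausdorff_gauge t (V n))" using F(1) by (intro sum_le_suminf) auto
    also have "\<dots> < ennreal e" by (rule V(3))
    finally show ?thesis using e by (simp add: ennreal_less_iff sum_nonneg)
  qed
  have \<eta>1: "\<eta> n < 1" if "V n \<noteq> {}" for n
  proof (rule ccontr)
    assume "\<not> \<eta> n < 1"
    then have "1 \<le> \<eta> n powr t" using t by (intro ge_one_powr_ge_zero) auto
    moreover have "?d n powr t \<le> e" using sumle[of "{n}"] that by simp
    moreover have "e * (1/2) ^ Suc n \<le> e * 1" using e by (intro mult_left_mono power_le_one) auto
    ultimately show False using \<eta>t[of n] e by linarith
  qed
  have "\<forall>n. \<exists>y. V n \<noteq> {} \<longrightarrow> y \<in> V n" by blast
  then obtain y where y: "\<And>n. V n \<noteq> {} \<Longrightarrow> y n \<in> V n" by metis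
  have "K \<subseteq> (\<Union>n\<in>{n. V n \<noteq> {}}. ball (y n) (\<eta> n))"
  proof
    fix x assume "x \<in> K"
    then obtain n where n: "x \<in> V n" using V(1) by blast
    then have "y n \<in> V n" using y by blast
    then have "dist (y n) x \<le> ?d n" using n V(2) diameter_bounded_bound by blast
    then have "x \<in> ball (y n) (\<eta> n)" using d\<eta>[of n] by simp
    then show "x \<in> (\<Union>n\<in>{n. V n \<noteq> {}}. ball (y n) (\<eta> n))" using n by blast
  qed
  then obtain F where F: "F \<subseteq> {n. V n \<noteq> {}}" "finite F" "K \<subseteq> (\<Union>n\<in>F. ball (y n) (\<eta> n))"
    by (rule compactE_image[OF K_compact, rotated]) auto
  have FV: "V n \<noteq> {}" if "n \<in> F" for n using F(1) that by blast
  define T where "T = (\<Union>n\<in>F. stop_near (\<eta> n) {y n})"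
  have finT: "finite T" using F(2) finite_stop[OF \<eta>pos] by (simp add: T_def stop_near_def)
  have Tl: "T \<subseteq> lists \<Lambda>" using stop_lists by (auto simp: T_def stop_near_def)
  have Fne: "F \<noteq> {}" using F(3) K_nonempty by auto
  define \<eta>0 where "\<eta>0 = Min (\<eta> ` F)"
  have \<eta>0: "0 < \<eta>0" "\<And>n. n \<in> F \<Longrightarrow> \<eta>0 \<le> \<eta> n" unfolding \<eta>0_def using F(2) Fne \<eta>pos by auto
  \<comment> \<open>At this depth every cylinder is smaller than all the radii in use, so every
    branch of length N has passed the stopping scale of whichever ball contains its point.\<close>
  obtain N where N: "rmax ^ N < \<eta>0" using real_arch_pow_inv[OF \<eta>0(1) rmax_less_1] by blast
  have "1 \<le> (\<Sum>w\<in>T. word_prod (\<lambda>i. \<rho> i powr t) w)"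
  proof (rule one_le_sum_word_prod_of_prefix_cover[OF finite_index _ ge1 finT Tl])
    fix v assume v: "v \<in> lists \<Lambda>" "length v = N"
    obtain x0 where x0: "x0 \<in> K" using K_nonempty by blast
    then have "hw v x0 \<in> K" using hw_K_subset[OF v(1)] by blast
    then obtain n where n: "n \<in> F" "dist (y n) (hw v x0) < \<eta> n" using F(3) by auto
    have "rw v \<le> \<eta> n" using rw_le_power[OF v(1)] v(2) N \<eta>0(2)[OF n(1)] by simp
    then obtain u where u: "u \<in> stop (\<eta> n)" "prefix u v"
      using stop_prefix_exists[OF v(1)] \<eta>1[OF FV[OF n(1)]] by blast
    then obtain s where s: "v = u @ s" by (auto simp: prefix_def)
    then have "s \<in> lists \<Lambda>" using v by simp
    then have "hw v x0 \<in> hw u ` K" using s x0 hw_K_subset[of s] by (auto simp: word_map_append)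
    then have "u \<in> stop_near (\<eta> n) {y n}" using u n unfolding stop_near_def
      by (force simp: dist_commute)
    then show "\<exists>u\<in>T. prefix u v" using u n by (auto simp: T_def)
  qed simp
  also have "\<dots> = (\<Sum>w\<in>T. rw w powr t)"
    using Tl by (intro sum.cong refl word_prod_powr) auto
  also have "\<dots> \<le> (\<Sum>n\<in>F. \<Sum>w\<in>stop_near (\<eta> n) {y n}. rw w powr t)"
    unfolding T_def using F(2) finite_stop[OF \<eta>pos] by (intro sum_UN_le) (auto simp: stop_near_def)
  also have "\<dots> \<le> (\<Sum>n\<in>F. C * \<eta> n powr t)"
  proof (rule sum_mono)
    fix n assume n: "n \<in> F"
    have "(\<Sum>w\<in>stop_near (\<eta> n) {y n}. rw w powr t) \<le> (\<Sum>w\<in>stop_near (\<eta> n) {y n}. \<eta> n powr t)"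
      using stop_le rw_pos stop_lists t by (intro sum_mono powr_mono2) (auto simp: stop_near_def less_imp_le)
    also have "\<dots> = real (card (stop_near (\<eta> n) {y n})) * \<eta> n powr t" by simp
    also have "\<dots> \<le> C * \<eta> n powr t"
      using C(2)[OF \<eta>pos \<eta>1[OF FV[OF n]], of "{y n}" 0] \<eta>pos[of n] by (intro mult_right_mono) auto
    finally show "(\<Sum>w\<in>stop_near (\<eta> n) {y n}. rw w powr t) \<le> C * \<eta> n powr t" .
  qed
  also have "\<dots> = C * ((\<Sum>n\<in>F. ?d n powr t) + (\<Sum>n\<in>F. e * (1/2) ^ Suc n))"
    by (simp only: \<eta>t sum_distrib_left sum.distrib distrib_left)
  also have "\<dots> \<le> C * (e + e)"
  proof (intro mult_left_mono add_mono)
    show "(\<Sum>n\<in>F. ?d n powr t) \<le> e" using sumle F(2) FV by blast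
    have "(\<Sum>n\<in>F. (1/2) ^ Suc n) \<le> (\<Sum>n. (1/2::real) ^ Suc n)"
      using power_half_series by (intro sum_le_suminf F(2)) (auto simp: sums_iff)
    then have "(\<Sum>n\<in>F. (1/2::real) ^ Suc n) \<le> 1" using power_half_series by (simp add: sums_iff)
    then have "e * (\<Sum>n\<in>F. (1/2::real) ^ Suc n) \<le> e * 1" using e by (intro mult_left_mono) auto
    then show "(\<Sum>n\<in>F. e * (1/2) ^ Suc n) \<le> e" by (simp only: sum_distrib_left mult_1_right)
  qed (use C in auto)
  also have "\<dots> < 1" using e(3) by simp
  finally show False by simp
qed

text \<open>If the sum exceeded 1 at s, by continuity it would exceed 1 at some t > s, where the
  outer measure of K vanishes by definition of the dimension but is nonzero by the mass distribution
  bound.\<close>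

lemma sum_ratio_powr_dim_le_1:
  assumes dim: "hausdorff_dim K = ereal s" and s: "0 < s"
  shows "(\<Sum>i\<in>\<Lambda>. \<rho> i powr s) \<le> 1"
proof (rule ccontr)
  assume "\<not> ?thesis"
  then have gt: "1 < (\<Sum>i\<in>\<Lambda>. \<rho> i powr s)" by simp
  have "((\<lambda>t. \<Sum>i\<in>\<Lambda>. \<rho> i powr t) \<longlongrightarrow> (\<Sum>i\<in>\<Lambda>. \<rho> i powr s)) (at_right s)"
    using ratio_pos by (intro tendsto_sum tendsto_powr tendsto_const tendsto_ident_at) fastforce
  then have "\<forall>\<^sub>F t in at_right s. 1 < (\<Sum>i\<in>\<Lambda>. \<rho> i powr t)" using gt by (rule order_tendstoD(1))
  moreover have "\<forall>\<^sub>F t in at_right s. s < t" by (rule eventually_at_right_less)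
  ultimately have "\<forall>\<^sub>F t in at_right s. 1 < (\<Sum>i\<in>\<Lambda>. \<rho> i powr t) \<and> s < t" by (rule eventually_conj)
  then obtain t where t: "1 < (\<Sum>i\<in>\<Lambda>. \<rho> i powr t)" "s < t"
    using eventually_happens' [OF trivial_limit_at_right_real] by blast
  have "hausdorff_outer_measure t K = 0"
    by (rule hausdorff_outer_measure_null_above_dim) (simp add: dim t)
  then show False using hausdorff_outer_measure_nonzero[of t] t s by auto
qed

end

text \<open>The \<open>emeasure\<close> of a \<open>measure_of\<close> is either the given set
  function or 0, and the outer measure bounds it in both cases.\<close>

lemma emeasure_restrict_hausdorff_le:
  fixes A K :: "'a::metric_space set"
  assumes "A \<in> sets borel" "K \<in> sets borel"
  shows "emeasure (restrict_measure_to (hausdorff_measure s) K) A \<le> hausdorff_outer_measure s (A \<inter> K)"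
proof -
  have sets: "sets (hausdorff_measure s :: 'a measure) = sets borel"
    unfolding hausdorff_measure_def using sets.space_closed[of borel]
    by (simp add: sets.sigma_sets_eq[of borel, simplified])
  have "emeasure (restrict_measure_to (hausdorff_measure s) K) A
     = (\<integral>\<^sup>+x. indicator K x * indicator A x \<partial>hausdorff_measure s)"
    unfolding restrict_measure_to_def using assms sets
    by (intro emeasure_density) (auto intro!: borel_measurable_indicator)
  also have "\<dots> = (\<integral>\<^sup>+x. indicator (A \<inter> K) x \<partial>hausdorff_measure s)"
    by (intro nn_integral_cong) (auto simp: indicator_def)
  also have "\<dots> = emeasure (hausdorff_measure s) (A \<inter> K)"
    using assms sets by (intro nn_integral_indicator) auto
  also have "\<dots> \<le> hausdorff_outer_measure s (A \<inter> K)"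
    unfolding hausdorff_measure_def by (simp add: emeasure_measure_of_conv)
  finally show ?thesis .
qed

lemma open_open_nbhd: "open (open_nbhd \<epsilon> L)"
  by (auto simp: open_nbhd_def)

lemma ext_ln_mono:
  assumes "x \<le> y" shows "ext_ln x \<le> ext_ln y"
proof -
  consider "x = 0" | "y = top" | "x \<noteq> 0" "y \<noteq> top" by blast
  then show ?thesis
  proof cases
    case 3
    then have "x \<noteq> top" "y \<noteq> 0" using assms by (auto simp: top_unique)
    moreover have "0 < enn2real x" using 3 \<open>x \<noteq> top\<close> by (simp add: enn2real_positive_iff less_top zero_less_iff_neq_zero)
    moreover have "enn2real x \<le> enn2real y" using assms 3 by (intro enn2real_mono) (simp_all add: less_top)
    ultimately show ?thesis using 3 by (simp add: ext_ln_def)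
  qed (auto simp: ext_ln_def)
qed

text \<open>Division by the negative number \<open>ln \<epsilon>\<close> turns the upper bound C
  \<epsilon>^(s-k) into a lower bound for the quotient, and the contribution
  \<open>ln C / ln \<epsilon>\<close> of the constant tends to 0.\<close>

lemma (in similarity_ifs) Liminf_neighbourhood_exponent_ge:
  assumes sum1: "(\<Sum>i\<in>\<Lambda>. \<rho> i powr s) \<le> 1" and s: "0 < s"
    and \<mu>: "\<mu> = restrict_measure_to (hausdorff_measure s) K"
  shows "ereal (s - real k) \<le> Liminf (at_right (0::real))
       (\<lambda>\<epsilon>. ext_ln (SUP L \<in> affine_subspaces k. emeasure \<mu> (open_nbhd \<epsilon> L)) / ereal (ln \<epsilon>))"
proof -
  obtain C where C: "0 < C" "\<And>\<epsilon> L k. 0 < \<epsilon> \<Longrightarrow> \<epsilon> < 1 \<Longrightarrow> affine L \<Longrightarrow> aff_dim L = int k \<Longrightarrow>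
     hausdorff_outer_measure s (open_nbhd \<epsilon> L \<inter> K) \<le> ennreal (C * \<epsilon> powr (s - real k))"
    using hausdorff_outer_measure_near_affine_le[OF sum1 s] by blast
  let ?f = "\<lambda>\<epsilon>. ext_ln (SUP L \<in> affine_subspaces k. emeasure \<mu> (open_nbhd \<epsilon> L)) / ereal (ln \<epsilon>)"
  let ?g = "\<lambda>\<epsilon>. ereal (ln C / ln \<epsilon> + (s - real k))"
  have K: "K \<in> sets borel" using K_compact by (simp add: borel_compact)
  have le: "?g \<epsilon> \<le> ?f \<epsilon>" if \<epsilon>: "0 < \<epsilon>" "\<epsilon> < 1" for \<epsilon>
  proof -
    have "(SUP L \<in> affine_subspaces k. emeasure \<mu> (open_nbhd \<epsilon> L)) \<le> ennreal (C * \<epsilon> powr (s - real k))"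
    proof (rule SUP_least)
      fix L :: "'a set" assume "L \<in> affine_subspaces k"
      then have L: "affine L" "aff_dim L = int k" by (auto simp: affine_subspaces_def)
      have "emeasure \<mu> (open_nbhd \<epsilon> L) \<le> hausdorff_outer_measure s (open_nbhd \<epsilon> L \<inter> K)"
        unfolding \<mu> by (rule emeasure_restrict_hausdorff_le[OF _ K]) (simp add: open_open_nbhd)
      also have "\<dots> \<le> ennreal (C * \<epsilon> powr (s - real k))" by (rule C(2)[OF \<epsilon> L])
      finally show "emeasure \<mu> (open_nbhd \<epsilon> L) \<le> ennreal (C * \<epsilon> powr (s - real k))" .
    qed
    then have "ext_ln (SUP L \<in> affine_subspaces k. emeasure \<mu> (open_nbhd \<epsilon> L)) \<le> ext_ln (ennreal (C * \<epsilon> powr (s - real k)))"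
      by (rule ext_ln_mono)
    also have "\<dots> = ereal (ln C + (s - real k) * ln \<epsilon>)"
      using C(1) \<epsilon> by (simp add: ext_ln_def ln_mult ln_powr)
    finally have e: "ext_ln (SUP L \<in> affine_subspaces k. emeasure \<mu> (open_nbhd \<epsilon> L)) \<le> ereal (ln C + (s - real k) * ln \<epsilon>)" .
    have ln: "ln \<epsilon> < 0" using \<epsilon> by simp
    have "?g \<epsilon> = ereal (ln C + (s - real k) * ln \<epsilon>) / ereal (ln \<epsilon>)"
      using ln by (simp add: add_divide_distrib)
    also have "\<dots> \<le> ?f \<epsilon>"
      using e ln by (cases "ext_ln (SUP L \<in> affine_subspaces k. emeasure \<mu> (open_nbhd \<epsilon> L))")
        (auto simp: divide_right_mono_neg)
    finally show ?thesis .
  qed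
  have "((\<lambda>\<epsilon>. ln C / ln \<epsilon> + (s - real k)) \<longlongrightarrow> 0 + (s - real k)) (at_right 0)"
    by (rule tendsto_add[OF tendsto_divide_0[OF tendsto_const
          filterlim_mono[OF ln_at_0 at_bot_le_at_infinity order_refl]] tendsto_const])
  then have "(?g \<longlongrightarrow> ereal (s - real k)) (at_right 0)" by simp
  then have "ereal (s - real k) = Liminf (at_right 0) ?g"
    by (intro lim_imp_Liminf[symmetric]) simp_all
  also have "\<dots> \<le> Liminf (at_right 0) ?f"
  proof (rule Liminf_mono)
    have "\<forall>\<^sub>F \<epsilon> in at_right 0. \<epsilon> \<in> {0<..<1::real}" by (rule eventually_at_right_real) simp
    then show "\<forall>\<^sub>F \<epsilon> in at_right 0. ?g \<epsilon> \<le> ?f \<epsilon>" by (rule eventually_mono) (use le in auto)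
  qed
  finally show ?thesis .
qed

section \<open>Simultaneous approximation\<close>

text \<open>Norm of the vector of the lattice dual to the one of linear forms at scale \<open>r\<close>: a pair \<open>(q, p)\<close> is
  a simultaneous approximation \<open>p / q\<close> of \<open>x\<close>.\<close>
definition approx_size :: "real ^ 'd \<Rightarrow> real \<Rightarrow> int \<times> (int ^ 'd) \<Rightarrow> real" where
  "approx_size x r v = max (\<bar>real_of_int (fst v)\<bar> * r powr (real CARD('d) / (real CARD('d) + 1)))
     (norm (real_of_int (fst v) *\<^sub>R x - real_vec (snd v)) * r powr (- 1 / (real CARD('d) + 1)))"

text \<open>First minimum of a unimodular lattice: the exponents in \<open>approx_size\<close> make
  the rescaling volume preserving, since one factor r^(d/(d+1)) meets d factors
  r^(-1/(d+1)).\<close>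

definition approx_min :: "real ^ 'd \<Rightarrow> real \<Rightarrow> real" where
  "approx_min x r = Inf (approx_size x r ` {v. v \<noteq> (0, 0)})"

text \<open>Pairing of the two dual lattices. In w the first entry is the constant term of a linear
  form and the second its coefficients; in v they are denominator and numerators.\<close>

definition int_form :: "int \<times> (int ^ 'd) \<Rightarrow> int \<times> (int ^ 'd) \<Rightarrow> int" where
  "int_form w v = fst w * fst v + (\<Sum>i\<in>UNIV. snd w $ i * snd v $ i)"

text \<open>All that is retained of singularity at the scale r. The condition becomes stronger as A
  grows.\<close>

definition trapped :: "real \<Rightarrow> real ^ 'd \<Rightarrow> real \<Rightarrow> bool" where
  "trapped A x r \<longleftrightarrow> (\<exists>w. w \<noteq> (0, 0) \<and> (\<forall>v. approx_size x r v \<le> A \<longrightarrow> int_form w v = 0))"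

lemma real_vec_nth [simp]: "real_vec q $ i = real_of_int (q $ i)"
  by (simp add: real_vec_def)

lemma real_vec_eq_0_iff: "real_vec q = 0 \<longleftrightarrow> q = 0"
  by (auto simp: vec_eq_iff)

lemma one_le_norm_real_vec: "q \<noteq> 0 \<Longrightarrow> 1 \<le> norm (real_vec q)"
proof -
  assume "q \<noteq> 0"
  then obtain i where "q $ i \<noteq> 0" by (auto simp: vec_eq_iff)
  then have "1 \<le> \<bar>real_vec q $ i\<bar>" by simp
  then show ?thesis using component_le_norm_cart[of "real_vec q" i] by linarith
qed

lemma approx_size_nonneg: "0 \<le> approx_size x r v"
  by (simp add: approx_size_def le_max_iff_disj)

lemma approx_min_le: "v \<noteq> (0, 0) \<Longrightarrow> approx_min x r \<le> approx_size x r v"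
  unfolding approx_min_def
  by (rule cInf_lower) (auto intro!: bdd_belowI[of _ 0] approx_size_nonneg)

lemma nonzero_pairs: "{v :: int \<times> (int ^ 'd). v \<noteq> (0, 0)} \<noteq> {}"
proof -
  have "(1, 0) \<in> {v :: int \<times> (int ^ 'd). v \<noteq> (0, 0)}" by simp
  then show ?thesis by (metis empty_iff)
qed

lemma approx_min_lessD: "approx_min x r < y \<Longrightarrow> \<exists>v. v \<noteq> (0, 0) \<and> approx_size x r v < y"
  unfolding approx_min_def using cInf_lessD[of "approx_size x r ` {v. v \<noteq> (0, 0)}" y] nonzero_pairs by blast

lemma approx_min_pos:
  fixes x :: "real ^ 'd"
  assumes "0 < r" shows "0 < approx_min x r"
proof -
  let ?a = "r powr (real CARD('d) / (real CARD('d) + 1))" and ?b = "r powr (- 1 / (real CARD('d) + 1))"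
  have "min ?a ?b \<le> approx_size x r v" if v: "v \<noteq> (0, 0)" for v :: "int \<times> (int ^ 'd)"
  proof (cases "fst v = 0")
    case True
    then have "1 \<le> norm (real_vec (snd v))" using v by (intro one_le_norm_real_vec) (auto simp: prod_eq_iff)
    then have "?b \<le> norm (real_vec (snd v)) * ?b" using mult_right_mono[of 1 "norm (real_vec (snd v))" ?b] by simp
    then show ?thesis using True by (simp add: approx_size_def)
  next
    case False
    then have "1 \<le> \<bar>real_of_int (fst v)\<bar>" by simp
    then have "?a \<le> \<bar>real_of_int (fst v)\<bar> * ?a" using mult_right_mono[of 1 _ ?a] by simp
    then show ?thesis unfolding approx_size_def by linarith
  qed
  then have "min ?a ?b \<le> approx_min x r" unfolding approx_min_def
    using nonzero_pairs by (intro cInf_greatest) auto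
  moreover have "0 < min ?a ?b" using assms by simp
  ultimately show ?thesis by linarith
qed

lemma approx_min_le_const:
  fixes x :: "real ^ 'd"
  assumes r: "0 < r" "r \<le> 1"
  shows "approx_min x r \<le> 2 ^ CARD('d) + real CARD('d)"
proof -
  let ?d = "real CARD('d)"
  let ?R = "r powr (- 1 / (?d + 1))"
  have R1: "1 \<le> ?R" using r powr_mono'[of "- 1 / (?d + 1)" 0 r] by simp
  \<comment> \<open>With N about r^(-1/(d+1)) both parts of the size are bounded: the denominator by
    N^d, which matches r^(-d/(d+1)), and the error in each coordinate by 1 / N.\<close>
  define N where "N = nat \<lceil>?R\<rceil>"
  have N: "?R \<le> real N" "real N \<le> 2 * ?R" "0 < N" using R1 unfolding N_def by linarith+
  obtain f where f: "bij_betw f (UNIV :: 'd set) {0..<CARD('d)}" using ex_bij_betw_finite_nat[of "UNIV :: 'd set"] by auto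
  obtain q p where q: "0 < q" "q \<le> int (N ^ CARD('d))"
    and p: "\<And>i. i < CARD('d) \<Longrightarrow> \<bar>of_int q * (x $ inv_into UNIV f i) - of_int (p i)\<bar> < 1 / N"
    using Dirichlet_approx_simult[OF N(3), of "CARD('d)" "\<lambda>i. x $ inv_into UNIV f i"] by blast
  define P :: "int ^ 'd" where "P = (\<chi> i. p (f i))"
  have comp: "\<bar>(real_of_int q *\<^sub>R x - real_vec P) $ i\<bar> \<le> 1 / N" for i
  proof -
    have "f i < CARD('d)" using f by (auto simp: bij_betw_def)
    moreover have "inv_into UNIV f (f i) = i" using f by (simp add: bij_betw_def)
    ultimately show ?thesis using p[of "f i"] by (simp add: P_def less_imp_le)
  qed
  have "norm (real_of_int q *\<^sub>R x - real_vec P) \<le> (\<Sum>i\<in>UNIV. \<bar>(real_of_int q *\<^sub>R x - real_vec P) $ i\<bar>)"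
    by (rule norm_le_l1_cart)
  also have "\<dots> \<le> (\<Sum>i\<in>(UNIV :: 'd set). 1 / N)" by (rule sum_mono) (rule comp)
  also have "\<dots> = ?d / N" by simp
  also have "\<dots> \<le> ?d / ?R" using N R1 by (intro divide_left_mono mult_pos_pos) linarith+
  finally have "norm (real_of_int q *\<^sub>R x - real_vec P) * ?R \<le> ?d"
    by (rule pos_le_divide_eq[THEN iffD1, rotated]) (use R1 in linarith)
  moreover have "\<bar>real_of_int q\<bar> * r powr (?d / (?d + 1)) \<le> 2 ^ CARD('d)"
  proof -
    have "\<bar>real_of_int q\<bar> \<le> real N ^ CARD('d)"
      using q by (metis abs_of_pos of_int_0_less_iff of_int_le_iff of_int_of_nat_eq of_nat_power)
    also have "\<dots> \<le> (2 * ?R) ^ CARD('d)" using N by (intro power_mono) auto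
    finally have "\<bar>real_of_int q\<bar> * r powr (?d / (?d + 1)) \<le> (2 * ?R) ^ CARD('d) * r powr (?d / (?d + 1))"
      by (rule mult_right_mono) simp
    also have "\<dots> = 2 ^ CARD('d) * (?R powr ?d * r powr (?d / (?d + 1)))"
      using r by (simp add: power_mult_distrib powr_realpow)
    also have "?R powr ?d * r powr (?d / (?d + 1)) = 1"
      using r by (simp add: powr_powr flip: powr_add)
    finally show ?thesis by simp
  qed
  ultimately have "approx_size x r (q, P) \<le> 2 ^ CARD('d) + ?d"
    unfolding approx_size_def by (auto intro: add_increasing add_increasing2)
  moreover have "approx_min x r \<le> approx_size x r (q, P)" using q by (intro approx_min_le) auto
  ultimately show ?thesis by linarith
qed

lemma of_int_form:
  "real_of_int (int_form w v) = real_of_int (fst w) * real_of_int (fst v) + real_vec (snd w) \<bullet> real_vec (snd v)"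
  by (simp add: int_form_def inner_vec_def)

text \<open>A small linear form pairs with every moderately small simultaneous approximation to an integer of
  absolute value less than \<open>1\<close>, that is to \<open>0\<close>.\<close>
lemma singular_vector_trapped:
  fixes x :: "real ^ 'd"
  assumes sing: "singular_vector x" and A: "0 < A"
  obtains r0 where "0 < r0" "\<And>r. 0 < r \<Longrightarrow> r \<le> r0 \<Longrightarrow> trapped A x r"
proof -
  let ?d = "real CARD('d)"
  have d: "1 \<le> ?d" by simp
  \<comment> \<open>The pairing of (p0, q0) with v = (q, p) is q (q0 x + p0) + q0 (p - q x). The
    constant \<epsilon> makes the first summand at most 1 / 4, the constant a the second.\<close>
  define a where "a = 1 / (4 * ?d * A)"
  have a: "0 < a" using A d by (simp add: a_def)
  define \<epsilon> where "\<epsilon> = min (1/2) (a powr ?d / (8 * A))"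
  have \<epsilon>: "0 < \<epsilon>" "\<epsilon> < 1" "\<epsilon> \<le> a powr ?d / (8 * A)" using a A by (auto simp: \<epsilon>_def)
  obtain N0 where N0: "\<And>N. N \<ge> N0 \<Longrightarrow> \<exists>(p::int) (q :: int ^ 'd). (p, q) \<noteq> (0, 0) \<and>
            \<bar>real_vec q \<bullet> x + real_of_int p\<bar> \<le> \<epsilon> / real N \<and>
            infnorm (real_vec q) \<le> real N powr (1 / ?d)"
    using sing[unfolded singular_vector_def, rule_format, OF conjI[OF \<epsilon>(1,2)]] by auto
  define e where "e = ?d / (?d + 1)"
  have e: "0 < e" using d by (simp add: e_def)
  \<comment> \<open>Chosen such that M below is at least N0 + 2 whenever r^(-e) \<ge> B; then its
    integer part is at least N0 and at least M / 2.\<close>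
  define B where "B = (real N0 + 2) / a powr ?d"
  have B: "0 < B" using a by (simp add: B_def)
  show thesis
  proof (rule that[of "B powr (- 1 / e)"])
    show "0 < B powr (- 1 / e)" using B by simp
    fix r assume r: "0 < r" "r \<le> B powr (- 1 / e)"
    \<comment> \<open>The height at which singularity is invoked: M^(1/d) = a r^(-1/(d+1)), so the
      bound on q0 is dual to the rescaled error of v.\<close>
    define M where "M = a powr ?d * r powr (- e)"
    have "(B powr (- 1 / e)) powr (- e) \<le> r powr (- e)"
      using r e by (intro powr_mono2') auto
    then have "B \<le> r powr (- e)" using e B by (simp add: powr_powr)
    then have M: "real N0 + 2 \<le> M" using a by (simp add: M_def B_def field_simps)
    define N where "N = nat \<lfloor>M\<rfloor>"
    have N: "N0 \<le> N" "real N \<le> M" "M / 2 \<le> real N" using M unfolding N_def by linarith+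
    obtain p0 :: int and q0 :: "int ^ 'd" where pq: "(p0, q0) \<noteq> (0, 0)"
      "\<bar>real_vec q0 \<bullet> x + real_of_int p0\<bar> \<le> \<epsilon> / real N"
      "infnorm (real_vec q0) \<le> real N powr (1 / ?d)" using N0[OF N(1)] by blast
    have Mpos: "0 < M" using M by linarith
    have "infnorm (real_vec q0) \<le> M powr (1 / ?d)"
      using pq(3) N(2) d by (intro order_trans[OF pq(3)] powr_mono2) auto
    also have "M powr (1 / ?d) = a * r powr (- 1 / (?d + 1))"
      using a r d by (simp add: M_def e_def powr_mult powr_powr)
    finally have q0: "infnorm (real_vec q0) \<le> a * r powr (- 1 / (?d + 1))" .
    have "int_form (p0, q0) v = 0" if v: "approx_size x r v \<le> A" for v
    proof -
      obtain q p where vqp: "v = (q, p)" by (cases v)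
      have v1: "\<bar>real_of_int q\<bar> * r powr e \<le> A" and v2: "norm (real_of_int q *\<^sub>R x - real_vec p) * r powr (- 1 / (?d + 1)) \<le> A"
        using v by (auto simp: approx_size_def vqp e_def)
      let ?y = "real_vec p - real_of_int q *\<^sub>R x"
      have "\<bar>real_of_int q * (real_vec q0 \<bullet> x + real_of_int p0)\<bar> \<le> (A * r powr (- e)) * (\<epsilon> / real N)"
      proof -
        have "\<bar>real_of_int q\<bar> \<le> A * r powr (- e)" using v1 r by (simp add: powr_minus field_simps)
        then show ?thesis unfolding abs_mult using pq(2) A by (intro mult_mono) auto
      qed
      also have "\<dots> \<le> (A * r powr (- e)) * ((a powr ?d / (8 * A)) / (M / 2))"
        using \<epsilon> A N Mpos by (intro mult_left_mono frac_le) auto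
      also have "\<dots> = 1 / 4" using A a r by (simp add: M_def field_simps)
      finally have 1: "\<bar>real_of_int q * (real_vec q0 \<bullet> x + real_of_int p0)\<bar> \<le> 1 / 4" .
      have "\<bar>real_vec q0 \<bullet> ?y\<bar> \<le> (\<Sum>i\<in>UNIV. \<bar>real_vec q0 $ i * ?y $ i\<bar>)"
        unfolding inner_vec_def inner_real_def by (rule sum_abs)
      also have "\<dots> \<le> (\<Sum>i\<in>(UNIV :: 'd set). (a * r powr (- 1 / (?d + 1))) * norm ?y)"
        unfolding abs_mult
        using q0 component_le_infnorm_cart[of "real_vec q0"] a
        by (intro sum_mono mult_mono component_le_norm_cart) (auto intro: order_trans)
      also have "\<dots> = ?d * a * (norm ?y * r powr (- 1 / (?d + 1)))" by simp
      also have "\<dots> \<le> ?d * a * A" using v2 a by (intro mult_left_mono) (auto simp: norm_minus_commute)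
      also have "\<dots> = 1 / 4" using A d by (simp add: a_def)
      finally have 2: "\<bar>real_vec q0 \<bullet> ?y\<bar> \<le> 1 / 4" .
      have "real_of_int (int_form (p0, q0) v) = real_of_int q * (real_vec q0 \<bullet> x + real_of_int p0) + real_vec q0 \<bullet> ?y"
        by (simp add: of_int_form vqp inner_diff_right algebra_simps)
      then have "\<bar>real_of_int (int_form (p0, q0) v)\<bar> < 1" using 1 2 by linarith
      then show ?thesis by linarith
    qed
    then show "trapped A x r" unfolding trapped_def using pq(1) by blast
  qed
qed

text \<open>The vectors in question span at most a hyperplane, and the coordinate in which its normal vector is
  largest is controlled by the others; hence the exponent \<open>d\<close> instead of \<open>d + 1\<close>.\<close>
lemma card_trapped_le:
  fixes x :: "real ^ 'd" and w :: "int \<times> (int ^ 'd)"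
  assumes r: "0 < r" and w: "w \<noteq> (0, 0)" and R: "0 \<le> R"
    and X: "\<And>v. v \<in> X \<Longrightarrow> int_form w v = 0" "\<And>v. v \<in> X \<Longrightarrow> approx_size x r v \<le> R * approx_min x r"
  shows "finite X" and "real (card X) \<le> (4 * real CARD('d) * R + 2) ^ CARD('d)"
proof -
  let ?d = "real CARD('d)"
  let ?a = "r powr (?d / (?d + 1))" and ?b = "r powr (- 1 / (?d + 1))"
  let ?m = "approx_min x r"
  have ab: "0 < ?a" "0 < ?b" using r by simp_all
  have m: "0 < ?m" by (rule approx_min_pos[OF r])
  define z where "z j v = (case j of None \<Rightarrow> real_of_int (fst v) * ?a
      | Some i \<Rightarrow> (real_of_int (fst v) *\<^sub>R x - real_vec (snd v)) $ i * ?b)" for j :: "'d option" and v :: "int \<times> (int ^ 'd)"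
  \<comment> \<open>The coefficients of the form w in the rescaled coordinates z of v, where
    \<open>None\<close> is the denominator coordinate; thus \<Sum> n z is the integer
    pairing.\<close>
  define n where "n j = (case j of None \<Rightarrow> (real_of_int (fst w) + real_vec (snd w) \<bullet> x) / ?a
      | Some i \<Rightarrow> - real_vec (snd w) $ i / ?b)" for j :: "'d option"
  have UNIV_opt: "(UNIV :: 'd option set) = insert None (Some ` UNIV)" by (auto intro: option.exhaust)
  have sum_opt: "(\<Sum>j\<in>UNIV. g j) = g None + (\<Sum>i\<in>UNIV. g (Some i))" for g :: "'d option \<Rightarrow> real"
    unfolding UNIV_opt by (subst sum.insert) (auto simp: sum.reindex)
  have zdiff: "z j v - z j v' = z j (fst v - fst v', snd v - snd v')" for j v v'
    by (auto simp: z_def algebra_simps split: option.split)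
  have zle: "\<bar>z j v\<bar> \<le> approx_size x r v" for j v
  proof (cases j)
    case None
    then show ?thesis using ab by (simp add: z_def approx_size_def abs_mult)
  next
    case (Some i)
    have "\<bar>z j v\<bar> \<le> norm (real_of_int (fst v) *\<^sub>R x - real_vec (snd v)) * ?b"
      unfolding Some z_def option.case abs_mult abs_of_pos[OF ab(2)]
      by (rule mult_right_mono[OF component_le_norm_cart]) simp
    then show ?thesis by (simp add: approx_size_def)
  qed
  have lez: "approx_size x r v \<le> (\<Sum>j\<in>UNIV. \<bar>z j v\<bar>)" for v
  proof -
    have "norm (real_of_int (fst v) *\<^sub>R x - real_vec (snd v)) * ?b
       \<le> (\<Sum>i\<in>UNIV. \<bar>(real_of_int (fst v) *\<^sub>R x - real_vec (snd v)) $ i\<bar>) * ?b"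
      using ab by (intro mult_right_mono norm_le_l1_cart) auto
    also have "\<dots> = (\<Sum>i\<in>UNIV. \<bar>z (Some i) v\<bar>)" using ab by (simp add: z_def sum_distrib_right abs_mult)
    finally have "norm (real_of_int (fst v) *\<^sub>R x - real_vec (snd v)) * ?b \<le> (\<Sum>i\<in>UNIV. \<bar>z (Some i) v\<bar>)" .
    moreover have "\<bar>real_of_int (fst v)\<bar> * ?a = \<bar>z None v\<bar>" using ab by (simp add: z_def abs_mult)
    moreover have "0 \<le> (\<Sum>i\<in>UNIV. \<bar>z (Some i) v\<bar>)" by (rule sum_nonneg) simp
    ultimately show ?thesis unfolding sum_opt approx_size_def by auto
  qed
  have rel: "(\<Sum>j\<in>UNIV. n j * z j v) = real_of_int (int_form w v)" for v
  proof -
    let ?y = "real_of_int (fst v) *\<^sub>R x - real_vec (snd v)"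
    have "(\<Sum>i\<in>UNIV. n (Some i) * z (Some i) v) = - (\<Sum>i\<in>UNIV. real_vec (snd w) $ i * ?y $ i)"
      unfolding sum_negf[symmetric] using ab by (intro sum.cong refl) (simp add: n_def z_def)
    also have "\<dots> = - (real_vec (snd w) \<bullet> ?y)" by (simp only: inner_vec_def inner_real_def)
    finally have 1: "(\<Sum>i\<in>UNIV. n (Some i) * z (Some i) v) = - (real_vec (snd w) \<bullet> ?y)" .
    have 2: "n None * z None v = (real_of_int (fst w) + real_vec (snd w) \<bullet> x) * real_of_int (fst v)"
      using ab by (simp add: n_def z_def)
    show ?thesis unfolding sum_opt of_int_form 1 2
      by (simp add: inner_diff_right algebra_simps)
  qed
  let ?N = "range (\<lambda>j. \<bar>n j\<bar>)"
  have "Max ?N \<in> ?N" by (rule Max_in) auto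
  then obtain j0 where "Max ?N = \<bar>n j0\<bar>" by blast
  then have j0: "\<bar>n j\<bar> \<le> \<bar>n j0\<bar>" for j using Max_ge[of ?N "\<bar>n j\<bar>"] by simp
  have n0: "n j0 \<noteq> 0"
  proof
    assume "n j0 = 0"
    then have n: "n j = 0" for j using j0[of j] by simp
    have "snd w $ i = 0" for i using n[of "Some i"] ab by (simp add: n_def)
    then have s: "snd w = 0" by (simp add: vec_eq_iff)
    then have "real_vec (snd w) = 0" by (simp add: real_vec_eq_0_iff)
    then have "fst w = 0" using n[of None] ab by (simp add: n_def)
    then show False using s w by (simp add: prod_eq_iff)
  qed
  let ?I = "UNIV - {j0} :: 'd option set"
  have cardI: "card ?I = CARD('d)" by (simp add: card_Diff_singleton)
  have z0: "\<bar>z j0 v\<bar> \<le> (\<Sum>j\<in>?I. \<bar>z j v\<bar>)" if "int_form w v = 0" for v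
  proof -
    have "n j0 * z j0 v + (\<Sum>j\<in>?I. n j * z j v) = 0"
      using rel[of v] that by (simp add: sum.remove[of UNIV j0])
    then have "\<bar>n j0\<bar> * \<bar>z j0 v\<bar> = \<bar>\<Sum>j\<in>?I. n j * z j v\<bar>"
      by (metis abs_minus_cancel abs_mult add_eq_0_iff)
    also have "\<dots> \<le> (\<Sum>j\<in>?I. \<bar>n j * z j v\<bar>)" by (rule sum_abs)
    also have "\<dots> \<le> (\<Sum>j\<in>?I. \<bar>n j0\<bar> * \<bar>z j v\<bar>)"
      unfolding abs_mult by (intro sum_mono mult_right_mono j0) auto
    also have "\<dots> = \<bar>n j0\<bar> * (\<Sum>j\<in>?I. \<bar>z j v\<bar>)" by (simp add: sum_distrib_left)
    finally show ?thesis using n0 by simp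
  qed
  \<comment> \<open>A difference in the hyperplane whose d remaining coordinates are all below this
    would have size below 2 d times it, which is the minimum.\<close>
  let ?\<delta> = "?m / (2 * ?d)"
  have sep: "\<exists>j\<in>?I. ?\<delta> \<le> \<bar>z j v - z j v'\<bar>" if vv: "v \<in> X" "v' \<in> X" "v \<noteq> v'" for v v'
  proof (rule ccontr)
    assume "\<not> ?thesis"
    then have lt: "\<bar>z j v - z j v'\<bar> < ?\<delta>" if "j \<in> ?I" for j using that by force
    let ?u = "(fst v - fst v', snd v - snd v')"
    have "int_form w ?u = int_form w v - int_form w v'"
      by (simp add: int_form_def right_diff_distrib sum_subtractf)
    then have "int_form w ?u = 0" using X(1) vv by simp
    then have "\<bar>z j0 ?u\<bar> \<le> (\<Sum>j\<in>?I. \<bar>z j ?u\<bar>)" by (rule z0)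
    then have "approx_size x r ?u \<le> 2 * (\<Sum>j\<in>?I. \<bar>z j ?u\<bar>)"
      using lez[of ?u] by (simp add: sum.remove[of UNIV j0])
    also have "\<dots> < 2 * (\<Sum>j\<in>?I. ?\<delta>)"
    proof -
      have "?I \<noteq> {}" using cardI by (metis card.empty zero_less_card_finite less_irrefl)
      then have "(\<Sum>j\<in>?I. \<bar>z j ?u\<bar>) < (\<Sum>j\<in>?I. ?\<delta>)" using lt by (intro sum_strict_mono) (auto simp: zdiff)
      then show ?thesis by simp
    qed
    also have "\<dots> = ?m" using cardI by simp
    also have "\<dots> \<le> approx_size x r ?u" using vv(3) by (intro approx_min_le) (auto simp: prod_eq_iff)
    finally show False by simp
  qed
  have \<delta>: "0 < ?\<delta>" using m by simp
  have bd: "\<bar>z j v\<bar> \<le> R * ?m" if "v \<in> X" for j v using zle[of j v] X(2)[OF that] by linarith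
  have M: "0 \<le> R * ?m" using R m by simp
  show "finite X"
    by (rule card_le_of_separated(1)[of ?I ?\<delta> "\<lambda>_. R * ?m" X z]) (use \<delta> bd M sep in auto)
  have "real (card X) \<le> (\<Prod>j\<in>?I. 2 * (R * ?m) / ?\<delta> + 2)"
    by (rule card_le_of_separated(2)[of ?I ?\<delta> "\<lambda>_. R * ?m" X z]) (use \<delta> bd M sep in auto)
  also have "\<dots> = (4 * ?d * R + 2) ^ CARD('d)" using cardI m by (simp add: field_simps)
  finally show "real (card X) \<le> (4 * ?d * R + 2) ^ CARD('d)" .
qed

section \<open>Contraction of the shortest vector\<close>

text \<open>Moving x by r changes the error by |q| r, and \<open>r * ?b = ?a\<close> makes this
  comparable to the denominator part: the size is stable on balls of radius about r. The error term
  keeps the coefficient 1, because later it is small while the denominator part is not.\<close>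

lemma approx_size_le_of_near:
  fixes x y :: "real ^ 'd"
  assumes r: "0 < r" and xy: "dist x y \<le> D * r" and D: "0 \<le> D"
  shows "approx_size y r v \<le> norm (real_of_int (fst v) *\<^sub>R x - real_vec (snd v)) * r powr (- 1 / (real CARD('d) + 1))
     + (1 + D) * (\<bar>real_of_int (fst v)\<bar> * r powr (real CARD('d) / (real CARD('d) + 1)))"
proof -
  let ?d = "real CARD('d)"
  let ?a = "r powr (?d / (?d + 1))" and ?b = "r powr (- 1 / (?d + 1))"
  let ?q = "real_of_int (fst v)" and ?p = "real_vec (snd v)"
  have "1 + - 1 / (?d + 1) = ?d / (?d + 1)" by (simp add: field_simps)
  then have rb: "r * ?b = ?a" using r powr_add[of r 1 "- 1 / (?d + 1)"] by simp
  have "norm (?q *\<^sub>R y - ?p) \<le> norm (?q *\<^sub>R x - ?p) + norm (?q *\<^sub>R (y - x))"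
    using norm_triangle_ineq[of "?q *\<^sub>R x - ?p" "?q *\<^sub>R (y - x)"] by (simp add: algebra_simps)
  also have "\<dots> \<le> norm (?q *\<^sub>R x - ?p) + \<bar>?q\<bar> * (D * r)"
    using xy by (simp add: dist_norm norm_minus_commute mult_left_mono)
  finally have "norm (?q *\<^sub>R y - ?p) * ?b \<le> (norm (?q *\<^sub>R x - ?p) + \<bar>?q\<bar> * (D * r)) * ?b"
    by (rule mult_right_mono) simp
  also have "\<dots> = norm (?q *\<^sub>R x - ?p) * ?b + D * (\<bar>?q\<bar> * (r * ?b))" by (simp add: algebra_simps)
  also have "\<dots> = norm (?q *\<^sub>R x - ?p) * ?b + D * (\<bar>?q\<bar> * ?a)" unfolding rb ..
  finally have 1: "norm (?q *\<^sub>R y - ?p) * ?b \<le> norm (?q *\<^sub>R x - ?p) * ?b + D * (\<bar>?q\<bar> * ?a)" .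
  have 2: "0 \<le> norm (?q *\<^sub>R x - ?p) * ?b" "0 \<le> \<bar>?q\<bar> * ?a" "0 \<le> D * (\<bar>?q\<bar> * ?a)" using D by simp_all
  show ?thesis unfolding approx_size_def distrib_right mult_1_left using 1 2 by linarith
qed

lemma approx_size_le_mult_of_near:
  fixes x y :: "real ^ 'd"
  assumes r: "0 < r" and xy: "dist x y \<le> D * r" and D: "0 \<le> D"
  shows "approx_size y r v \<le> (2 + D) * approx_size x r v"
proof -
  let ?d = "real CARD('d)"
  have "norm (real_of_int (fst v) *\<^sub>R x - real_vec (snd v)) * r powr (- 1 / (?d + 1)) \<le> approx_size x r v"
    "\<bar>real_of_int (fst v)\<bar> * r powr (?d / (?d + 1)) \<le> approx_size x r v" by (simp_all add: approx_size_def)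
  then have "norm (real_of_int (fst v) *\<^sub>R x - real_vec (snd v)) * r powr (- 1 / (?d + 1))
     + (1 + D) * (\<bar>real_of_int (fst v)\<bar> * r powr (?d / (?d + 1))) \<le> approx_size x r v + (1 + D) * approx_size x r v"
    using D by (intro add_mono mult_left_mono) auto
  then show ?thesis using approx_size_le_of_near[OF assms, of v] by (simp add: algebra_simps)
qed

section \<open>The lattices attached to cylinders, represented by the base points
  \<open>hw w x0\<close> at scale \<open>rw w\<close>\<close>

locale vector_ifs = similarity_ifs \<Lambda> h \<rho> K U
  for \<Lambda> :: "'i set" and h :: "'i \<Rightarrow> real ^ 'd \<Rightarrow> real ^ 'd" and \<rho> K U +
  fixes s d :: real and x0 :: "real ^ 'd"
  assumes x0: "x0 \<in> K" and sum1: "(\<Sum>i\<in>\<Lambda>. \<rho> i powr s) \<le> 1"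
    and d_eq: "d = real CARD('d)" and s_gt: "d - 1 < s" and s_le: "s \<le> d"
begin

lemma of_nat_CARD [simp]: "real CARD('d) = d"
  by (simp add: d_eq)

abbreviation D :: real where "D \<equiv> diameter K"

text \<open>Decay exponent of the weights near hyperplanes, which is \<open>s - real k\<close> with
  k = d - 1.\<close>

definition \<alpha> :: real where "\<alpha> = s - d + 1"

text \<open>The power of \<eta> produced by interpolating the point and hyperplane bounds: s
  \<alpha> + \<alpha> (1 - \<alpha>) = d \<alpha>.\<close>

definition c :: real where "c = d * \<alpha>"

definition lam :: "'i list \<Rightarrow> real" where "lam w = approx_min (hw w x0) (rw w)"

definition wsize :: "'i list \<Rightarrow> int \<times> (int ^ 'd) \<Rightarrow> real" where "wsize w = approx_size (hw w x0) (rw w)"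

text \<open>The denominator coordinate of v on the scale of w, in units of the shortest vector. In
  these units estimates are uniform in w.\<close>

definition height :: "'i list \<Rightarrow> int \<times> (int ^ 'd) \<Rightarrow> real" where
  "height w v = \<bar>real_of_int (fst v)\<bar> * rw w powr (d / (d + 1)) / lam w"

text \<open>Growth of the shortest vector relative to the expected factor
  \<open>rw u powr (- 1 / (d + 1))\<close>; a typical word has gain about 1.\<close>

definition gain :: "'i list \<Rightarrow> 'i list \<Rightarrow> real" where
  "gain w u = lam (w @ u) * rw u powr (1 / (d + 1)) / lam w"

text \<open>The gain is less than \<eta> because of a vector v, and the words are sorted by the
  height of v at the parent w. The dyadic range of heights makes the counting and distance bounds
  sharp simultaneously.\<close>

definition low_gain :: "real \<Rightarrow> 'i list \<Rightarrow> real \<Rightarrow> real \<Rightarrow> 'i list set" where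
  "low_gain \<tau> w P \<eta> = {u \<in> stop \<tau>. \<exists>v. v \<noteq> (0, 0) \<and>
     wsize (w @ u) v < \<eta> * rw u powr (- 1 / (d + 1)) * lam w \<and> P \<le> height w v \<and> height w v < 2 * P}"

lemma d_ge_1: "1 \<le> d"
  using zero_less_card_finite[where 'a = 'd] unfolding d_eq by linarith

lemma \<alpha>_pos: "0 < \<alpha>" and \<alpha>_le_1: "\<alpha> \<le> 1" and c_pos: "0 < c" and s_pos: "0 < s"
  using s_gt s_le d_ge_1 by (auto simp: \<alpha>_def c_def)

lemma D_nonneg: "0 \<le> D" by (rule diameter_K_nonneg)

lemma lam_pos: "w \<in> lists \<Lambda> \<Longrightarrow> 0 < lam w"
  unfolding lam_def by (intro approx_min_pos rw_pos)

lemma lam_le: "v \<noteq> (0, 0) \<Longrightarrow> lam w \<le> wsize w v"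
  unfolding lam_def wsize_def by (rule approx_min_le)

lemma lam_le_const: "w \<in> lists \<Lambda> \<Longrightarrow> lam w \<le> 2 ^ CARD('d) + d"
  unfolding lam_def using approx_min_le_const[of "rw w" "hw w x0"] by (simp add: rw_pos rw_le_1)

text \<open>The factor \<open>rw u powr (- 1 / (d + 1))\<close> cancels the change of scale in the
  error part, while in the denominator part a factor \<open>rw u\<close> is left over. The last
  claim transfers both from the base point of the descendant to that of w.\<close>

lemma descendant_approximation:
  assumes w: "w \<in> lists \<Lambda>" and u: "u \<in> lists \<Lambda>"
    and v: "wsize (w @ u) v < \<eta> * rw u powr (- 1 / (d + 1)) * lam w"
  shows "height w v * rw u < \<eta>"
    and "norm (real_of_int (fst v) *\<^sub>R hw (w @ u) x0 - real_vec (snd v)) * rw w powr (- 1 / (d + 1)) < \<eta> * lam w"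
    and "wsize w v \<le> (\<eta> + (1 + D) * height w v) * lam w"
proof -
  let ?a = "d / (d + 1)" and ?b = "- 1 / (d + 1)"
  let ?q = "\<bar>real_of_int (fst v)\<bar>" and ?n = "norm (real_of_int (fst v) *\<^sub>R hw (w @ u) x0 - real_vec (snd v))"
  note pw = rw_pos[OF w] and pu = rw_pos[OF u] and l = lam_pos[OF w]
  have "?a = 1 + ?b" using d_ge_1 by (simp add: field_simps)
  then have ab: "rw u powr ?a = rw u * rw u powr ?b" using pu powr_add[of "rw u" 1 ?b] by simp
  have "?q * (rw w * rw u) powr ?a < \<eta> * rw u powr ?b * lam w"
    using v by (simp add: wsize_def approx_size_def)
  then have "(?q * rw w powr ?a * rw u) * rw u powr ?b < (\<eta> * lam w) * rw u powr ?b"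
    using pw pu by (simp add: powr_mult ab mult_ac)
  then have "?q * rw w powr ?a * rw u < \<eta> * lam w" using pu by simp
  then show 1: "height w v * rw u < \<eta>" using l by (simp add: height_def field_simps)
  have "?n * (rw w * rw u) powr ?b < \<eta> * rw u powr ?b * lam w"
    using v by (simp add: wsize_def approx_size_def)
  then have "(?n * rw w powr ?b) * rw u powr ?b < (\<eta> * lam w) * rw u powr ?b"
    using pw pu by (simp add: powr_mult mult_ac)
  then show 2: "?n * rw w powr ?b < \<eta> * lam w" using pu by simp
  have "dist (hw (w @ u) x0) (hw w x0) = rw w * dist (hw u x0) x0"
    using dist_hw[OF w] by (simp add: word_map_append)
  also have "\<dots> \<le> rw w * D" using pw hw_K_subset[OF u] x0 dist_K_le by (intro mult_left_mono) auto
  finally have "wsize w v \<le> ?n * rw w powr ?b + (1 + D) * (?q * rw w powr ?a)"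
    unfolding wsize_def using approx_size_le_of_near[OF pw _ D_nonneg, of "hw (w @ u) x0" "hw w x0" v] by (simp add: mult.commute)
  also have "?q * rw w powr ?a = height w v * lam w" using l by (simp add: height_def)
  finally show "wsize w v \<le> (\<eta> + (1 + D) * height w v) * lam w" using 2 by (simp add: algebra_simps)
qed

text \<open>Otherwise v would already be shorter than the shortest vector at w: its error
  contributes at most \<eta> \<le> 1 / 2 and its denominator less than 1 / 2.\<close>

lemma height_ge:
  assumes "w \<in> lists \<Lambda>" "u \<in> lists \<Lambda>" "v \<noteq> (0, 0)" "\<eta> \<le> 1 / 2"
    and "wsize (w @ u) v < \<eta> * rw u powr (- 1 / (d + 1)) * lam w"
  shows "1 / (2 * (1 + D)) \<le> height w v"
proof -
  have l: "0 < lam w" using lam_pos assms by blast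
  have "1 * lam w \<le> (\<eta> + (1 + D) * height w v) * lam w"
    using descendant_approximation(3)[OF assms(1,2,5)] lam_le[OF assms(3), of w] by simp
  then have "1 \<le> \<eta> + (1 + D) * height w v" using l by simp
  then have "1 / 2 \<le> (1 + D) * height w v" using assms(4) by linarith
  then show ?thesis using D_nonneg by (simp add: field_simps)
qed

text \<open>The hyperplane is pulled back by \<open>hw w\<close>, so that the mass bounds can be
  applied at the unit scale of K rather than inside the cylinder.\<close>

lemma affine_rational_hyperplane:
  assumes w: "w \<in> lists \<Lambda>" and f: "a \<noteq> 0"
  shows "affine {z. a \<bullet> hw w z = e} \<and> aff_dim {z. a \<bullet> hw w z = e} = int (CARD('d) - 1)"
proof -
  obtain g b where g: "orthogonal_transformation g" "\<And>x. hw w x = rw w *\<^sub>R g x + b"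
    using hw_similarity[OF w] by blast
  obtain a' where a': "g a' = a" using orthogonal_transformation_surj[OF g(1)] by (metis surjD)
  have "a' \<noteq> 0" using a' f g(1) by (metis orthogonal_transformation_norm norm_eq_zero)
  have "a \<bullet> hw w z = rw w * (a' \<bullet> z) + a \<bullet> b" for z
    using g a' by (simp add: inner_add_right orthogonal_transformation_def flip: a')
  then have "{z. a \<bullet> hw w z = e} = {z. a' \<bullet> z = (e - a \<bullet> b) / rw w}"
    using rw_pos[OF w] by (auto simp: field_simps)
  moreover have "affine {z. a' \<bullet> z = (e - a \<bullet> b) / rw w}" by (rule affine_hyperplane)
  moreover have "aff_dim {z. a' \<bullet> z = (e - a \<bullet> b) / rw w} = int (DIM(real ^ 'd)) - 1"
    using aff_dim_hyperplane[OF \<open>a' \<noteq> 0\<close>] by simp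
  ultimately show ?thesis by (simp add: of_nat_diff)
qed

text \<open>The words counted have a point near one of the \<open>O(P\<^sup>d)\<close> rational points \<open>p / q\<close> with \<open>height\<close> about \<open>P\<close>, and
  near a fixed rational hyperplane. Interpolating between the two resulting bounds with weights \<open>\<alpha>\<close> and
  \<open>1 - \<alpha>\<close> makes the power of \<open>P\<close> cancel and leaves \<open>\<eta>\<^sup>c\<close>.\<close>
lemma mass_low_gain:
  obtains C where "0 < C" "\<And>\<tau> w f P \<eta>. 0 < \<tau> \<Longrightarrow> w \<in> lists \<Lambda> \<Longrightarrow> f \<noteq> (0, 0) \<Longrightarrow>
     0 < \<eta> \<Longrightarrow> \<eta> \<le> 1 / 2 \<Longrightarrow> 1 / (2 * (1 + D)) \<le> P \<Longrightarrow> 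
     (\<And>v. wsize w v \<le> (\<eta> + (1 + D) / (\<tau> * rmin)) * lam w \<Longrightarrow> int_form f v = 0) \<Longrightarrow>
     (\<Sum>u\<in>low_gain \<tau> w P \<eta>. rw u powr s) \<le> C * \<eta> powr c"
proof -
  obtain C where C: "1 \<le> C" "\<And>\<tau> \<sigma> L k x0. 0 < \<tau> \<Longrightarrow> \<tau> \<le> \<sigma> \<Longrightarrow> affine L \<Longrightarrow> aff_dim L = int k \<Longrightarrow>
     real k \<le> s \<Longrightarrow> x0 \<in> K \<Longrightarrow>
     (\<Sum>u\<in>{u \<in> stop \<tau>. \<exists>y\<in>L. dist (hw u x0) y \<le> \<sigma>}. rw u powr s) \<le> C * \<sigma> powr (s - real k)"
    using mass_near_affine[OF sum1] by blast
  \<comment> \<open>The first summand is 4 d times the relative size 3 (1 + D) of the vectors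
    counted; the second absorbs the additive 2 of the count, since P \<ge> 1 / (2 (1 + D)).\<close>
  define C1 where "C1 = 12 * d * (1 + D) + 4 * (1 + D)"
  have C1: "0 < C1" using D_nonneg d_ge_1 unfolding C1_def by (intro add_nonneg_pos) auto
  show thesis
  proof (rule that[of "C * (C1 / rmin) powr c"])
    show "0 < C * (C1 / rmin) powr c" using C C1 rmin_pos by simp
    fix \<tau> :: real and w f P \<eta>
    assume \<tau>: "0 < \<tau>" and w: "w \<in> lists \<Lambda>" and f: "f \<noteq> (0 :: int, 0 :: int ^ 'd)" and \<eta>: "0 < \<eta>" "\<eta> \<le> 1 / 2"
      and P: "1 / (2 * (1 + D)) \<le> P"
      and trap: "\<And>v. wsize w v \<le> (\<eta> + (1 + D) / (\<tau> * rmin)) * lam w \<Longrightarrow> int_form f v = 0"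
    let ?G = "low_gain \<tau> w P \<eta>"
    let ?S = "\<Sum>u\<in>?G. rw u powr s"
    have Ppos: "0 < P" using P D_nonneg by (smt (verit) divide_pos_pos)
    have l: "0 < lam w" using lam_pos[OF w] .
    have pw: "0 < rw w" using rw_pos[OF w] .
    have finG: "finite ?G" using finite_stop[OF \<tau>] by (simp add: low_gain_def)
    show "?S \<le> C * (C1 / rmin) powr c * \<eta> powr c"
    proof (cases "?G = {}")
      case True
      then show ?thesis using C C1 rmin_pos by simp
    next
      case False
      \<comment> \<open>The distance to a rational point is at most \<eta> / P; the further factor 1
        / \<open>rmin\<close> ensures \<tau> \<le> \<sigma>, below which the cylinders would be too
        coarse for the mass bound.\<close>
      define \<sigma> where "\<sigma> = \<eta> / (P * rmin)"
      have \<sigma>0: "0 < \<sigma>" using \<eta> Ppos rmin_pos by (simp add: \<sigma>_def)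
      define V where "V = {v. int_form f v = 0 \<and> wsize w v \<le> (3 * (1 + D) * P) * lam w \<and> fst v \<noteq> 0}"
      have "finite V \<and> real (card V) \<le> (4 * d * (3 * (1 + D) * P) + 2) ^ CARD('d)"
        using card_trapped_le[OF pw f, folded d_eq, of "3 * (1 + D) * P" V "hw w x0"] Ppos D_nonneg
        by (auto simp: V_def wsize_def lam_def)
      moreover have "2 \<le> 4 * (1 + D) * P" using P D_nonneg by (simp add: field_simps)
      then have "4 * d * (3 * (1 + D) * P) + 2 \<le> C1 * P" by (simp add: C1_def algebra_simps)
      then have "(4 * d * (3 * (1 + D) * P) + 2) ^ CARD('d) \<le> (C1 * P) ^ CARD('d)"
        using Ppos D_nonneg d_ge_1 by (intro power_mono add_nonneg_nonneg mult_nonneg_nonneg) auto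
      ultimately have V: "finite V" "real (card V) \<le> (C1 * P) ^ CARD('d)" by auto
      have "\<exists>z. hw w z = real_vec (snd v) /\<^sub>R real_of_int (fst v)" for v :: "int \<times> (int ^ 'd)" by (rule surj_hw[OF w])
      then obtain z where z: "\<And>v :: int \<times> (int ^ 'd). hw w (z v) = real_vec (snd v) /\<^sub>R real_of_int (fst v)" by metis
      have key: "\<exists>v\<in>V. dist (hw u x0) (z v) \<le> \<sigma> \<and> \<tau> \<le> \<sigma>" if uG: "u \<in> ?G" for u
      proof -
        obtain v where u: "u \<in> stop \<tau>" and v: "v \<noteq> (0, 0)"
          "wsize (w @ u) v < \<eta> * rw u powr (- 1 / (d + 1)) * lam w" "P \<le> height w v" "height w v < 2 * P"
          using uG unfolding low_gain_def by blast
        have ul: "u \<in> lists \<Lambda>" using stop_lists[OF u] .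
        note da = descendant_approximation[OF w ul v(2)]
        have pu: "0 < rw u" using rw_pos[OF ul] .
        have hpos: "0 < height w v" using v(3) Ppos by linarith
        then have q: "fst v \<noteq> 0" by (auto simp: height_def)
        have "height w v * (rmin * \<tau>) \<le> height w v * rw u" using stop_ge[OF u] hpos by simp
        then have ht: "height w v * (rmin * \<tau>) < \<eta>" using da(1) by linarith
        then have "height w v < 1 / (\<tau> * rmin)" using \<eta> \<tau> rmin_pos by (simp add: field_simps)
        \<comment> \<open>Relative to \<open>lam w\<close> this range depends on \<tau> and \<eta>
          but not on P, so one trapping hypothesis serves all heights.\<close>
        then have "wsize w v \<le> (\<eta> + (1 + D) * (1 / (\<tau> * rmin))) * lam w"
          using D_nonneg l by (intro order_trans[OF da(3)] mult_right_mono add_left_mono mult_left_mono) auto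
        then have int0: "int_form f v = 0" using trap by simp
        have "\<eta> \<le> (1 + D) * P" using \<eta>(2) P D_nonneg by (simp add: field_simps)
        then have "\<eta> + (1 + D) * height w v \<le> (1 + D) * P + (1 + D) * (2 * P)"
          using v(4) D_nonneg by (intro add_mono mult_left_mono) auto
        also have "\<dots> = 3 * (1 + D) * P" by (simp add: algebra_simps)
        finally have "wsize w v \<le> (3 * (1 + D) * P) * lam w"
          using l by (intro order_trans[OF da(3)] mult_right_mono) auto
        then have "v \<in> V" using int0 q by (simp add: V_def)
        moreover have "\<tau> \<le> \<sigma>"
        proof -
          have "P * (rmin * \<tau>) \<le> height w v * (rmin * \<tau>)" using v(3) rmin_pos \<tau> by simp
          then show ?thesis using ht Ppos rmin_pos by (simp add: \<sigma>_def field_simps)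
        qed
        moreover have "dist (hw u x0) (z v) \<le> \<sigma>"
        proof -
          let ?q = "real_of_int (fst v)" and ?n = "norm (real_of_int (fst v) *\<^sub>R hw (w @ u) x0 - real_vec (snd v))"
          let ?a = "d / (d + 1)" and ?b = "- 1 / (d + 1)"
          have q0: "0 < \<bar>?q\<bar>" using q by simp
          have "?a = 1 + ?b" using d_ge_1 by (simp add: field_simps)
          then have ab: "rw w powr ?a = rw w * rw w powr ?b" using pw powr_add[of "rw w" 1 ?b] by simp
          have "?q *\<^sub>R (hw (w @ u) x0 - hw w (z v)) = ?q *\<^sub>R hw (w @ u) x0 - real_vec (snd v)"
            using q by (simp add: z scaleR_diff_right)
          then have "\<bar>?q\<bar> * dist (hw (w @ u) x0) (hw w (z v)) = ?n"
            by (metis dist_norm norm_scaleR)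
          also have "dist (hw (w @ u) x0) (hw w (z v)) = rw w * dist (hw u x0) (z v)"
            using dist_hw[OF w] by (simp add: word_map_append)
          finally have "\<bar>?q\<bar> * rw w powr ?a * dist (hw u x0) (z v) = ?n * rw w powr ?b"
            by (simp add: ab mult_ac)
          also have "\<dots> < \<eta> * lam w" by (rule da(2))
          finally have "height w v * dist (hw u x0) (z v) < \<eta>" using l by (simp add: height_def field_simps)
          moreover have "P * dist (hw u x0) (z v) \<le> height w v * dist (hw u x0) (z v)"
            using v(3) by (intro mult_right_mono) auto
          ultimately have "dist (hw u x0) (z v) \<le> \<eta> / P" using Ppos by (simp add: field_simps)
          also have "\<dots> \<le> \<sigma>" unfolding \<sigma>_def using \<eta> Ppos rmin_pos rmin_less_1
            by (intro divide_left_mono) (auto simp: mult_left_le)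
          finally show ?thesis .
        qed
        ultimately show ?thesis by blast
      qed
      have \<tau>\<sigma>: "\<tau> \<le> \<sigma>" using key False by blast
      let ?X = "(C1 * P) ^ CARD('d) * (C * \<sigma> powr s)" and ?Y = "C * \<sigma> powr \<alpha>"
      have X: "?S \<le> ?X"
      proof -
        let ?A = "\<lambda>v. {u \<in> stop \<tau>. \<exists>y\<in>{z v}. dist (hw u x0) y \<le> \<sigma>}"
        have "?G \<subseteq> (\<Union>v\<in>V. ?A v)"
        proof
          fix u assume u: "u \<in> ?G"
          then obtain v where "v \<in> V" "dist (hw u x0) (z v) \<le> \<sigma>" using key by blast
          moreover have "u \<in> stop \<tau>" using u by (simp add: low_gain_def)
          ultimately show "u \<in> (\<Union>v\<in>V. ?A v)" by blast
        qed
        then have "?S \<le> (\<Sum>u\<in>(\<Union>v\<in>V. ?A v). rw u powr s)"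
          using V(1) finite_stop[OF \<tau>] by (intro sum_mono2) auto
        also have "\<dots> \<le> (\<Sum>v\<in>V. \<Sum>u\<in>?A v. rw u powr s)"
          using V(1) finite_stop[OF \<tau>] by (intro sum_UN_le) auto
        also have "\<dots> \<le> (\<Sum>v\<in>V. C * \<sigma> powr (s - real 0))"
          using s_pos by (intro sum_mono C(2)[OF \<tau> \<tau>\<sigma> _ _ _ x0]) auto
        also have "\<dots> = real (card V) * (C * \<sigma> powr s)" by simp
        also have "\<dots> \<le> ?X" using V(2) C(1) by (intro mult_right_mono) auto
        finally show ?thesis .
      qed
      have Y: "?S \<le> ?Y"
      proof -
        let ?a = "real_vec (snd f)"
        let ?H = "{z. ?a \<bullet> hw w z = - real_of_int (fst f)}"
        have zH: "z v \<in> ?H" if "v \<in> V" for v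
        proof -
          have q: "real_of_int (fst v) \<noteq> 0" and "int_form f v = 0" using that by (auto simp: V_def)
          then have "real_of_int (fst f) * real_of_int (fst v) + ?a \<bullet> real_vec (snd v) = 0"
            using of_int_form[of f v] by simp
          then show ?thesis using q by (simp add: z field_simps)
        qed
        \<comment> \<open>Without spatial part the form would be a nonzero constant, yet it vanishes
          at the rational points of V, of which there is at least one.\<close>
        have a0: "?a \<noteq> 0"
        proof
          assume a: "?a = 0"
          obtain v where "v \<in> V" using key False by blast
          then have "real_of_int (fst f) = 0" using zH[of v] a by (simp split: if_splits)
          then show False using a f by (simp add: real_vec_eq_0_iff prod_eq_iff)
        qed
        have "?G \<subseteq> {u \<in> stop \<tau>. \<exists>y\<in>?H. dist (hw u x0) y \<le> \<sigma>}"
        proof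
          fix u assume u: "u \<in> ?G"
          then obtain v where "v \<in> V" "dist (hw u x0) (z v) \<le> \<sigma>" using key by blast
          moreover have "u \<in> stop \<tau>" using u by (simp add: low_gain_def)
          ultimately show "u \<in> {u \<in> stop \<tau>. \<exists>y\<in>?H. dist (hw u x0) y \<le> \<sigma>}" using zH by blast
        qed
        then have "?S \<le> (\<Sum>u\<in>{u \<in> stop \<tau>. \<exists>y\<in>?H. dist (hw u x0) y \<le> \<sigma>}. rw u powr s)"
          using finite_stop[OF \<tau>] by (intro sum_mono2) auto
        also have "\<dots> \<le> C * \<sigma> powr (s - real (CARD('d) - 1))"
          using affine_rational_hyperplane[OF w a0] s_gt by (intro C(2)[OF \<tau> \<tau>\<sigma> _ _ _ x0]) (auto simp: of_nat_diff)
        also have "s - real (CARD('d) - 1) = \<alpha>" by (simp add: \<alpha>_def of_nat_diff)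
        finally show ?thesis .
      qed
      have S0: "0 \<le> ?S" by (rule sum_nonneg) simp
      have "?S \<le> ?X powr \<alpha> * ?Y powr (1 - \<alpha>)"
      proof (cases "?S = 0")
        case True
        then show ?thesis by simp
      next
        case False
        then have "?S = ?S powr \<alpha> * ?S powr (1 - \<alpha>)" using S0 by (simp flip: powr_add)
        also have "\<dots> \<le> ?X powr \<alpha> * ?Y powr (1 - \<alpha>)"
          using X Y S0 \<alpha>_pos \<alpha>_le_1 by (intro mult_mono powr_mono2) auto
        finally show ?thesis .
      qed
      also have "\<dots> = C * (C1 * P * \<sigma>) powr c"
      proof -
        have CP: "(C1 * P) ^ CARD('d) = (C1 * P) powr d"
          unfolding d_eq using C1 Ppos by (intro powr_realpow[symmetric]) simp
        have "?X powr \<alpha> * ?Y powr (1 - \<alpha>)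
          = ((C1 * P) powr d) powr \<alpha> * (C powr \<alpha> * (\<sigma> powr s) powr \<alpha>) * (C powr (1 - \<alpha>) * (\<sigma> powr \<alpha>) powr (1 - \<alpha>))"
          unfolding CP using C(1) C1 Ppos \<sigma>0 by (simp add: powr_mult)
        also have "\<dots> = (C1 * P) powr c * (C powr \<alpha> * C powr (1 - \<alpha>)) * (\<sigma> powr (s * \<alpha>) * \<sigma> powr (\<alpha> * (1 - \<alpha>)))"
          by (simp add: powr_powr c_def mult_ac)
        also have "C powr \<alpha> * C powr (1 - \<alpha>) = C" using C by (simp flip: powr_add)
        also have "\<sigma> powr (s * \<alpha>) * \<sigma> powr (\<alpha> * (1 - \<alpha>)) = \<sigma> powr c"
        proof -
          have "s * \<alpha> + \<alpha> * (1 - \<alpha>) = c" by (simp add: c_def \<alpha>_def algebra_simps)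
          then show ?thesis by (simp flip: powr_add)
        qed
        also have "(C1 * P) powr c * C * \<sigma> powr c = C * (C1 * P * \<sigma>) powr c"
          using C1 Ppos \<sigma>0 by (simp add: powr_mult)
        finally show ?thesis .
      qed
      also have "C1 * P * \<sigma> = C1 / rmin * \<eta>" using Ppos rmin_pos by (simp add: \<sigma>_def)
      also have "(C1 / rmin * \<eta>) powr c = (C1 / rmin) powr c * \<eta> powr c"
        by (rule powr_mult)
      finally show ?thesis by (simp add: mult.assoc)
    qed
  qed
qed

end

section \<open>Dyadic decomposition of the gains and the one-step contraction\<close>

lemma dyadic_below:
  fixes b x :: real
  assumes "0 < b" "b \<le> x"
  obtains j :: nat where "b * 2 ^ j \<le> x" "x < 2 * (b * 2 ^ j)"
proof -
  obtain n where "x / b < 2 ^ n" using real_arch_pow[of 2 "x / b"] by auto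
  then have ex: "\<exists>n. x < b * 2 ^ n" using assms(1) by (auto simp: field_simps)
  define m where "m = (LEAST n. x < b * 2 ^ n)"
  have m: "x < b * 2 ^ m" unfolding m_def using ex by (rule LeastI_ex)
  have "m \<noteq> 0"
  proof
    assume "m = 0"
    then show False using m assms(2) by simp
  qed
  then obtain j where j: "m = Suc j" using not0_implies_Suc by blast
  have "\<not> x < b * 2 ^ j" using not_less_Least[of j "\<lambda>n. x < b * 2 ^ n"] j unfolding m_def by simp
  then show thesis using m j by (intro that[of j]) auto
qed

lemma dyadic_below_half:
  fixes g :: real
  assumes "0 < g" "g < 1 / 2"
  obtains k :: nat where "1 \<le> k" "(1 / 2) ^ Suc k \<le> g" "g < (1 / 2) ^ k"
proof -
  obtain n where "(1 / 2) ^ n < g" using real_arch_pow_inv[OF assms(1), of "1 / 2"] by auto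
  then have ex: "\<exists>n. (1 / 2) ^ n \<le> g" using less_imp_le by blast
  define m where "m = (LEAST n. (1 / 2) ^ n \<le> g)"
  have m: "(1 / 2) ^ m \<le> g" unfolding m_def using ex by (rule LeastI_ex)
  have "m \<noteq> 0"
  proof
    assume "m = 0"
    then show False using m assms(2) by simp
  qed
  then obtain k where k: "m = Suc k" using not0_implies_Suc by blast
  have "\<not> (1 / 2) ^ k \<le> g" using not_less_Least[of k "\<lambda>n. (1 / 2) ^ n \<le> g"] k unfolding m_def by simp
  moreover have "k \<noteq> 0"
  proof
    assume "k = 0"
    then show False using m k assms(2) by simp
  qed
  ultimately show thesis using m k by (intro that[of k]) auto
qed

context vector_ifs
begin

lemma lam_ratio_eq_gain:
  assumes "w \<in> lists \<Lambda>" "u \<in> lists \<Lambda>"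
  shows "lam (w @ u) / lam w = gain w u * rw u powr (- 1 / (d + 1))"
proof -
  have "rw u powr (1 / (d + 1)) * rw u powr (- 1 / (d + 1)) = 1"
    using rw_pos[OF assms(2)] by (simp flip: powr_add)
  then show ?thesis by (simp add: gain_def mult.assoc)
qed

lemma gain_pos: "w \<in> lists \<Lambda> \<Longrightarrow> u \<in> lists \<Lambda> \<Longrightarrow> 0 < gain w u"
  using lam_pos[of w] lam_pos[of "w @ u"] rw_pos[of u] by (simp add: gain_def)

text \<open>The gain lies near 2^-k and the height of its witness near 2^j. The height is bounded
  below, and its product with \<open>rmin * \<tau>\<close> is less than 2^-k; hence both k and j
  stay below J, about log(1 / \<tau>).\<close>

lemma small_gain_classes:
  assumes \<tau>: "0 < \<tau>" and w: "w \<in> lists \<Lambda>" and J: "2 * (1 + D) / (\<tau> * rmin) \<le> 2 ^ J"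
    and u: "u \<in> stop \<tau>" and g: "gain w u < 1 / 2"
  shows "\<exists>k\<in>{1..<J}. \<exists>j<J. u \<in> low_gain \<tau> w (1 / (2 * (1 + D)) * 2 ^ j) ((1 / 2) ^ k) \<and> (1 / 2) ^ Suc k \<le> gain w u"
proof -
  have ul: "u \<in> lists \<Lambda>" using stop_lists[OF u] .
  have pu: "0 < rw u" using rw_pos[OF ul] .
  have l: "0 < lam w" using lam_pos[OF w] .
  let ?b = "1 / (2 * (1 + D))"
  have b: "0 < ?b" using D_nonneg by simp
  obtain k where k: "1 \<le> k" "(1 / 2) ^ Suc k \<le> gain w u" "gain w u < (1 / 2) ^ k"
    using dyadic_below_half[OF gain_pos[OF w ul] g] by blast
  have "lam (w @ u) = gain w u * rw u powr (- 1 / (d + 1)) * lam w"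
    using lam_ratio_eq_gain[OF w ul] l by (simp add: field_simps)
  also have "\<dots> < (1 / 2) ^ k * rw u powr (- 1 / (d + 1)) * lam w"
    using k(3) pu l by (intro mult_strict_right_mono) auto
  finally obtain v where v: "v \<noteq> (0, 0)" "wsize (w @ u) v < (1 / 2) ^ k * rw u powr (- 1 / (d + 1)) * lam w"
    using approx_min_lessD unfolding lam_def wsize_def by blast
  have k2: "(1 / 2 :: real) ^ k \<le> 1 / 2" using power_decreasing[OF k(1), of "1 / 2 :: real"] by simp
  have hb: "?b \<le> height w v" by (rule height_ge[OF w ul v(1) k2 v(2)])
  then obtain j where j: "?b * 2 ^ j \<le> height w v" "height w v < 2 * (?b * 2 ^ j)"
    using dyadic_below[OF b] by blast
  have "height w v * (rmin * \<tau>) \<le> height w v * rw u"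
    using stop_ge[OF u] hb b by (intro mult_left_mono) linarith+
  also have "\<dots> < (1 / 2) ^ k" by (rule descendant_approximation(1)[OF w ul v(2)])
  finally have h: "height w v * (rmin * \<tau>) < (1 / 2) ^ k" .
  have rt: "0 < rmin * \<tau>" using rmin_pos \<tau> by simp
  have "?b * 2 ^ j * (rmin * \<tau>) < 1"
  proof -
    have "?b * 2 ^ j * (rmin * \<tau>) \<le> height w v * (rmin * \<tau>)" using j(1) rt by (intro mult_right_mono) auto
    also have "\<dots> < (1 / 2) ^ k" by (rule h)
    also have "\<dots> \<le> 1" by (rule power_le_one) auto
    finally show ?thesis .
  qed
  then have "2 ^ j < 2 * (1 + D) / (\<tau> * rmin)" using D_nonneg rt by (simp add: field_simps)
  then have "(2::real) ^ j < 2 ^ J" using J by linarith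
  then have jJ: "j < J" by simp
  have "?b * (rmin * \<tau>) < (1 / 2) ^ k"
  proof -
    have "?b * (rmin * \<tau>) \<le> height w v * (rmin * \<tau>)" using hb rt by (intro mult_right_mono) auto
    then show ?thesis using h by linarith
  qed
  then have "2 ^ k < 2 * (1 + D) / (\<tau> * rmin)"
    using D_nonneg rt by (simp add: field_simps power_one_over)
  then have "(2::real) ^ k < 2 ^ J" using J by linarith
  then have "k < J" by simp
  moreover have "u \<in> low_gain \<tau> w (?b * 2 ^ j) ((1 / 2) ^ k)"
    unfolding low_gain_def using u v j by blast
  ultimately show ?thesis using k jJ by (intro bexI[of _ k] exI[of _ j]) auto
qed

text \<open>Gains of at least 1 / 2 contribute at most 2^c in total. In the class of gains near 2^-k
  the weight is O(2^(-k c)) and the summand at most 2^((k+1) c) times the weight, so each of the at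
  most J^2 classes contributes a constant.\<close>

lemma sum_gain_powr:
  obtains C where "0 < C" "\<And>\<tau> w f J. 0 < \<tau> \<Longrightarrow> w \<in> lists \<Lambda> \<Longrightarrow> f \<noteq> (0, 0) \<Longrightarrow>
     2 * (1 + D) / (\<tau> * rmin) \<le> 2 ^ J \<Longrightarrow>
     (\<And>v. wsize w v \<le> (1 + (1 + D) / (\<tau> * rmin)) * lam w \<Longrightarrow> int_form f v = 0) \<Longrightarrow>
     (\<Sum>u\<in>stop \<tau>. rw u powr s * gain w u powr (- c)) \<le> 2 powr c + C * (real J)\<^sup>2"
proof -
  obtain C where C: "0 < C" "\<And>\<tau> w f P \<eta>. 0 < \<tau> \<Longrightarrow> w \<in> lists \<Lambda> \<Longrightarrow> f \<noteq> (0, 0) \<Longrightarrow>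
     0 < \<eta> \<Longrightarrow> \<eta> \<le> 1 / 2 \<Longrightarrow> 1 / (2 * (1 + D)) \<le> P \<Longrightarrow> 
     (\<And>v. wsize w v \<le> (\<eta> + (1 + D) / (\<tau> * rmin)) * lam w \<Longrightarrow> int_form f v = 0) \<Longrightarrow>
     (\<Sum>u\<in>low_gain \<tau> w P \<eta>. rw u powr s) \<le> C * \<eta> powr c" using mass_low_gain by blast
  show thesis
  proof (rule that[of "C * 2 powr c"])
    show "0 < C * 2 powr c" using C by simp
    fix \<tau> :: real and w f J
    assume \<tau>: "0 < \<tau>" and w: "w \<in> lists \<Lambda>" and f: "f \<noteq> (0 :: int, 0 :: int ^ 'd)"
      and J: "2 * (1 + D) / (\<tau> * rmin) \<le> 2 ^ J"
      and trap: "\<And>v. wsize w v \<le> (1 + (1 + D) / (\<tau> * rmin)) * lam w \<Longrightarrow> int_form f v = 0"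
    let ?b = "1 / (2 * (1 + D))"
    let ?f = "\<lambda>u. rw u powr s * gain w u powr (- c)"
    let ?Z = "{u \<in> stop \<tau>. 1 / 2 \<le> gain w u}"
    let ?A = "\<lambda>(k, j). {u \<in> low_gain \<tau> w (?b * 2 ^ j) ((1 / 2) ^ k). (1 / 2) ^ Suc k \<le> gain w u}"
    let ?I = "{1..<J} \<times> {..<J}"
    have fin: "finite (stop \<tau>)" by (rule finite_stop[OF \<tau>])
    have finA: "finite (?A i)" for i using fin by (cases i) (simp add: low_gain_def)
    have l: "0 < lam w" using lam_pos[OF w] .
    have sub: "stop \<tau> \<subseteq> ?Z \<union> (\<Union>i\<in>?I. ?A i)"
    proof
      fix u assume u: "u \<in> stop \<tau>"
      show "u \<in> ?Z \<union> (\<Union>i\<in>?I. ?A i)"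
      proof (cases "1 / 2 \<le> gain w u")
        case False
        then obtain k j where kj: "k \<in> {1..<J}" "j < J" "u \<in> low_gain \<tau> w (?b * 2 ^ j) ((1 / 2) ^ k)" "(1 / 2) ^ Suc k \<le> gain w u"
          using small_gain_classes[OF \<tau> w J u] by force
        then have "u \<in> ?A (k, j)" "(k, j) \<in> ?I" by auto
        then show ?thesis by blast
      qed (use u in blast)
    qed
    have "(\<Sum>u\<in>stop \<tau>. ?f u) \<le> sum ?f (?Z \<union> (\<Union>i\<in>?I. ?A i))"
      using fin finA by (intro sum_mono2 sub) auto
    also have "\<dots> \<le> sum ?f ?Z + sum ?f (\<Union>i\<in>?I. ?A i)"
      using fin finA by (subst sum.union_inter[symmetric]) (auto intro!: sum_nonneg)
    also have "\<dots> \<le> 2 powr c + C * 2 powr c * (real J)\<^sup>2"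
    proof (rule add_mono)
      have "sum ?f ?Z \<le> (\<Sum>u\<in>?Z. rw u powr s * 2 powr c)"
      proof (intro sum_mono mult_left_mono)
        fix u assume u: "u \<in> ?Z"
        then have "gain w u powr (- c) \<le> (1 / 2) powr (- c)" using c_pos by (intro powr_mono2') auto
        then show "gain w u powr (- c) \<le> 2 powr c" by (simp add: powr_minus powr_divide)
      qed simp
      also have "\<dots> \<le> (\<Sum>u\<in>stop \<tau>. rw u powr s * 2 powr c)" using fin by (intro sum_mono2) auto
      also have "\<dots> = (\<Sum>u\<in>stop \<tau>. rw u powr s) * 2 powr c" by (simp add: sum_distrib_right)
      also have "\<dots> \<le> 1 * 2 powr c" using sum_stop_le_1[OF sum1 \<tau>] by (intro mult_right_mono) auto
      finally show "sum ?f ?Z \<le> 2 powr c" by simp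
      have "sum ?f (\<Union>i\<in>?I. ?A i) \<le> (\<Sum>i\<in>?I. sum ?f (?A i))"
        using finA by (intro sum_UN_le) auto
      also have "\<dots> \<le> (\<Sum>i\<in>?I. C * 2 powr c)"
      proof (rule sum_mono)
        fix i assume "i \<in> ?I"
        then obtain k j where i: "i = (k, j)" "1 \<le> k" "k < J" "j < J" by auto
        let ?\<eta> = "(1 / 2 :: real) ^ k"
        have \<eta>: "0 < ?\<eta>" "?\<eta> \<le> 1 / 2" using power_decreasing[OF i(2), of "1 / 2 :: real"] by auto
        have "sum ?f (?A i) \<le> (\<Sum>u\<in>?A i. rw u powr s * (?\<eta> / 2) powr (- c))"
        proof (intro sum_mono mult_left_mono)
          fix u assume "u \<in> ?A i"
          then have "?\<eta> / 2 \<le> gain w u" using i by simp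
          then show "gain w u powr (- c) \<le> (?\<eta> / 2) powr (- c)" using c_pos by (intro powr_mono2') auto
        qed simp
        also have "\<dots> \<le> (\<Sum>u\<in>low_gain \<tau> w (?b * 2 ^ j) ?\<eta>. rw u powr s * (?\<eta> / 2) powr (- c))"
          using fin i by (intro sum_mono2) (auto simp: low_gain_def)
        also have "\<dots> = (\<Sum>u\<in>low_gain \<tau> w (?b * 2 ^ j) ?\<eta>. rw u powr s) * (?\<eta> / 2) powr (- c)"
          by (simp add: sum_distrib_right)
        also have "\<dots> \<le> (C * ?\<eta> powr c) * (?\<eta> / 2) powr (- c)"
        proof (intro mult_right_mono C(2)[OF \<tau> w f \<eta>])
          have "?b * 1 \<le> ?b * 2 ^ j" using D_nonneg by (intro mult_left_mono) auto
          then show "?b \<le> ?b * 2 ^ j" by simp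
          fix v assume v: "wsize w v \<le> (?\<eta> + (1 + D) / (\<tau> * rmin)) * lam w"
          have "(?\<eta> + (1 + D) / (\<tau> * rmin)) * lam w \<le> (1 + (1 + D) / (\<tau> * rmin)) * lam w"
            using \<eta> l by (intro mult_right_mono) auto
          then show "int_form f v = 0" using v by (intro trap) linarith
        qed simp
        also have "\<dots> = C * 2 powr c"
        proof -
          have "(?\<eta> / 2) powr (- c) = 2 powr c / ?\<eta> powr c" using \<eta> by (simp add: powr_minus powr_divide)
          then show ?thesis using \<eta> by simp
        qed
        finally show "sum ?f (?A i) \<le> C * 2 powr c" .
      qed
      also have "\<dots> = real (card ?I) * (C * 2 powr c)" by simp
      also have "\<dots> \<le> (real J)\<^sup>2 * (C * 2 powr c)"
        using C(1) by (intro mult_right_mono) (auto simp: power2_eq_square mult_right_mono)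
      finally show "sum ?f (\<Union>i\<in>?I. ?A i) \<le> C * 2 powr c * (real J)\<^sup>2" by (simp add: mult_ac)
    qed
    finally show "(\<Sum>u\<in>stop \<tau>. ?f u) \<le> 2 powr c + C * 2 powr c * (real J)\<^sup>2" .
  qed
qed

text \<open>By \<open>lam_ratio_eq_gain\<close> the summand is \<open>lam w powr (- c)\<close> times
  the weight, the power of the gain, and \<open>rw u powr \<kappa>\<close> with \<kappa> = t + c /
  (d + 1) - s > 0. On \<open>stop \<tau>\<close> the last factor is at most \<tau>^\<kappa>.\<close>

lemma contraction:
  assumes t: "s - c / (d + 1) < t"
  obtains \<tau> B where "0 < \<tau>" "\<tau> < 1" "0 < B" "\<And>w f. w \<in> lists \<Lambda> \<Longrightarrow> f \<noteq> (0, 0) \<Longrightarrow>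
     (\<And>v. wsize w v \<le> B * lam w \<Longrightarrow> int_form f v = 0) \<Longrightarrow>
     (\<Sum>u\<in>stop \<tau>. rw u powr t * lam (w @ u) powr (- c)) \<le> 1 / 2 * lam w powr (- c)"
proof -
  obtain C where C: "0 < C" "\<And>\<tau> w f J. 0 < \<tau> \<Longrightarrow> w \<in> lists \<Lambda> \<Longrightarrow> f \<noteq> (0, 0) \<Longrightarrow>
     2 * (1 + D) / (\<tau> * rmin) \<le> 2 ^ J \<Longrightarrow>
     (\<And>v. wsize w v \<le> (1 + (1 + D) / (\<tau> * rmin)) * lam w \<Longrightarrow> int_form f v = 0) \<Longrightarrow>
     (\<Sum>u\<in>stop \<tau>. rw u powr s * gain w u powr (- c)) \<le> 2 powr c + C * (real J)\<^sup>2"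
    using sum_gain_powr by blast
  define \<kappa> where "\<kappa> = t + c / (d + 1) - s"
  have \<kappa>: "0 < \<kappa>" using t by (simp add: \<kappa>_def)
  define a where "a = 2 * (1 + D) / rmin"
  have a: "1 < a" using D_nonneg rmin_pos rmin_less_1 by (simp add: a_def field_simps)
  define E where "E = 2 powr c"
  \<comment> \<open>The expression dominates \<tau>^\<kappa> (2^c + C J^2), because J is at most log
    2 (a / \<tau>) + 1; the power beats the squared logarithm.\<close>
  have "((\<lambda>\<tau>. \<tau> powr \<kappa> * (E + C * (log 2 (a / \<tau>) + 1)\<^sup>2)) \<longlongrightarrow> 0) (at_right 0)"
    using \<kappa> a by real_asymp
  then have "\<forall>\<^sub>F \<tau> in at_right 0. \<tau> powr \<kappa> * (E + C * (log 2 (a / \<tau>) + 1)\<^sup>2) < 1 / 2"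
    by (rule order_tendstoD) simp
  moreover have "\<forall>\<^sub>F \<tau> in at_right 0. \<tau> \<in> {0<..<1::real}" by (rule eventually_at_right_real) simp
  ultimately have "\<forall>\<^sub>F \<tau> in at_right 0. \<tau> powr \<kappa> * (E + C * (log 2 (a / \<tau>) + 1)\<^sup>2) < 1 / 2 \<and> \<tau> \<in> {0<..<1::real}"
    by (rule eventually_conj)
  then obtain \<tau> where small: "\<tau> powr \<kappa> * (E + C * (log 2 (a / \<tau>) + 1)\<^sup>2) < 1 / 2" and "\<tau> \<in> {0<..<1::real}"
    using eventually_happens' [OF trivial_limit_at_right_real] by blast
  then have \<tau>: "0 < \<tau>" "\<tau> < 1" by auto
  define J where "J = nat \<lceil>log 2 (a / \<tau>)\<rceil>"
  have a\<tau>: "1 \<le> a / \<tau>" using a \<tau> by (simp add: field_simps)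
  then have l0: "0 \<le> log 2 (a / \<tau>)" by simp
  have J: "log 2 (a / \<tau>) \<le> real J" "real J \<le> log 2 (a / \<tau>) + 1" using l0 unfolding J_def by linarith+
  have "a / \<tau> = 2 powr log 2 (a / \<tau>)" using a\<tau> by simp
  also have "\<dots> \<le> 2 powr real J" using J(1) by simp
  finally have aJ: "2 * (1 + D) / (\<tau> * rmin) \<le> 2 ^ J" by (simp add: a_def powr_realpow mult.commute)
  have small': "\<tau> powr \<kappa> * (2 powr c + C * (real J)\<^sup>2) \<le> 1 / 2"
  proof -
    have "(real J)\<^sup>2 \<le> (log 2 (a / \<tau>) + 1)\<^sup>2" using J(2) by (intro power_mono) auto
    then have "\<tau> powr \<kappa> * (2 powr c + C * (real J)\<^sup>2) \<le> \<tau> powr \<kappa> * (E + C * (log 2 (a / \<tau>) + 1)\<^sup>2)"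
      unfolding E_def using C(1) by (intro mult_left_mono add_left_mono) auto
    then show ?thesis using small by linarith
  qed
  show thesis
  proof (rule that[OF \<tau>, of "1 + (1 + D) / (\<tau> * rmin)"])
    show "0 < 1 + (1 + D) / (\<tau> * rmin)" using D_nonneg \<tau> rmin_pos by (intro add_pos_nonneg) auto
    fix w f
    assume w: "w \<in> lists \<Lambda>" and f: "f \<noteq> (0 :: int, 0 :: int ^ 'd)"
      and trap: "\<And>v. wsize w v \<le> (1 + (1 + D) / (\<tau> * rmin)) * lam w \<Longrightarrow> int_form f v = 0"
    have l: "0 < lam w" using lam_pos[OF w] .
    have "(\<Sum>u\<in>stop \<tau>. rw u powr t * lam (w @ u) powr (- c))
       \<le> (\<Sum>u\<in>stop \<tau>. (rw u powr s * gain w u powr (- c)) * (\<tau> powr \<kappa> * lam w powr (- c)))"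
    proof (rule sum_mono)
      fix u assume u: "u \<in> stop \<tau>"
      have ul: "u \<in> lists \<Lambda>" using stop_lists[OF u] .
      have pu: "0 < rw u" using rw_pos[OF ul] .
      have g: "0 < gain w u" using gain_pos[OF w ul] .
      have "lam (w @ u) = gain w u * rw u powr (- 1 / (d + 1)) * lam w"
        using lam_ratio_eq_gain[OF w ul] l by (simp add: field_simps)
      then have "lam (w @ u) powr (- c) = gain w u powr (- c) * rw u powr (c / (d + 1)) * lam w powr (- c)"
        by (simp add: powr_mult powr_powr)
      then have "rw u powr t * lam (w @ u) powr (- c)
          = (rw u powr (t + c / (d + 1))) * (gain w u powr (- c) * lam w powr (- c))"
        by (simp add: powr_add)
      also have "t + c / (d + 1) = s + \<kappa>" by (simp add: \<kappa>_def)
      also have "rw u powr (s + \<kappa>) = rw u powr s * rw u powr \<kappa>" by (rule powr_add)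
      also have "rw u powr s * rw u powr \<kappa> * (gain w u powr (- c) * lam w powr (- c))
         \<le> rw u powr s * \<tau> powr \<kappa> * (gain w u powr (- c) * lam w powr (- c))"
        using stop_le[OF u] pu \<kappa> by (intro mult_right_mono mult_left_mono powr_mono2) auto
      finally show "rw u powr t * lam (w @ u) powr (- c)
        \<le> (rw u powr s * gain w u powr (- c)) * (\<tau> powr \<kappa> * lam w powr (- c))" by (simp add: mult_ac)
    qed
    also have "\<dots> = (\<Sum>u\<in>stop \<tau>. rw u powr s * gain w u powr (- c)) * (\<tau> powr \<kappa> * lam w powr (- c))"
      by (simp add: sum_distrib_right)
    also have "\<dots> \<le> (2 powr c + C * (real J)\<^sup>2) * (\<tau> powr \<kappa> * lam w powr (- c))"
      using C(2)[OF \<tau>(1) w f aJ trap] by (intro mult_right_mono) auto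
    also have "\<dots> = (\<tau> powr \<kappa> * (2 powr c + C * (real J)\<^sup>2)) * lam w powr (- c)" by (simp add: mult_ac)
    also have "\<dots> \<le> 1 / 2 * lam w powr (- c)" using small' by (intro mult_right_mono) auto
    finally show "(\<Sum>u\<in>stop \<tau>. rw u powr t * lam (w @ u) powr (- c)) \<le> 1 / 2 * lam w powr (- c)" .
  qed
qed

end

section \<open>The dimension of the singular vectors\<close>

context vector_ifs
begin

text \<open>Fixing r0 makes trapping uniform over the set, so that every cylinder of ratio at most
  r0 meeting it satisfies the trapping hypothesis.\<close>

definition trapped_below :: "real \<Rightarrow> real \<Rightarrow> (real ^ 'd) set" where
  "trapped_below A r0 = {x \<in> K. \<forall>r. 0 < r \<longrightarrow> r \<le> r0 \<longrightarrow> trapped A x r}"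

text \<open>One trapped point traps the base point of its cylinder, since sizes within the cylinder
  differ by a factor of at most 2 + D. The bound on \<open>lam\<close> replaces the threshold B
  \<open>lam w\<close> by one independent of w.\<close>

lemma trapped_cylinder:
  assumes w: "w \<in> lists \<Lambda>" and B: "0 < B" and x: "x \<in> hw w ` K"
    and t: "trapped ((2 + D) * (B * (2 ^ CARD('d) + d))) x (rw w)"
  obtains f where "f \<noteq> (0, 0)" "\<And>v. wsize w v \<le> B * lam w \<Longrightarrow> int_form f v = 0"
proof -
  obtain f where f: "f \<noteq> (0, 0)"
    "\<And>v. approx_size x (rw w) v \<le> (2 + D) * (B * (2 ^ CARD('d) + d)) \<Longrightarrow> int_form f v = 0"
    using t unfolding trapped_def by blast
  obtain y where y: "y \<in> K" "x = hw w y" using x by blast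
  have "dist (hw w x0) x \<le> D * rw w"
    using dist_hw[OF w, of x0 y] dist_K_le[OF x0 y(1)] rw_pos[OF w] y(2) by (simp add: mult.commute)
  note near = approx_size_le_mult_of_near[OF rw_pos[OF w] this D_nonneg]
  show thesis
  proof (rule that[OF f(1)])
    fix v assume v: "wsize w v \<le> B * lam w"
    have "approx_size x (rw w) v \<le> (2 + D) * wsize w v" unfolding wsize_def by (rule near)
    also have "\<dots> \<le> (2 + D) * (B * (2 ^ CARD('d) + d))"
      using D_nonneg B lam_le_const[OF w] by (intro mult_left_mono order_trans[OF v]) auto
    finally show "int_form f v = 0" by (rule f(2))
  qed
qed

text \<open>The invariant of the iteration. The sum bounded by m carries the weights
  \<open>lam v powr (- c)\<close>, since that is the quantity which contracts.\<close>

definition covers_by :: "(real ^ 'd) set \<Rightarrow> 'i list \<Rightarrow> real \<Rightarrow> real \<Rightarrow> real \<Rightarrow> 'i list set \<Rightarrow> bool" where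
  "covers_by E w t \<epsilon> m T \<longleftrightarrow> finite T \<and> T \<subseteq> lists \<Lambda> \<and> E \<inter> hw w ` K \<subseteq> (\<Union>v\<in>T. hw v ` K) \<and>
     (\<forall>v\<in>T. rw v \<le> \<epsilon>) \<and> (\<Sum>v\<in>T. rw v powr t * lam v powr (- c)) \<le> m"

lemma covers_byD:
  assumes "covers_by E w t \<epsilon> m T"
  shows "finite T" "T \<subseteq> lists \<Lambda>" "E \<inter> hw w ` K \<subseteq> (\<Union>v\<in>T. hw v ` K)" "v \<in> T \<Longrightarrow> rw v \<le> \<epsilon>"
    "(\<Sum>v\<in>T. rw v powr t * lam v powr (- c)) \<le> m"
  using assms by (auto simp: covers_by_def)

text \<open>Only cylinders meeting E are subdivided: a point of E in the cylinder supplies the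
  trapping form and hence the contraction. All others are covered by the empty family.\<close>

lemma iterated_contraction:
  assumes \<tau>: "0 < \<tau>" "\<tau> < 1" and B: "0 < B"
    and contr: "\<And>w f. w \<in> lists \<Lambda> \<Longrightarrow> f \<noteq> (0, 0) \<Longrightarrow>
     (\<And>v. wsize w v \<le> B * lam w \<Longrightarrow> int_form f v = 0) \<Longrightarrow>
     (\<Sum>u\<in>stop \<tau>. rw u powr t * lam (w @ u) powr (- c)) \<le> 1 / 2 * lam w powr (- c)"
    and E: "E = trapped_below ((2 + D) * (B * (2 ^ CARD('d) + d))) r0"
    and w: "w \<in> lists \<Lambda>" "rw w \<le> r0"
  shows "\<exists>T. covers_by E w t (\<tau> ^ n * rw w) ((1 / 2) ^ n * (rw w powr t * lam w powr (- c))) T"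
  using w
proof (induction n arbitrary: w)
  case 0
  then show ?case by (intro exI[of _ "{w}"]) (auto simp: covers_by_def)
next
  case (Suc n)
  show ?case
  proof (cases "E \<inter> hw w ` K = {}")
    case True
    then show ?thesis by (intro exI[of _ "{}"]) (auto simp: covers_by_def)
  next
    case False
    then obtain x where x: "x \<in> E" "x \<in> hw w ` K" by blast
    have pw: "0 < rw w" using rw_pos[OF Suc.prems(1)] .
    have "trapped ((2 + D) * (B * (2 ^ CARD('d) + d))) x (rw w)"
      using x(1) pw Suc.prems(2) by (simp add: E trapped_below_def)
    then obtain f where "f \<noteq> (0, 0)" "\<And>v. wsize w v \<le> B * lam w \<Longrightarrow> int_form f v = 0"
      using trapped_cylinder[OF Suc.prems(1) B x(2)] by blast
    then have half: "(\<Sum>u\<in>stop \<tau>. rw u powr t * lam (w @ u) powr (- c)) \<le> 1 / 2 * lam w powr (- c)"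
      by (rule contr[OF Suc.prems(1)])
    have fin: "finite (stop \<tau>)" by (rule finite_stop[OF \<tau>(1)])
    have wul: "w @ u \<in> lists \<Lambda>" if "u \<in> stop \<tau>" for u using Suc.prems(1) stop_lists[OF that] by simp
    have pu: "0 < rw u" if "u \<in> stop \<tau>" for u using rw_pos stop_lists that by blast
    have wur: "rw (w @ u) \<le> r0" if "u \<in> stop \<tau>" for u
    proof -
      have "rw (w @ u) \<le> rw w" using rw_prefix_le[OF wul[OF that], of w] by simp
      then show ?thesis using Suc.prems(2) by linarith
    qed
    have "\<forall>u\<in>stop \<tau>. \<exists>T. covers_by E (w @ u) t (\<tau> ^ n * rw (w @ u))
        ((1 / 2) ^ n * (rw (w @ u) powr t * lam (w @ u) powr (- c))) T"
      by (intro ballI Suc.IH wul wur)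
    then obtain T where "\<forall>u\<in>stop \<tau>. covers_by E (w @ u) t (\<tau> ^ n * rw (w @ u))
        ((1 / 2) ^ n * (rw (w @ u) powr t * lam (w @ u) powr (- c))) (T u)"
      by (rule exE[OF bchoice])
    note T = covers_byD[OF bspec[OF this]]
    let ?T = "\<Union>u\<in>stop \<tau>. T u"
    have "finite ?T" using fin T(1) by blast
    moreover have "?T \<subseteq> lists \<Lambda>" using T(2) by blast
    moreover have "E \<inter> hw w ` K \<subseteq> (\<Union>v\<in>?T. hw v ` K)"
    proof
      fix y assume y: "y \<in> E \<inter> hw w ` K"
      then obtain u where u: "u \<in> stop \<tau>" "y \<in> hw (w @ u) ` K"
        using cylinder_subset_stop[OF Suc.prems(1) \<tau>] by blast
      then have "y \<in> (\<Union>v\<in>T u. hw v ` K)" using T(3)[OF u(1)] y by blast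
      then show "y \<in> (\<Union>v\<in>?T. hw v ` K)" using u(1) by blast
    qed
    moreover have "rw v \<le> \<tau> ^ Suc n * rw w" if v: "v \<in> ?T" for v
    proof -
      obtain u where u: "u \<in> stop \<tau>" "v \<in> T u" using v by blast
      have "rw v \<le> \<tau> ^ n * (rw w * rw u)" using T(4)[OF u] by simp
      also have "\<dots> \<le> \<tau> ^ n * (rw w * \<tau>)"
        using stop_le[OF u(1)] pw \<tau>(1) by (intro mult_left_mono) auto
      finally show ?thesis by (simp add: mult_ac)
    qed
    moreover have "(\<Sum>v\<in>?T. rw v powr t * lam v powr (- c)) \<le> (1 / 2) ^ Suc n * (rw w powr t * lam w powr (- c))"
    proof -
      have "(\<Sum>v\<in>?T. rw v powr t * lam v powr (- c)) \<le> (\<Sum>u\<in>stop \<tau>. \<Sum>v\<in>T u. rw v powr t * lam v powr (- c))"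
        using fin T(1) by (intro sum_UN_le) auto
      also have "\<dots> \<le> (\<Sum>u\<in>stop \<tau>. (1 / 2) ^ n * (rw (w @ u) powr t * lam (w @ u) powr (- c)))"
        by (intro sum_mono T(5))
      also have "\<dots> = (1 / 2) ^ n * rw w powr t * (\<Sum>u\<in>stop \<tau>. rw u powr t * lam (w @ u) powr (- c))"
        unfolding sum_distrib_left by (intro sum.cong refl) (simp add: powr_mult mult_ac)
      also have "\<dots> \<le> (1 / 2) ^ n * rw w powr t * (1 / 2 * lam w powr (- c))"
        using half by (intro mult_left_mono) auto
      finally show ?thesis by (simp add: mult_ac)
    qed
    ultimately have "covers_by E w t (\<tau> ^ Suc n * rw w) ((1 / 2) ^ Suc n * (rw w powr t * lam w powr (- c))) ?T"
      unfolding covers_by_def by (intro conjI ballI)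
    then show ?thesis by (rule exI)
  qed
qed

text \<open>As \<open>lam\<close> is bounded above, \<open>lam v powr (- c)\<close> is bounded below
  by a positive constant, so halving the weighted sums n times makes the plain t-sums of the covers
  arbitrarily small. The level A is fixed before r0.\<close>

lemma hausdorff_outer_measure_trapped_below_null:
  assumes t: "s - c / (d + 1) < t" "0 < t"
  obtains A where "0 < A" "\<And>r0. 0 < r0 \<Longrightarrow> hausdorff_outer_measure t (trapped_below A r0) = 0"
proof (rule contraction[OF t(1)])
  fix \<tau> B :: real
  assume \<tau>: "0 < \<tau>" "\<tau> < 1" and B: "0 < B" and contr: "\<And>w f. w \<in> lists \<Lambda> \<Longrightarrow> f \<noteq> (0, 0) \<Longrightarrow>
     (\<And>v. wsize w v \<le> B * lam w \<Longrightarrow> int_form f v = 0) \<Longrightarrow>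
     (\<Sum>u\<in>stop \<tau>. rw u powr t * lam (w @ u) powr (- c)) \<le> 1 / 2 * lam w powr (- c)"
  let ?L = "2 ^ CARD('d) + d"
  have L: "0 < ?L" using d_ge_1 by (intro add_pos_pos) auto
  let ?A = "(2 + D) * (B * ?L)"
  show thesis
  proof (rule that[of ?A])
    show "0 < ?A" using D_nonneg B L by (intro mult_pos_pos) auto
    fix r0 :: real assume r0: "0 < r0"
    \<comment> \<open>The initial cylinders come from \<open>stop\<close>, which covers only at
      scales below 1.\<close>
    define r1 where "r1 = min r0 (1 / 2)"
    have r1: "0 < r1" "r1 < 1" "r1 \<le> r0" using r0 by (auto simp: r1_def)
    define E where "E = trapped_below ?A r0"
    have fin1: "finite (stop r1)" by (rule finite_stop[OF r1(1)])
    define S0 where "S0 = (\<Sum>w\<in>stop r1. rw w powr t * lam w powr (- c))"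
    let ?M = "(D + 1) powr t * ?L powr c * S0"
    have S0: "0 \<le> S0" unfolding S0_def by (intro sum_nonneg) auto
    show "hausdorff_outer_measure t (trapped_below ?A r0) = 0"
      unfolding E_def[symmetric]
    proof (rule hausdorff_outer_measure_null_of_finite_covers[OF t(2)])
      fix \<delta> e :: real assume \<delta>: "0 < \<delta>" and e: "0 < e"
      have "(\<lambda>n. \<tau> ^ n * (D + 1)) \<longlonglongrightarrow> 0" using \<tau> by (intro tendsto_mult_left_zero LIMSEQ_power_zero) simp
      then have "\<forall>\<^sub>F n in sequentially. \<tau> ^ n * (D + 1) < \<delta>" using \<delta> by (rule order_tendstoD)
      moreover have "(\<lambda>n. (1 / 2) ^ n * ?M) \<longlonglongrightarrow> 0" by (intro tendsto_mult_left_zero LIMSEQ_power_zero) simp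
      then have "\<forall>\<^sub>F n in sequentially. (1 / 2) ^ n * ?M < e" using e by (rule order_tendstoD)
      ultimately have "\<forall>\<^sub>F n in sequentially. \<tau> ^ n * (D + 1) < \<delta> \<and> (1 / 2) ^ n * ?M < e" by (rule eventually_conj)
      then obtain n where n: "\<tau> ^ n * (D + 1) < \<delta>" "(1 / 2) ^ n * ?M < e"
        using eventually_happens'[OF sequentially_bot] by blast
      have "\<forall>w\<in>stop r1. \<exists>T. covers_by E w t (\<tau> ^ n * rw w) ((1 / 2) ^ n * (rw w powr t * lam w powr (- c))) T"
      proof
        fix w assume w: "w \<in> stop r1"
        show "\<exists>T. covers_by E w t (\<tau> ^ n * rw w) ((1 / 2) ^ n * (rw w powr t * lam w powr (- c))) T"
          using stop_le[OF w] r1(3) by (intro iterated_contraction[OF \<tau> B contr E_def stop_lists[OF w]]) auto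
      qed
      then obtain T where "\<forall>w\<in>stop r1. covers_by E w t (\<tau> ^ n * rw w) ((1 / 2) ^ n * (rw w powr t * lam w powr (- c))) (T w)"
        by (rule exE[OF bchoice])
      note T = covers_byD[OF bspec[OF this]]
      let ?T = "\<Union>w\<in>stop r1. T w"
      let ?V = "\<lambda>v. hw v ` K"
      have finT: "finite ?T" using fin1 T(1) by blast
      have Tl: "v \<in> lists \<Lambda>" if "v \<in> ?T" for v using T(2) that by blast
      have "E \<subseteq> (\<Union>v\<in>?T. ?V v)"
      proof
        fix x assume x: "x \<in> E"
        then have "x \<in> K" by (simp add: E_def trapped_below_def)
        then obtain w where w: "w \<in> stop r1" "x \<in> hw w ` K" using cylinder_subset_stop[of "[]" r1] r1 by auto
        then obtain v where "v \<in> T w" "x \<in> hw v ` K" using T(3)[OF w(1)] x by blast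
        then show "x \<in> (\<Union>v\<in>?T. ?V v)" using w by blast
      qed
      moreover have "bounded (?V v) \<and> diameter (?V v) \<le> \<delta>" if v: "v \<in> ?T" for v
      proof -
        obtain w where w: "w \<in> stop r1" "v \<in> T w" using v by blast
        have "diameter (?V v) \<le> rw v * D" by (rule diameter_cylinder_le[OF Tl[OF v]])
        also have "\<dots> \<le> \<tau> ^ n * (D + 1)"
        proof (intro mult_mono)
          have "rw v \<le> \<tau> ^ n * rw w" by (rule T(4)[OF w])
          also have "\<dots> \<le> \<tau> ^ n" using \<tau> rw_le_1[OF stop_lists[OF w(1)]] by (simp add: mult_left_le)
          finally show "rw v \<le> \<tau> ^ n" .
        qed (use \<tau> D_nonneg in auto)
        finally show ?thesis using n(1) bounded_cylinder[OF Tl[OF v]] by simp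
      qed
      moreover have "(\<Sum>v\<in>?T. diameter (?V v) powr t) \<le> e"
      proof -
        have "(\<Sum>v\<in>?T. diameter (?V v) powr t) \<le> (\<Sum>v\<in>?T. ((D + 1) powr t * ?L powr c) * (rw v powr t * lam v powr (- c)))"
        proof (rule sum_mono)
          fix v assume v: "v \<in> ?T"
          have vl: "v \<in> lists \<Lambda>" by (rule Tl[OF v])
          have pv: "0 < rw v" "0 < lam v" using rw_pos[OF vl] lam_pos[OF vl] .
          have "diameter (?V v) \<le> rw v * (D + 1)"
            using diameter_cylinder_le[OF vl] pv(1) by (simp add: algebra_simps)
          then have "diameter (?V v) powr t \<le> (rw v * (D + 1)) powr t"
            using t(2) bounded_cylinder[OF vl] by (intro powr_mono2 diameter_ge_0) auto
          also have "\<dots> = (D + 1) powr t * rw v powr t * 1" by (simp add: powr_mult mult.commute)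
          also have "\<dots> \<le> (D + 1) powr t * rw v powr t * (?L powr c * lam v powr (- c))"
          proof (rule mult_left_mono)
            have "lam v powr c \<le> ?L powr c" using lam_le_const[OF vl] pv(2) c_pos by (intro powr_mono2) auto
            then show "1 \<le> ?L powr c * lam v powr (- c)" using pv(2) by (simp add: powr_minus field_simps)
          qed simp
          finally show "diameter (?V v) powr t \<le> ((D + 1) powr t * ?L powr c) * (rw v powr t * lam v powr (- c))"
            by (simp add: mult_ac)
        qed
        also have "\<dots> = ((D + 1) powr t * ?L powr c) * (\<Sum>v\<in>?T. rw v powr t * lam v powr (- c))"
          by (simp add: sum_distrib_left)
        also have "\<dots> \<le> ((D + 1) powr t * ?L powr c) * ((1 / 2) ^ n * S0)"
        proof (rule mult_left_mono)
          have "(\<Sum>v\<in>?T. rw v powr t * lam v powr (- c)) \<le> (\<Sum>w\<in>stop r1. \<Sum>v\<in>T w. rw v powr t * lam v powr (- c))"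
            using fin1 T(1) by (intro sum_UN_le) auto
          also have "\<dots> \<le> (\<Sum>w\<in>stop r1. (1 / 2) ^ n * (rw w powr t * lam w powr (- c)))"
            by (intro sum_mono T(5))
          also have "\<dots> = (1 / 2) ^ n * S0" by (simp add: S0_def sum_distrib_left)
          finally show "(\<Sum>v\<in>?T. rw v powr t * lam v powr (- c)) \<le> (1 / 2) ^ n * S0" .
        qed simp
        also have "\<dots> = (1 / 2) ^ n * ?M" by (simp add: mult_ac)
        finally show ?thesis using n(2) by linarith
      qed
      ultimately show "\<exists>T (V :: 'i list \<Rightarrow> (real ^ 'd) set). finite T \<and> E \<subseteq> (\<Union>v\<in>T. V v) \<and>
         (\<forall>v\<in>T. bounded (V v) \<and> diameter (V v) \<le> \<delta>) \<and> (\<Sum>v\<in>T. diameter (V v) powr t) \<le> e"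
        using finT by (intro exI[of _ ?T] exI[of _ ?V]) simp
    qed
  qed
qed

lemma hausdorff_dim_Sing_le: "hausdorff_dim (Sing \<inter> K) \<le> ereal (s - c / (d + 1))"
proof (rule hausdorff_dim_le)
  \<comment> \<open>The claimed dimension must be nonnegative, since the exponents in the definition
    of the dimension are; this identity and s \<le> d give c \<le> s.\<close>
  have "s - c = (d - 1) * (d - s)" by (simp add: c_def \<alpha>_def algebra_simps)
  then have "c \<le> s" using d_ge_1 s_le by (metis diff_ge_0_iff_ge mult_nonneg_nonneg)
  moreover have "c / (d + 1) \<le> c" using d_ge_1 c_pos by (simp add: field_simps)
  ultimately show nn: "0 \<le> s - c / (d + 1)" by linarith
  fix t assume t: "s - c / (d + 1) < t"
  then have "0 < t" using nn by linarith
  then obtain A where A: "0 < A" "\<And>r0. 0 < r0 \<Longrightarrow> hausdorff_outer_measure t (trapped_below A r0) = 0"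
    using hausdorff_outer_measure_trapped_below_null[OF t] by blast
  have "Sing \<inter> K \<subseteq> (\<Union>m. trapped_below A (1 / real (Suc m)))"
  proof
    fix x assume x: "x \<in> Sing \<inter> K"
    then obtain r0 where r0: "0 < r0" "\<And>r. 0 < r \<Longrightarrow> r \<le> r0 \<Longrightarrow> trapped A x r"
      using singular_vector_trapped[OF _ A(1)] by (auto simp: Sing_def)
    obtain m where "1 / real (Suc m) < r0" using nat_approx_posE[OF r0(1)] by blast
    then have "x \<in> trapped_below A (1 / real (Suc m))" using x r0(2) by (auto simp: trapped_below_def)
    then show "x \<in> (\<Union>m. trapped_below A (1 / real (Suc m)))" by blast
  qed
  then have "hausdorff_outer_measure t (Sing \<inter> K) \<le> hausdorff_outer_measure t (\<Union>m. trapped_below A (1 / real (Suc m)))"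
    by (rule hausdorff_outer_measure_mono)
  also have "\<dots> = 0" by (intro hausdorff_outer_measure_UN_null A(2)) simp
  finally show "hausdorff_outer_measure t (Sing \<inter> K) = 0" by simp
qed

end

theorem corollary1p6:
  fixes \<Lambda> :: "'i set"
    and h :: "'i \<Rightarrow> real ^ 'd \<Rightarrow> real ^ 'd"
    and K :: "(real ^ 'd) set"
    and \<mu> :: "(real ^ 'd) measure"
    and s d :: real
  assumes "d = real CARD('d)"
    and "is_IFS \<Lambda> h"
    and "open_set_condition \<Lambda> h"
    and "is_limit_set \<Lambda> h K"
    and "hausdorff_dim K = ereal s"
    and "\<mu> = restrict_measure_to (hausdorff_measure s) K"
    and "s > d - 1"
  shows "(\<forall>l::nat. 1 \<le> l \<and> l \<le> CARD('d) \<longrightarrow> alpha_exp l \<mu> \<ge> ereal (s - d + real l)) \<and>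
         hausdorff_dim (Sing \<inter> K) \<le> ereal (s - d * (s - d + 1) / (d + 1))"
proof -
  have "\<exists>r. 0 < r \<and> r < 1 \<and> (\<exists>g b. orthogonal_transformation g \<and> (\<forall>x. h i x = r *\<^sub>R g x + b))"
    if i: "i \<in> \<Lambda>" for i
  proof -
    obtain r :: real and Q :: "real ^ 'd ^ 'd" and b where r: "0 < r" "r < 1" and Q: "rotation_matrix Q"
      and hi: "\<And>x. h i x = r *\<^sub>R (Q *v x) + b" 
      using conjunct2[OF assms(2)[unfolded is_IFS_def], rule_format, OF i] by (elim exE conjE) auto
    have "orthogonal_transformation ((*v) Q)"
      using Q unfolding rotation_matrix_def by (simp add: orthogonal_transformation_matrix)
    then show ?thesis using r hi by blast
  qed
  then obtain \<rho> where \<rho>: "\<And>i. i \<in> \<Lambda> \<Longrightarrow> 0 < \<rho> i \<and> \<rho> i < 1 \<and>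
      (\<exists>g b. orthogonal_transformation g \<and> (\<forall>x. h i x = \<rho> i *\<^sub>R g x + b))" by metis
  obtain U where U: "open U" "U \<noteq> {}" "\<And>i. i \<in> \<Lambda> \<Longrightarrow> h i ` U \<subseteq> U"
    "\<And>i j. i \<in> \<Lambda> \<Longrightarrow> j \<in> \<Lambda> \<Longrightarrow> i \<noteq> j \<Longrightarrow> h i ` U \<inter> h j ` U = {}"
    using assms(3) unfolding open_set_condition_def by metis
  have K: "K \<noteq> {}" "compact K" "K = (\<Union>i\<in>\<Lambda>. h i ` K)" using assms(4) by (auto simp: is_limit_set_def)
  interpret similarity_ifs \<Lambda> h \<rho> K U
    by unfold_locales (use assms(2) \<rho> U K in \<open>auto simp: is_IFS_def\<close>)
  have "0 < CARD('d)" by simp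
  then have d1: "1 \<le> d" unfolding assms(1) by linarith
  then have s0: "0 < s" using assms(7) by linarith
  have sum1: "(\<Sum>i\<in>\<Lambda>. \<rho> i powr s) \<le> 1" by (rule sum_ratio_powr_dim_le_1[OF assms(5) s0])
  have sd: "s \<le> d" using hausdorff_dim_le_DIM assms(1,5) by simp
  obtain x0 where "x0 \<in> K" using K(1) by blast
  then interpret vector_ifs \<Lambda> h \<rho> K U s d x0
    by unfold_locales (use sum1 sd assms(1,7) in auto)
  show ?thesis
  proof (intro conjI allI impI)
    fix l :: nat assume l: "1 \<le> l \<and> l \<le> CARD('d)"
    then have eq: "s - d + real l = s - real (CARD('d) - l)" by (simp add: of_nat_diff)
    show "ereal (s - d + real l) \<le> alpha_exp l \<mu>"
      unfolding alpha_exp_def eq by (rule Liminf_neighbourhood_exponent_ge[OF sum1 s0 assms(6)])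
  next
    show "hausdorff_dim (Sing \<inter> K) \<le> ereal (s - d * (s - d + 1) / (d + 1))"
      using hausdorff_dim_Sing_le by (simp add: c_def \<alpha>_def)
  qed
qed

end
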